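(* For $d\ge2$, fix $s>\frac d2+1$. Assume that $\theta_0,S\in H^s(\mathbb{T}^d)$ have zero mean on $\mathbb{T}^d$. Then for $\nu=0$, under the assumptions A1, A2 and A5$_2$, there exist a $T>0$ and a unique smooth solution $\theta^0$ to (AS$_0$) such that $$\theta^0\in L^\infty(0,T;H^s(\mathbb{T}^d)).$$
   Context: Setting. Let $\mathbb{T}^d=[0,2\pi]^d$ with periodic boundary conditions. For $\nu\ge0$, (AS$_\nu$) denotes the problem $$\partial_t\theta^\nu+u^\nu\cdot\nabla\theta^\nu=S,\qquad u^\nu_j=\partial_{x_i}T^\nu_{ij}[\theta^\nu]\ (\text{summed over } i),\qquad \theta^\nu(x,0)=\theta_0(x),$$ where $S=S(x)$ is a given time-independent forcing, and (AS$_0$) is the case $\nu=0$. Standing assumption: $\int_{\mathbb{T}^d}\theta^\nu(x,t)\,dx=\int_{\mathbb{T}^d}S(x)\,dx=0$ for all $t\ge0$. $\{T^\nu_{ij}\}_{\nu\ge0}$, $1\le i,j\le d$, is a given family of Fourier multiplier operators with symbols $\widehat T^\nu_{ij}(k)$, $k\in\mathbb{Z}^d$. $H^s=W^{s,2}$. Assumptions: A1: $\partial_i\partial_jT^\nu_{ij}f=0$ (repeated indices summed) for all smooth $f$ and all $\nu\ge0$. A2: $T^\nu_{ij}:L^\infty(\mathbb{T}^d)\to BMO(\mathbb{T}^d)$ is bounded for all $\nu\ge0$. A5$_2$: there is $C_0>0$ independent of $\nu$ such that for all $1\le i,j\le d$, $\sup_{\nu\in(0,1]}\sup_{k\in\mathbb{Z}^d}|k_i\widehat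 T^\nu_{ij}(k)|\le C_0$ and $\sup_{k\in\mathbb{Z}^d}|k_i\widehat T^0_{ij}(k)|\le C_0$. *)

theory Defs
  imports "HOL-Analysis.Analysis"
begin

text \<open>
  Functions on the torus are real-valued functions on \<^typ>\<open>real^'d\<close> that are
  \<open>2\<pi>\<close>-periodic in every coordinate; integrals are taken over the fundamental cell
  \<open>[0,2\<pi>]\<^sup>d\<close>. The dimension is \<open>d = CARD('d)\<close> and frequencies are elements of
  \<^typ>\<open>int^'d\<close>. Elements of Lebesgue-type spaces are represented by measurable functions, not by
  equivalence classes, so data are only ever compared almost everywhere.
\<close>

definition torus_cell :: "(real^'d) set" where
  "torus_cell = cbox 0 (\<chi> i. 2 * pi)"

definition periodic :: "(real^'d \<Rightarrow> 'b) \<Rightarrow> bool" where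
  "periodic f \<longleftrightarrow> (\<forall>x i. f (x + (2 * pi) *\<^sub>R axis i 1) = f x)"

definition torus_L1 :: "(real^'d \<Rightarrow> real) set" where
  "torus_L1 = {f. periodic f \<and> f \<in> borel_measurable lebesgue \<and> set_integrable lebesgue torus_cell f}"

definition torus_L2 :: "(real^'d \<Rightarrow> real) set" where
  "torus_L2 = {f. periodic f \<and> f \<in> borel_measurable lebesgue \<and>
     set_integrable lebesgue torus_cell (\<lambda>x. (f x)\<^sup>2)}"

definition torus_Linf :: "(real^'d \<Rightarrow> real) set" where
  "torus_Linf = {f. periodic f \<and> f \<in> borel_measurable lebesgue \<and>
     (\<exists>B. AE x in lebesgue. \<bar>f x\<bar> \<le> B)}"

definition Linf_norm :: "(real^'d \<Rightarrow> real) \<Rightarrow> real" where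
  "Linf_norm f = Inf {B. 0 \<le> B \<and> (AE x in lebesgue. \<bar>f x\<bar> \<le> B)}"

definition zero_mean :: "(real^'d \<Rightarrow> real) \<Rightarrow> bool" where
  "zero_mean f \<longleftrightarrow> (LINT x:torus_cell|lebesgue. f x) = 0"


subsection \<open>Fourier coefficients and Sobolev spaces\<close>

definition freq_dot :: "int^'d \<Rightarrow> real^'d \<Rightarrow> real" where
  "freq_dot k x = (\<Sum>i\<in>UNIV. real_of_int (k $ i) * x $ i)"

definition fcoeff :: "(real^'d \<Rightarrow> real) \<Rightarrow> int^'d \<Rightarrow> complex" where
  "fcoeff f k = (LINT x:torus_cell|lebesgue. complex_of_real (f x) * cis (- freq_dot k x))
                  / (2 * pi) ^ CARD('d)"

text \<open>\<open>(1 + |k|\<^sup>2)\<^sup>s |f\<^sub>k|\<^sup>2\<close>, the summand of the squared \<open>H\<^sup>s\<close>-norm.\<close>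

definition Hs_weight :: "real \<Rightarrow> (real^'d \<Rightarrow> real) \<Rightarrow> int^'d \<Rightarrow> real" where
  "Hs_weight s f k = (1 + (\<Sum>i\<in>UNIV. (real_of_int (k $ i))\<^sup>2)) powr s * (cmod (fcoeff f k))\<^sup>2"

text \<open>\<open>H\<^sup>s = W\<^sup>s\<^sup>,\<^sup>2\<close> for real \<open>s \<ge> 0\<close>.\<close>

definition Hs :: "real \<Rightarrow> (real^'d \<Rightarrow> real) set" where
  "Hs s = {f \<in> torus_L2. Hs_weight s f summable_on UNIV}"

definition Hs_norm :: "real \<Rightarrow> (real^'d \<Rightarrow> real) \<Rightarrow> real" where
  "Hs_norm s f = sqrt (\<Sum>\<^sub>\<infinity>k. Hs_weight s f k)"

definition simple_Hs :: "real \<Rightarrow> real \<Rightarrow> (real \<Rightarrow> real^'d \<Rightarrow> real) \<Rightarrow> bool" where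
  "simple_Hs T s \<phi> \<longleftrightarrow> finite (\<phi> ` {0<..<T}) \<and> \<phi> ` {0<..<T} \<subseteq> Hs s \<and>
     (\<forall>g. {t \<in> {0<..<T}. \<phi> t = g} \<in> sets lebesgue)"

text \<open>
  \<open>L\<^sup>\<infinity>(0,T;H\<^sup>s)\<close>: essentially bounded, strongly (Bochner) measurable, i.e. an almost everywhere
  limit in \<open>H\<^sup>s\<close> of simple functions.
\<close>

definition Linf_Hs :: "real \<Rightarrow> real \<Rightarrow> (real \<Rightarrow> real^'d \<Rightarrow> real) set" where
  "Linf_Hs T s = {\<theta>.
     (\<exists>M. AE t in lebesgue_on {0<..<T}. \<theta> t \<in> Hs s \<and> Hs_norm s (\<theta> t) \<le> M) \<and>
     (\<exists>\<phi> :: nat \<Rightarrow> real \<Rightarrow> real^'d \<Rightarrow> real.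
        (\<forall>n. simple_Hs T s (\<phi> n)) \<and>
        (AE t in lebesgue_on {0<..<T}.
           (\<lambda>n. Hs_norm s (\<lambda>x. \<phi> n t x - \<theta> t x)) \<longlonglongrightarrow> 0))}"


subsection \<open>BMO\<close>

definition avg :: "(real^'d) set \<Rightarrow> (real^'d \<Rightarrow> real) \<Rightarrow> real" where
  "avg A f = (LINT x:A|lebesgue. f x) / measure lebesgue A"

definition mean_osc :: "(real^'d \<Rightarrow> real) \<Rightarrow> (real^'d) set \<Rightarrow> real" where
  "mean_osc f A = avg A (\<lambda>x. \<bar>f x - avg A f\<bar>)"

definition torus_cubes :: "(real^'d) set set" where
  "torus_cubes = {cbox a (a + (\<chi> i. r)) | a r. 0 < r \<and> r \<le> 2 * pi}"

definition BMO :: "(real^'d \<Rightarrow> real) set" where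
  "BMO = {f \<in> torus_L1. bdd_above (mean_osc f ` torus_cubes)}"

text \<open>A seminorm, vanishing on constants, as usual for \<open>BMO\<close>.\<close>

definition BMO_norm :: "(real^'d \<Rightarrow> real) \<Rightarrow> real" where
  "BMO_norm f = (SUP Q\<in>torus_cubes. mean_osc f Q)"


subsection \<open>Smooth functions\<close>

definition pd :: "'d \<Rightarrow> (real^'d \<Rightarrow> real) \<Rightarrow> real^'d \<Rightarrow> real" where
  "pd i f x = frechet_derivative f (at x) (axis i 1)"

primrec Ck :: "nat \<Rightarrow> (real^'d \<Rightarrow> real) \<Rightarrow> bool" where
  "Ck 0 f \<longleftrightarrow> continuous_on UNIV f"
| "Ck (Suc n) f \<longleftrightarrow> (\<forall>x. f differentiable (at x)) \<and> (\<forall>i. Ck n (pd i f))"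

definition smooth_fun :: "(real^'d \<Rightarrow> real) \<Rightarrow> bool" where
  "smooth_fun f \<longleftrightarrow> (\<forall>n. Ck n f)"

text \<open>Continuously differentiable in \<open>(t,x)\<close> on \<open>[0,T] \<times> \<real>\<^sup>d\<close>, one-sidedly in time at the end points.\<close>

definition C1_strip :: "real \<Rightarrow> (real \<Rightarrow> real^'d \<Rightarrow> real) \<Rightarrow> bool" where
  "C1_strip T \<theta> \<longleftrightarrow>
     (\<exists>D :: real \<times> (real^'d) \<Rightarrow> (real \<times> (real^'d)) \<Rightarrow>\<^sub>L real.
        continuous_on ({0..T} \<times> UNIV) D \<and>
        (\<forall>p \<in> {0..T} \<times> UNIV.
           ((\<lambda>(t, x). \<theta> t x) has_derivative blinfun_apply (D p)) (at p within {0..T} \<times> UNIV)))"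


subsection \<open>Fourier multipliers and the assumptions on them\<close>

text \<open>
  \<open>mult m f g\<close> says that \<open>g\<close> is the image of \<open>f\<close> under the Fourier multiplier operator with
  symbol \<open>m\<close>; this determines \<open>g\<close> up to a null set. Both functions are real-valued, so the existence
  of images entails the symmetry \<open>m (- k) = cnj (m k)\<close>.
\<close>

definition mult :: "(int^'d \<Rightarrow> complex) \<Rightarrow> (real^'d \<Rightarrow> real) \<Rightarrow> (real^'d \<Rightarrow> real) \<Rightarrow> bool" where
  "mult m f g \<longleftrightarrow> f \<in> torus_L1 \<and> g \<in> torus_L1 \<and> (\<forall>k. fcoeff g k = m k * fcoeff f k)"

text \<open>
  A family of operators is given by its symbols: \<open>m \<nu> i j k\<close> is the symbol of the operator with
  parameter \<open>\<nu> \<ge> 0\<close> and indices \<open>i, j\<close> at the frequency \<open>k\<close>. Values at \<open>\<nu> < 0\<close> are irrelevant.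
\<close>

type_synonym 'd symbols = "real \<Rightarrow> 'd \<Rightarrow> 'd \<Rightarrow> int^'d \<Rightarrow> complex"

text \<open>
  The images of a smooth function are asked to be smooth, so that the second derivatives are
  classical. For families satisfying \<open>Linf_to_BMO_bounded\<close> below this is no restriction: testing
  on trigonometric functions shows that each symbol is bounded in \<open>k\<close>.
\<close>

definition divergence_free :: "'d::finite symbols \<Rightarrow> bool" where
  "divergence_free m \<longleftrightarrow> (\<forall>\<nu>\<ge>0. \<forall>f. periodic f \<and> smooth_fun f \<longrightarrow>
     (\<exists>g. (\<forall>i j. mult (m \<nu> i j) f (g i j) \<and> smooth_fun (g i j)) \<and>
          (\<forall>x. (\<Sum>i\<in>UNIV. \<Sum>j\<in>UNIV. pd i (pd j (g i j)) x) = 0)))"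

definition Linf_to_BMO_bounded :: "'d::finite symbols \<Rightarrow> bool" where
  "Linf_to_BMO_bounded m \<longleftrightarrow> (\<forall>\<nu>\<ge>0. \<forall>i j. \<exists>C. \<forall>f\<in>torus_Linf.
     \<exists>g\<in>BMO. mult (m \<nu> i j) f g \<and> BMO_norm g \<le> C * Linf_norm f)"

text \<open>There is no summation over \<open>i\<close> here.\<close>

definition gradient_bounded :: "'d::finite symbols \<Rightarrow> bool" where
  "gradient_bounded m \<longleftrightarrow> (\<exists>C0>0. \<forall>i j.
     (\<forall>\<nu>\<in>{0<..1}. \<forall>k. cmod (of_int (k $ i) * m \<nu> i j k) \<le> C0) \<and>
     (\<forall>k. cmod (of_int (k $ i) * m 0 i j k) \<le> C0))"


subsection \<open>The active scalar equation\<close>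

text \<open>\<open>u\<^sub>j = \<Sum>\<^sub>i \<partial>\<^sub>i T\<^sub>i\<^sub>j[f]\<close>, where \<open>\<tau> i j\<close> is the differentiable representative of \<open>T\<^sub>i\<^sub>j[f]\<close>.\<close>

definition velocity ::
  "('d::finite \<Rightarrow> 'd \<Rightarrow> int^'d \<Rightarrow> complex) \<Rightarrow> (real^'d \<Rightarrow> real) \<Rightarrow> (real^'d \<Rightarrow> real^'d) \<Rightarrow> bool" where
  "velocity m f u \<longleftrightarrow>
     (\<exists>\<tau>. (\<forall>i j. mult (m i j) f (\<tau> i j) \<and> (\<forall>x. \<tau> i j differentiable (at x))) \<and>
          (\<forall>x j. u x $ j = (\<Sum>i\<in>UNIV. pd i (\<tau> i j) x)))"

text \<open>
  Classical solutions on \<open>[0,T]\<close>. All derivatives are classical and exist everywhere; the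
  equation and the initial condition are required for almost every \<open>x\<close> only because \<open>S\<close> and
  \<open>\<theta>\<^sub>0\<close> are arbitrary representatives of their classes.
\<close>

definition AS_solution ::
  "'d::finite symbols \<Rightarrow> real \<Rightarrow> (real^'d \<Rightarrow> real) \<Rightarrow> (real^'d \<Rightarrow> real) \<Rightarrow> real
     \<Rightarrow> (real \<Rightarrow> real^'d \<Rightarrow> real) \<Rightarrow> bool" where
  "AS_solution m \<nu> S \<theta>0 T \<theta> \<longleftrightarrow>
     C1_strip T \<theta> \<and>
     (\<forall>t\<in>{0..T}. periodic (\<theta> t) \<and> zero_mean (\<theta> t)) \<and>
     (AE x in lebesgue. \<theta> 0 x = \<theta>0 x) \<and>
     (\<exists>u. \<forall>t\<in>{0..T}. velocity (m \<nu>) (\<theta> t) (u t) \<and>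
        (AE x in lebesgue.
           vector_derivative (\<lambda>r. \<theta> r x) (at t within {0..T})
             + (\<Sum>j\<in>UNIV. u t x $ j * pd j (\<theta> t) x) = S x))"

end

theory Submission
  imports Defs "HOL-Probability.Discrete_Topology"
begin

text \<open>
  On the torus the problem is an infinite system of ordinary differential equations for the Fourier
  coefficients \<open>a k\<close> of \<open>\<theta>\<close>. The assumption on \<open>k\<^sub>i T\<^sub>i\<^sub>j\<close> makes the velocity an operator of order zero
  in \<open>\<theta>\<close>: its coefficients are \<open>\<Lambda> j l * a l\<close> with \<open>\<Lambda>\<close> bounded. The system reads
  \<open>a' k = S k - Bil a a k\<close> with \<open>Bil a b k = (\<Sum>p. \<sigma> p (k - p) * a (k - p) * b p)\<close> and
  \<open>\<sigma> p l = (\<Sum>j. \<i> * p j * \<Lambda> j l)\<close>. Because the velocity is real and divergence free, \<open>\<sigma>\<close> is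
  skew-symmetric: the form \<open>\<Sum>k p. cnj (d k) * \<sigma> p (k - p) * a (k - p) * d p\<close> has no real part
  (\<open>transport_skew_symmetric\<close>). Everything rests on this cancellation.

  With the weights \<open>w k = (1 + |k|\<^sup>2) powr (s/2)\<close> the cancellation leaves only the commutator
  \<open>w k - w p\<close>, which gains the derivative that the transport term loses; since \<open>s > d/2 + 1\<close>,
  the sequence \<open>|p| a p\<close> is absolutely summable with a norm controlled by the \<open>H\<^sup>s\<close>-norm, and the
  growth of the energy is bounded by a function of the energy (\<open>energy_estimate\<close>). This gives a
  time of existence for all Galerkin truncations at once (\<open>galerkin_solution\<close>). Without weights the
  same cancellation controls the difference of two bounded solutions of the equations for the
  frequencies \<open>|k| \<le> n\<close>, up to an error that vanishes as \<open>n\<close> grows, uniformly in time (\<open>stability\<close>).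
  That one estimate shows that the Galerkin solutions converge (\<open>fourier_existence\<close>) and that
  solutions are unique (\<open>uniqueness\<close>).

  The rest is the translation between functions and coefficients. An integrable function is
  determined by its Fourier coefficients (\<open>fcoeff_zero_AE\<close>). A bound in \<open>H\<^sup>s\<close> that is uniform in time
  controls the tails of all the series that occur, including those of the first derivatives,
  uniformly in time and space, so that the series of a solution may be differentiated term by term
  (\<open>spacetime_C1\<close>). Conversely, the coefficients of a classical solution solve the system
  (\<open>solution_fourier\<close>). The symbols are bounded, hermitian and divergence free because of the
  action of the operators on \<open>cos (k \<bullet> x)\<close> (\<open>symbol_bounded_cnj\<close>, \<open>symbol_divfree\<close>).
\<close>

section \<open>Frequencies and sums over frequencies\<close>

definition fr :: "int^'d::finite \<Rightarrow> real^'d" where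
  "fr k = (\<chi> i. real_of_int (k $ i))"

text \<open>
  The bracket \<open>(1 + |k|\<^sup>2)\<^sup>1\<^sup>/\<^sup>2\<close>, written as a norm so that its subadditivity is a triangle
  inequality.
\<close>

definition jb :: "int^'d::finite \<Rightarrow> real" where
  "jb k = norm (1::real, fr k)"

lemma freq_dot_fr: "freq_dot k x = fr k \<bullet> x"
  by (simp add: freq_dot_def fr_def inner_vec_def)

lemma fr_add: "fr (k + l) = fr k + fr l"
  and fr_diff: "fr (k - l) = fr k - fr l"
  and fr_uminus: "fr (- k) = - fr k"
  and fr_zero [simp]: "fr 0 = 0"
  and fr_nth: "fr k $ i = real_of_int (k $ i)"
  by (simp_all add: fr_def vec_eq_iff)

lemma jb_eq: "jb k = sqrt (1 + (norm (fr k))\<^sup>2)"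
  by (simp add: jb_def norm_Pair)

lemma jb_sq: "(jb k)\<^sup>2 = 1 + (\<Sum>i\<in>UNIV. (real_of_int (k $ i))\<^sup>2)"
  by (simp add: jb_eq norm_eq_sqrt_inner inner_vec_def fr_def power2_eq_square sum_nonneg)

lemma jb_ge1: "1 \<le> jb k"
  by (simp add: jb_eq)

lemma jb_pos: "0 < jb k"
  using jb_ge1[of k] by linarith

lemma jb_ge0 [simp]: "0 \<le> jb k"
  using jb_ge1[of k] by linarith

lemma norm_fr_le_jb: "norm (fr k) \<le> jb k"
  unfolding jb_def by (metis norm_snd_le snd_conv)

lemma comp_le_norm_fr: "\<bar>real_of_int (k $ i)\<bar> \<le> norm (fr k)"
  using component_le_norm_cart[of "fr k" i] by (simp add: fr_nth)

lemma jb_add: "jb (k + l) \<le> jb k + jb l"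
proof -
  have "jb (k + l) = norm ((1, fr k) + (0::real, fr l))" by (simp add: jb_def fr_add)
  also have "\<dots> \<le> jb k + norm (fr l)"
    using norm_triangle_ineq[of "(1::real, fr k)" "(0::real, fr l)"] by (simp add: jb_def norm_Pair)
  finally show ?thesis using norm_fr_le_jb[of l] by linarith
qed

lemma jb_uminus [simp]: "jb (- k) = jb k"
  by (simp add: jb_eq fr_uminus)

lemma jb_diff: "\<bar>jb k - jb p\<bar> \<le> norm (fr (k - p))"
proof -
  have "\<bar>jb k - jb p\<bar> \<le> norm ((1::real, fr k) - (1, fr p))"
    unfolding jb_def by (rule norm_triangle_ineq3)
  also have "\<dots> = norm (fr (k - p))" by (simp add: fr_diff norm_Pair)
  finally show ?thesis .
qed

text \<open>
  Finite sets that exhaust all frequencies. Unlike cubes they are compatible with convolution: a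
  frequency outside \<open>fball (m + n)\<close> is never a sum of one in \<open>fball m\<close> and one in \<open>fball n\<close>.
\<close>

definition fball :: "nat \<Rightarrow> (int^'d::finite) set" where
  "fball n = {k. jb k \<le> real n}"

lemma finite_fball [simp]: "finite (fball n :: (int^'d::finite) set)"
proof -
  have "fball n \<subseteq> {k::int^'d. \<forall>i. k $ i \<in> {- int n .. int n}}"
  proof
    fix k :: "int^'d" assume "k \<in> fball n"
    then have "jb k \<le> real n" by (simp add: fball_def)
    then have "\<bar>real_of_int (k $ i)\<bar> \<le> real n" for i
      using comp_le_norm_fr[of k i] norm_fr_le_jb[of k] by linarith
    then have "\<bar>k $ i\<bar> \<le> int n" for i by (metis of_int_abs of_int_le_iff of_int_of_nat_eq)
    then show "k \<in> {k::int^'d. \<forall>i. k $ i \<in> {- int n .. int n}}" by (auto simp: abs_le_iff minus_le_iff)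
  qed
  moreover have "{k::int^'d. \<forall>i. k $ i \<in> {- int n .. int n}} \<subseteq>
     vec_lambda ` (PiE UNIV (\<lambda>_. {- int n .. int n}))"
  proof
    fix k :: "int^'d" assume "k \<in> {k::int^'d. \<forall>i. k $ i \<in> {- int n .. int n}}"
    then show "k \<in> vec_lambda ` (PiE UNIV (\<lambda>_. {- int n .. int n}))"
      by (intro image_eqI[of _ _ "vec_nth k"]) auto
  qed
  moreover have "finite (vec_lambda ` (PiE (UNIV::'d set) (\<lambda>_. {- int n .. int n})))"
    by (intro finite_imageI finite_PiE) auto
  ultimately show ?thesis by (meson finite_subset)
qed

lemma fball_mono: "m \<le> n \<Longrightarrow> fball m \<subseteq> fball n"
  by (auto simp: fball_def)

lemma fball_uminus [simp]: "- k \<in> fball n \<longleftrightarrow> k \<in> fball n"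
  by (simp add: fball_def)

lemma fball_add: "k \<in> fball m \<Longrightarrow> l \<in> fball n \<Longrightarrow> k + l \<in> fball (m + n)"
  using jb_add[of k l] by (simp add: fball_def)

lemma finite_subset_fball: "finite F \<Longrightarrow> \<exists>n. F \<subseteq> fball n"
proof (induction F rule: finite_induct)
  case (insert k F)
  then obtain n where n: "F \<subseteq> fball n" by blast
  obtain m where "jb k \<le> real m" using real_arch_simple by blast
  then have "insert k F \<subseteq> fball (max m n)"
    using n fball_mono[of n "max m n"] by (auto simp: fball_def)
  then show ?case by blast
qed simp

lemma filterlim_fball: "filterlim fball (finite_subsets_at_top UNIV) sequentially"
  unfolding filterlim_finite_subsets_at_top
proof (intro allI impI)
  fix F :: "(int^'d) set" assume F: "finite F \<and> F \<subseteq> UNIV"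
  then obtain n where "F \<subseteq> fball n" using finite_subset_fball by blast
  then show "\<forall>\<^sub>F y in sequentially. finite (fball y) \<and> F \<subseteq> fball y \<and> fball y \<subseteq> (UNIV::(int^'d) set)"
    using fball_mono order_trans by (auto simp: eventually_sequentially intro!: exI[of _ n])
qed

lemma has_sum_fball:
  assumes "(f has_sum S) UNIV"
  shows "(\<lambda>n. sum f (fball n)) \<longlonglongrightarrow> S"
  using filterlim_compose[OF assms[unfolded has_sum_def] filterlim_fball] by (simp add: o_def)

text \<open>
  Bounds on infinite sums of nonnegative terms, stated through the finite partial sums. In this form
  they pass to limits of sequences and under injective changes of the index without any discussion of
  convergence.
\<close>

definition sums_le :: "('a \<Rightarrow> real) \<Rightarrow> real \<Rightarrow> bool" where
  "sums_le f H \<longleftrightarrow> (\<forall>F. finite F \<longrightarrow> sum f F \<le> H)"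

lemma sums_leD: "sums_le f H \<Longrightarrow> finite F \<Longrightarrow> sum f F \<le> H"
  by (simp add: sums_le_def)

lemma sums_le_nonneg: "sums_le f H \<Longrightarrow> 0 \<le> H"
  using sums_leD[of f H "{}"] by simp

lemma sums_le_single: "sums_le f H \<Longrightarrow> f k \<le> H"
  using sums_leD[of f H "{k}"] by simp

lemma sums_le_mono: "sums_le f H \<Longrightarrow> (\<And>k. g k \<le> f k) \<Longrightarrow> H \<le> H' \<Longrightarrow> sums_le g H'"
  unfolding sums_le_def by (meson order_trans sum_mono)

lemma sums_le_summable:
  assumes "sums_le f H" "\<And>k. 0 \<le> f k"
  shows "f summable_on A"
proof (rule nonneg_bdd_above_summable_on)
  show "bdd_above (sum f ` {F. F \<subseteq> A \<and> finite F})"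
    using assms(1) by (auto simp: sums_le_def intro!: bdd_aboveI[where M=H])
qed (use assms in auto)

lemma sums_le_infsum:
  assumes "sums_le f H" "\<And>k. 0 \<le> f k"
  shows "infsum f A \<le> H"
  by (rule infsum_le_finite_sums[OF sums_le_summable[OF assms]]) (use assms in \<open>auto simp: sums_le_def\<close>)

lemma summable_sums_le:
  assumes "f summable_on UNIV" "\<And>k. 0 \<le> f k"
  shows "sums_le f (infsum f UNIV)"
  unfolding sums_le_def using assms by (auto intro!: finite_sum_le_infsum)

lemma sums_le_reindex:
  assumes "sums_le f H" "inj \<phi>"
  shows "sums_le (\<lambda>k. f (\<phi> k)) H"
  unfolding sums_le_def
proof (intro allI impI)
  fix F assume "finite (F :: 'b set)"
  then show "(\<Sum>k\<in>F. f (\<phi> k)) \<le> H"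
    using sums_leD[OF assms(1), of "\<phi> ` F"] assms(2) by (simp add: sum.reindex inj_on_subset)
qed

lemma norm_infsum_sums_le:
  fixes f :: "'a \<Rightarrow> 'b::banach"
  assumes "sums_le (\<lambda>k. norm (f k)) H"
  shows "f summable_on A" "norm (infsum f A) \<le> H"
proof -
  have s: "(\<lambda>k. norm (f k)) summable_on A" using assms sums_le_summable by fastforce
  show "f summable_on A" using s abs_summable_summable by blast
  show "norm (infsum f A) \<le> H"
    using norm_infsum_bound[OF s] sums_le_infsum[OF assms, of A] by simp
qed

lemma infsum_tail_tendsto:
  fixes f :: "int^'d::finite \<Rightarrow> real"
  assumes "\<And>A. f summable_on A"
  shows "(\<lambda>n. infsum f (- fball n)) \<longlonglongrightarrow> 0"
proof -
  have eq: "infsum f (- fball n) = infsum f UNIV - sum f (fball n)" for n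
    using infsum_Un_disjoint[of f "fball n" "- fball n"] assms by simp
  have "(\<lambda>n. infsum f UNIV - sum f (fball n)) \<longlonglongrightarrow> infsum f UNIV - infsum f UNIV"
    by (intro tendsto_intros has_sum_fball has_sum_infsum assms)
  then show ?thesis unfolding eq by simp
qed

lemma partial_sum_diff_le:
  fixes f :: "int^'d::finite \<Rightarrow> complex"
  assumes lim: "(\<lambda>m. sum f (fball m)) \<longlonglongrightarrow> S"
    and tail: "\<And>F. finite F \<Longrightarrow> F \<inter> fball n = {} \<Longrightarrow> (\<Sum>k\<in>F. cmod (f k)) \<le> r"
  shows "cmod (sum f (fball n) - S) \<le> r"
proof (rule LIMSEQ_le_const2)
  show "(\<lambda>m. cmod (sum f (fball n) - sum f (fball m))) \<longlonglongrightarrow> cmod (sum f (fball n) - S)"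
    by (intro tendsto_intros lim)
  have "cmod (sum f (fball n) - sum f (fball m)) \<le> r" if "m \<ge> n" for m
  proof -
    have "sum f (fball m) = sum f (fball n) + sum f (fball m - fball n)"
      using sum.subset_diff[OF fball_mono[OF that] finite_fball, of f] by (simp add: add.commute)
    then have "cmod (sum f (fball n) - sum f (fball m)) = cmod (sum f (fball m - fball n))" by simp
    also have "\<dots> \<le> (\<Sum>k\<in>fball m - fball n. cmod (f k))" by (rule norm_sum)
    also have "\<dots> \<le> r" by (rule tail) auto
    finally show ?thesis .
  qed
  then show "\<exists>N. \<forall>m\<ge>N. cmod (sum f (fball n) - sum f (fball m)) \<le> r" by blast
qed

lemma cmod_le_jb_cmod: "cmod x \<le> jb k * cmod x"
  using mult_right_mono[OF jb_ge1[of k], of "cmod x"] by simp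

text \<open>
  Young's inequality \<open>\<ell>\<^sup>2 * \<ell>\<^sup>1 \<subseteq> \<ell>\<^sup>2\<close> in the form of a trilinear estimate: fix \<open>p\<close>, where the
  \<open>\<ell>\<^sup>1\<close>-factor sits, and apply \<open>2xy \<le> x\<^sup>2 + y\<^sup>2\<close> to the two others. The next version has
  the \<open>\<ell>\<^sup>1\<close>-factor at \<open>k - p\<close> instead.
\<close>

lemma young_finite:
  fixes f g h :: "int^'d::finite \<Rightarrow> real"
  assumes "finite F" "finite G" and h: "\<And>p. 0 \<le> h p" and g: "sums_le (\<lambda>k. (g k)\<^sup>2) \<Gamma>"
  shows "(\<Sum>k\<in>F. \<Sum>p\<in>G. f k * g (k - p) * h p) \<le> sum h G * ((\<Sum>k\<in>F. (f k)\<^sup>2) + \<Gamma>) / 2"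
proof -
  have "(\<Sum>k\<in>F. \<Sum>p\<in>G. f k * g (k - p) * h p) = (\<Sum>p\<in>G. h p * (\<Sum>k\<in>F. f k * g (k - p)))"
    by (subst sum.swap) (simp add: sum_distrib_left mult_ac)
  also have "\<dots> \<le> (\<Sum>p\<in>G. h p * (((\<Sum>k\<in>F. (f k)\<^sup>2) + \<Gamma>) / 2))"
  proof (intro sum_mono mult_left_mono h)
    fix p
    have "(\<Sum>k\<in>F. f k * g (k - p)) \<le> (\<Sum>k\<in>F. ((f k)\<^sup>2 + (g (k - p))\<^sup>2) / 2)"
    proof (rule sum_mono)
      fix k show "f k * g (k - p) \<le> ((f k)\<^sup>2 + (g (k - p))\<^sup>2) / 2"
        using sum_squares_bound[of "f k" "g (k - p)"] by simp
    qed
    also have "\<dots> = ((\<Sum>k\<in>F. (f k)\<^sup>2) + (\<Sum>k\<in>F. (g (k - p))\<^sup>2)) / 2"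
      by (simp add: sum.distrib sum_divide_distrib[symmetric])
    also have "(\<Sum>k\<in>F. (g (k - p))\<^sup>2) \<le> \<Gamma>"
      using sums_leD[OF sums_le_reindex[OF g, of "\<lambda>k. k - p"] assms(1)] by (simp add: inj_on_def)
    finally show "(\<Sum>k\<in>F. f k * g (k - p)) \<le> ((\<Sum>k\<in>F. (f k)\<^sup>2) + \<Gamma>) / 2" by simp
  qed
  also have "\<dots> = sum h G * ((\<Sum>k\<in>F. (f k)\<^sup>2) + \<Gamma>) / 2"
    by (simp add: sum_distrib_right)
  finally show ?thesis .
qed

lemma young_kernel_finite:
  fixes f g h :: "int^'d::finite \<Rightarrow> real"
  assumes "finite F" "finite G" and h: "\<And>p. 0 \<le> h p" and H: "sums_le h H"
  shows "(\<Sum>k\<in>F. \<Sum>p\<in>G. f k * h (k - p) * g p) \<le> H * ((\<Sum>k\<in>F. (f k)\<^sup>2) + (\<Sum>p\<in>G. (g p)\<^sup>2)) / 2"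
proof -
  have "(\<Sum>k\<in>F. \<Sum>p\<in>G. f k * h (k - p) * g p) \<le> (\<Sum>k\<in>F. \<Sum>p\<in>G. h (k - p) * (f k)\<^sup>2 / 2 + h (k - p) * (g p)\<^sup>2 / 2)"
  proof (intro sum_mono)
    fix k p
    have "h (k - p) * (f k * g p) \<le> h (k - p) * (((f k)\<^sup>2 + (g p)\<^sup>2) / 2)"
      using sum_squares_bound[of "f k" "g p"] by (intro mult_left_mono h) simp
    then show "f k * h (k - p) * g p \<le> h (k - p) * (f k)\<^sup>2 / 2 + h (k - p) * (g p)\<^sup>2 / 2"
      by (simp add: algebra_simps add_divide_distrib)
  qed
  also have "\<dots> = (\<Sum>k\<in>F. (f k)\<^sup>2 * (\<Sum>p\<in>G. h (k - p))) / 2 + (\<Sum>p\<in>G. (g p)\<^sup>2 * (\<Sum>k\<in>F. h (k - p))) / 2"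
    unfolding sum.distrib
    by (subst (2) sum.swap) (simp add: sum_distrib_left sum_divide_distrib mult_ac)
  also have "\<dots> \<le> (\<Sum>k\<in>F. (f k)\<^sup>2 * H) / 2 + (\<Sum>p\<in>G. (g p)\<^sup>2 * H) / 2"
  proof (intro add_mono divide_right_mono sum_mono mult_left_mono)
    fix k show "(\<Sum>p\<in>G. h (k - p)) \<le> H"
      using sums_leD[OF sums_le_reindex[OF H, of "\<lambda>p. k - p"] assms(2)] by (simp add: inj_on_def)
  next
    fix p show "(\<Sum>k\<in>F. h (k - p)) \<le> H"
      using sums_leD[OF sums_le_reindex[OF H, of "\<lambda>k. k - p"] assms(1)] by (simp add: inj_on_def)
  qed auto
  also have "\<dots> = H * ((\<Sum>k\<in>F. (f k)\<^sup>2) + (\<Sum>p\<in>G. (g p)\<^sup>2)) / 2"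
    by (simp add: sum_distrib_left[symmetric] algebra_simps add_divide_distrib)
  finally show ?thesis .
qed

lemma sq_powr: "0 \<le> x \<Longrightarrow> (x\<^sup>2) powr y = x powr (2 * y)" for x y :: real
proof -
  assume "0 \<le> x"
  then have "x\<^sup>2 = x powr 2" by simp
  then show ?thesis by (simp only: powr_powr)
qed

lemma sums_le_int_powr:
  assumes q: "q > (1/2::real)"
  shows "\<exists>H. sums_le (\<lambda>n::int. (1 + (real_of_int n)\<^sup>2) powr (- q)) H"
proof -
  let ?g = "\<lambda>n::nat. (1 + (real n)\<^sup>2) powr (- q)"
  have "summable (\<lambda>n::nat. real n powr (- 2 * q))" using q by (subst summable_real_powr_iff) auto
  then have "summable ?g"
  proof (rule summable_comparison_test'[where N=1])
    fix n :: nat assume "1 \<le> n"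
    then have "?g n \<le> ((real n)\<^sup>2) powr (- q)"
      using q by (intro powr_mono2') auto
    also have "\<dots> = real n powr (- 2 * q)"
      by (subst sq_powr) auto
    finally show "norm (?g n) \<le> real n powr (- 2 * q)" by simp
  qed
  then have b: "sum ?g F \<le> suminf ?g" if "finite F" for F
    using that by (intro sum_le_suminf) auto
  have "sums_le (\<lambda>n::int. (1 + (real_of_int n)\<^sup>2) powr (- q)) (2 * suminf ?g)"
    unfolding sums_le_def
  proof (intro allI impI)
    fix F :: "int set" assume F: "finite F"
    let ?f = "\<lambda>n::int. (1 + (real_of_int n)\<^sup>2) powr (- q)"
    have 1: "sum ?f {n\<in>F. n \<ge> 0} = sum ?g (nat ` {n\<in>F. n \<ge> 0})"
      by (subst sum.reindex) (auto simp: inj_on_def)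
    have 2: "sum ?f {n\<in>F. n < 0} = sum ?g ((\<lambda>n. nat (- n)) ` {n\<in>F. n < 0})"
      by (subst sum.reindex) (auto simp: inj_on_def)
    have "sum ?f F = sum ?f ({n\<in>F. n \<ge> 0} \<union> {n\<in>F. n < 0})" by (rule arg_cong[where f="sum ?f"]) auto
    also have "\<dots> = sum ?f {n\<in>F. n \<ge> 0} + sum ?f {n\<in>F. n < 0}"
      using F by (subst sum.union_disjoint) auto
    also have "\<dots> \<le> 2 * suminf ?g" unfolding 1 2
      using b[of "nat ` {n\<in>F. n \<ge> 0}"] b[of "(\<lambda>n. nat (- n)) ` {n\<in>F. n < 0}"] F by simp
    finally show "sum ?f F \<le> 2 * suminf ?g" .
  qed
  then show ?thesis by blast
qed

text \<open>
  Each \<open>1 + k\<^sub>i\<^sup>2\<close> is at most \<open>1 + |k|\<^sup>2\<close>. Hence \<open>(1 + |k|\<^sup>2)\<^sup>-\<^sup>r\<^sup>/\<^sup>2\<close> is at most the product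
  over \<open>i\<close> of \<open>(1 + k\<^sub>i\<^sup>2)\<^sup>-\<^sup>r\<^sup>/\<^sup>2\<^sup>d\<close>, and the sum over all \<open>k\<close> is bounded by the \<open>d\<close>-th power of a
  one-dimensional sum, which is finite as \<open>r/d > 1\<close>.
\<close>

lemma sums_le_jb_powr:
  assumes r: "r > real CARD('d)"
  shows "\<exists>H. sums_le (\<lambda>k::int^'d::finite. jb k powr (- r)) H"
proof -
  define d where "d = real CARD('d)"
  have d: "d > 0" by (simp add: d_def)
  define q where "q = r / (2 * d)"
  have q: "q > 1/2" using r d by (simp add: q_def d_def field_simps)
  let ?f = "\<lambda>n::int. (1 + (real_of_int n)\<^sup>2) powr (- q)"
  obtain H where H: "sums_le ?f H" using sums_le_int_powr[OF q] by blast
  have le: "jb k powr (- r) \<le> (\<Prod>i\<in>UNIV. ?f (k $ i))" for k :: "int^'d"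
  proof -
    have "r = 2 * (q * d)" using d by (simp add: q_def)
    then have "jb k powr (- r) = ((jb k)\<^sup>2) powr (- (q * d))"
      by (subst sq_powr) auto
    also have "\<dots> = (((jb k)\<^sup>2) powr (- q)) powr real CARD('d)"
      by (simp only: powr_powr d_def mult_minus_left)
    also have "\<dots> = (\<Prod>i\<in>(UNIV::'d set). ((jb k)\<^sup>2) powr (- q))"
      using jb_pos[of k] by (subst powr_realpow) auto
    also have "\<dots> \<le> (\<Prod>i\<in>UNIV. ?f (k $ i))"
    proof (intro prod_mono conjI powr_mono2')
      fix i
      have "(real_of_int (k $ i))\<^sup>2 \<le> (\<Sum>i\<in>UNIV. (real_of_int (k $ i))\<^sup>2)"
        by (rule member_le_sum) auto
      then show "1 + (real_of_int (k $ i))\<^sup>2 \<le> (jb k)\<^sup>2" by (simp add: jb_sq)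
    qed (use q in \<open>auto simp: add_pos_nonneg\<close>)
    finally show ?thesis .
  qed
  have "sums_le (\<lambda>k::int^'d. jb k powr (- r)) (H ^ CARD('d))"
    unfolding sums_le_def
  proof (intro allI impI)
    fix F :: "(int^'d) set" assume F: "finite F"
    let ?I = "\<lambda>i. (\<lambda>k. k $ i) ` F"
    have "(\<Sum>k\<in>F. jb k powr (- r)) \<le> (\<Sum>k\<in>F. \<Prod>i\<in>UNIV. ?f (k $ i))" by (intro sum_mono le)
    also have "\<dots> = (\<Sum>g\<in>vec_nth ` F. \<Prod>i\<in>UNIV. ?f (g i))"
      by (subst sum.reindex) (auto simp: inj_on_def vec_eq_iff fun_eq_iff)
    also have "\<dots> \<le> (\<Sum>g\<in>PiE UNIV ?I. \<Prod>i\<in>UNIV. ?f (g i))"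
      using F by (intro sum_mono2 finite_PiE) (auto intro!: prod_nonneg)
    also have "\<dots> = (\<Prod>i\<in>UNIV. sum ?f (?I i))"
      using F by (subst prod_sum_PiE) auto
    also have "\<dots> \<le> (\<Prod>i\<in>(UNIV::'d set). H)"
      using F sums_leD[OF H] by (intro prod_mono) (auto intro!: sum_nonneg)
    finally show "(\<Sum>k\<in>F. jb k powr (- r)) \<le> H ^ CARD('d)" by simp
  qed
  then show ?thesis by blast
qed

section \<open>Differential inequalities and differential equations\<close>

lemma linear_growth_within:
  fixes g :: "real \<Rightarrow> real"
  assumes der: "\<And>t. t \<in> {0..T} \<Longrightarrow> (g has_real_derivative g' t) (at t within {0..T})"
    and "\<And>t. t \<in> {0..T} \<Longrightarrow> g' t \<le> c" "t \<in> {0..T}"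
  shows "g t \<le> g 0 + c * t"
proof -
  have "\<exists>\<xi>\<in>{0..t}. g t - g 0 = g' \<xi> * (t - 0)"
  proof (rule mvt_very_simple)
    fix x assume "0 \<le> x" "x \<le> t"
    then have "(g has_derivative (\<lambda>h. g' x * h)) (at x within {0..T})"
      using der[of x] assms(3) by (simp add: has_field_derivative_def)
    then show "(g has_derivative (\<lambda>h. g' x * h)) (at x within {0..t})"
      by (rule has_derivative_subset) (use assms(3) in auto)
  qed (use assms(3) in auto)
  then obtain \<xi> where "\<xi> \<in> {0..t}" "g t - g 0 = g' \<xi> * t" by auto
  moreover have "g' \<xi> * t \<le> c * t"
    using \<open>\<xi> \<in> {0..t}\<close> assms by (intro mult_right_mono) auto
  ultimately show ?thesis by linarith
qed

text \<open>
  The function \<open>exp (- \<alpha> * t) * f t - \<beta> * t\<close> does not increase.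
\<close>

lemma gronwall:
  fixes f :: "real \<Rightarrow> real"
  assumes der: "\<And>t. t \<in> {0..T} \<Longrightarrow> (f has_real_derivative f' t) (at t within {0..T})"
    and le: "\<And>t. t \<in> {0..T} \<Longrightarrow> f' t \<le> \<alpha> * f t + \<beta>"
    and "f 0 \<le> 0" "0 \<le> \<alpha>" "0 \<le> \<beta>" "t \<in> {0..T}"
  shows "f t \<le> \<beta> * T * exp (\<alpha> * T)"
proof -
  have "exp (- \<alpha> * t) * f t \<le> exp (- \<alpha> * 0) * f 0 + \<beta> * t"
  proof (rule linear_growth_within[where T=T])
    fix r assume r: "r \<in> {0..T}"
    show "((\<lambda>t. exp (- \<alpha> * t) * f t) has_real_derivative (exp (- \<alpha> * r) * (f' r - \<alpha> * f r))) (at r within {0..T})"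
      by (rule derivative_eq_intros der[OF r] | simp add: algebra_simps)+
    have "exp (- \<alpha> * r) * (f' r - \<alpha> * f r) \<le> exp (- \<alpha> * r) * \<beta>"
      using le[OF r] by (intro mult_left_mono) auto
    also have "\<dots> \<le> 1 * \<beta>" using r assms by (intro mult_right_mono) auto
    finally show "exp (- \<alpha> * r) * (f' r - \<alpha> * f r) \<le> \<beta>" by simp
  qed fact
  then have "exp (- \<alpha> * t) * f t \<le> \<beta> * T"
    using assms by (simp) (smt (verit) mult_left_mono)
  then have "exp (\<alpha> * t) * (exp (- \<alpha> * t) * f t) \<le> exp (\<alpha> * t) * (\<beta> * T)"
    by (intro mult_left_mono) auto
  also have "exp (\<alpha> * t) * (exp (- \<alpha> * t) * f t) = f t"
    by (simp add: mult.assoc[symmetric] exp_add[symmetric])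
  also have "exp (\<alpha> * t) * (\<beta> * T) \<le> exp (\<alpha> * T) * (\<beta> * T)"
    using assms by (intro mult_right_mono) (auto intro: mult_left_mono)
  finally show ?thesis by (simp add: mult_ac)
qed

text \<open>
  At the first time at which \<open>f\<close> reaches \<open>E\<close>, its derivative has been at most \<open>c\<close> all along, so that
  \<open>f\<close> cannot have reached \<open>E\<close> yet.
\<close>

lemma bootstrap_bound:
  fixes f :: "real \<Rightarrow> real"
  assumes der: "\<And>t. t \<in> {0..T} \<Longrightarrow> (f has_real_derivative f' t) (at t within {0..T})"
    and le: "\<And>t. t \<in> {0..T} \<Longrightarrow> f t \<le> E \<Longrightarrow> f' t \<le> c"
    and "0 \<le> c" "f 0 + c * T < E" "t \<in> {0..T}"
  shows "f t < E"
proof (rule ccontr)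
  assume "\<not> f t < E"
  define A where "A = {0..T} \<inter> f -` {E..}"
  have cont: "continuous_on {0..T} f"
    using der by (meson DERIV_continuous_on)
  have cl: "closed A" unfolding A_def by (intro continuous_closed_preimage cont) auto
  have ne: "A \<noteq> {}" using \<open>\<not> f t < E\<close> assms by (auto simp: A_def)
  have bd: "bdd_below A" by (auto simp: A_def intro!: bdd_belowI[where m=0])
  define t1 where "t1 = Inf A"
  have t1: "t1 \<in> A" unfolding t1_def using closed_contains_Inf[OF ne bd cl] .
  have lt: "f x < E" if "0 \<le> x" "x < t1" for x
  proof (rule ccontr)
    assume "\<not> f x < E"
    then have "x \<in> A" using that t1 by (auto simp: A_def)
    then have "t1 \<le> x" unfolding t1_def using bd by (simp add: cInf_lower)
    with that show False by simp
  qed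
  have "f 0 < E" using assms by (smt (verit) atLeastAtMost_iff mult_nonneg_nonneg)
  then have pos: "0 < t1" using t1 by (cases "t1 = 0") (auto simp: A_def)
  have "\<exists>\<xi>\<in>{0<..<t1}. f t1 - f 0 = f' \<xi> * (t1 - 0)"
  proof (rule mvt_simple[OF pos])
    fix x assume "0 \<le> x" "x \<le> t1"
    then have "(f has_derivative (\<lambda>h. f' x * h)) (at x within {0..T})"
      using der[of x] t1 by (simp add: has_field_derivative_def A_def)
    then show "(f has_derivative (\<lambda>h. f' x * h)) (at x within {0..t1})"
      by (rule has_derivative_subset) (use t1 in \<open>auto simp: A_def\<close>)
  qed
  then obtain \<xi> where \<xi>: "\<xi> \<in> {0<..<t1}" "f t1 - f 0 = f' \<xi> * t1" by auto
  have "f' \<xi> \<le> c" using \<xi> t1 lt[of \<xi>] by (intro le) (auto simp: A_def)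
  then have "f' \<xi> * t1 \<le> c * t1" using pos by (intro mult_right_mono) auto
  also have "c * t1 \<le> c * T" using t1 \<open>0 \<le> c\<close> by (intro mult_left_mono) (auto simp: A_def)
  finally have "f' \<xi> * t1 \<le> c * T" .
  then show False using \<xi> t1 assms by (auto simp: A_def)
qed

text \<open>
  Picard iteration. To get all of \<open>{0..T}\<close> in one step, the unknown is \<open>y t = exp (- \<mu> * t) *\<^sub>R x t\<close>:
  in this weighted norm the integral operator has the Lipschitz constant \<open>L / \<mu> \<le> 1/2\<close>.
\<close>

lemma ode_global_lipschitz:
  fixes F :: "'a::banach \<Rightarrow> 'a"
  assumes L: "\<And>x y. norm (F x - F y) \<le> L * norm (x - y)" and "0 \<le> L" "0 \<le> T"
  shows "\<exists>x. x 0 = x0 \<and> (\<forall>t\<in>{0..T}. (x has_vector_derivative F (x t)) (at t within {0..T}))"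
proof -
  define \<mu> where "\<mu> = 2 * L + 1"
  have \<mu>: "\<mu> > 0" using \<open>0 \<le> L\<close> by (simp add: \<mu>_def)
  \<comment> \<open>Bounded continuous functions live on the whole line, so times are clamped to \<open>{0..T}\<close>.\<close>
  define c where "c t = max 0 (min T t)" for t :: real
  have c: "c t \<in> {0..T}" for t using \<open>0 \<le> T\<close> by (auto simp: c_def)
  have c_id: "c t = t" if "t \<in> {0..T}" for t using that by (auto simp: c_def)
  have contc: "continuous_on UNIV c" unfolding c_def by (intro continuous_intros)
  have contF: "continuous_on A F" for A
    by (rule lipschitz_on_continuous_on[where L=L]) (auto simp: lipschitz_on_def dist_norm L \<open>0 \<le> L\<close>)
  define f where "f y \<tau> = F (exp (\<mu> * \<tau>) *\<^sub>R apply_bcontfun y \<tau>)" for y :: "real \<Rightarrow>\<^sub>C 'a" and \<tau>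
  have contf: "continuous_on {0..T} (f y)" for y
    unfolding f_def
    by (intro continuous_on_compose2[OF contF[of UNIV]] continuous_intros) auto
  define g where "g y t = exp (- \<mu> * t) *\<^sub>R (x0 + integral {0..t} (f y))" for y t
  have contg: "continuous_on {0..T} (g y)" for y
    unfolding g_def
    by (intro continuous_intros indefinite_integral_continuous_1 integrable_continuous_real contf)
  have inb: "(\<lambda>t. g y (c t)) \<in> bcontfun" for y
    unfolding bcontfun_def
  proof (intro CollectI conjI)
    show "continuous_on UNIV (\<lambda>t. g y (c t))"
      by (rule continuous_on_compose2[OF contg contc]) (use c in auto)
    have "bounded (g y ` {0..T})"
      by (intro compact_imp_bounded compact_continuous_image contg) auto
    then show "bounded (range (\<lambda>t. g y (c t)))"
      by (rule bounded_subset) (use c in auto)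
  qed
  define \<Phi> where "\<Phi> y = Bcontfun (\<lambda>t. g y (c t))" for y
  have \<Phi>: "apply_bcontfun (\<Phi> y) t = g y (c t)" for y t
    unfolding \<Phi>_def by (subst Bcontfun_inverse[OF inb]) simp
  have contr: "dist (\<Phi> y) (\<Phi> z) \<le> 1/2 * dist y z" for y z
  proof (rule dist_bound)
    fix t
    define u where "u = c t"
    have u: "u \<in> {0..T}" using c by (simp add: u_def)
    have int: "f w integrable_on {0..u}" for w
      by (intro integrable_continuous_real continuous_on_subset[OF contf]) (use u in auto)
    have "norm (integral {0..u} (f y) - integral {0..u} (f z)) = norm (integral {0..u} (\<lambda>\<tau>. f y \<tau> - f z \<tau>))"
      by (simp add: integral_diff int)
    also have "\<dots> \<le> integral {0..u} (\<lambda>\<tau>. L * dist y z * exp (\<mu> * \<tau>))"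
    proof (rule integral_norm_bound_integral)
      show "(\<lambda>\<tau>. f y \<tau> - f z \<tau>) integrable_on {0..u}" by (intro integrable_diff int)
      show "(\<lambda>\<tau>. L * dist y z * exp (\<mu> * \<tau>)) integrable_on {0..u}"
        by (intro integrable_continuous_real continuous_intros)
      fix \<tau> assume "\<tau> \<in> {0..u}"
      have "norm (f y \<tau> - f z \<tau>) \<le> L * norm (exp (\<mu> * \<tau>) *\<^sub>R (apply_bcontfun y \<tau> - apply_bcontfun z \<tau>))"
        unfolding f_def using L by (metis scaleR_diff_right)
      also have "\<dots> = L * exp (\<mu> * \<tau>) * dist (apply_bcontfun y \<tau>) (apply_bcontfun z \<tau>)" by (simp add: dist_norm)
      also have "\<dots> \<le> L * exp (\<mu> * \<tau>) * dist y z"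
        using \<open>0 \<le> L\<close> by (intro mult_left_mono dist_bounded) auto
      finally show "norm (f y \<tau> - f z \<tau>) \<le> L * dist y z * exp (\<mu> * \<tau>)" by (simp add: mult_ac)
    qed
    also have "\<dots> = L * dist y z * ((exp (\<mu> * u) - 1) / \<mu>)"
    proof -
      have "((\<lambda>\<tau>. exp (\<mu> * \<tau>)) has_integral (exp (\<mu> * u) / \<mu> - exp (\<mu> * 0) / \<mu>)) {0..u}"
        by (rule fundamental_theorem_of_calculus)
          (use u \<mu> in \<open>auto intro!: derivative_eq_intros simp: has_real_derivative_iff_has_vector_derivative[symmetric]\<close>)
      then show ?thesis by (simp add: integral_unique diff_divide_distrib)
    qed
    also have "\<dots> \<le> L * dist y z * (exp (\<mu> * u) / \<mu>)"
      using \<mu> \<open>0 \<le> L\<close> by (intro mult_left_mono divide_right_mono) auto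
    finally have *: "norm (integral {0..u} (f y) - integral {0..u} (f z)) \<le> L * dist y z * (exp (\<mu> * u) / \<mu>)" .
    have "dist (g y u) (g z u) = exp (- \<mu> * u) * norm (integral {0..u} (f y) - integral {0..u} (f z))"
      by (simp add: g_def dist_norm scaleR_diff_right[symmetric])
    also have "\<dots> \<le> exp (- \<mu> * u) * (L * dist y z * (exp (\<mu> * u) / \<mu>))"
      using * by (intro mult_left_mono) auto
    also have "\<dots> = (exp (- \<mu> * u) * exp (\<mu> * u)) * (L / \<mu> * dist y z)" by (simp add: field_simps)
    also have "exp (- \<mu> * u) * exp (\<mu> * u) = 1" by (simp add: exp_add[symmetric])
    also have "1 * (L / \<mu> * dist y z) \<le> 1/2 * dist y z"
      using \<mu> \<open>0 \<le> L\<close> by (simp only: mult_1) (intro mult_right_mono, auto simp: \<mu>_def field_simps)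
    finally show "dist (apply_bcontfun (\<Phi> y) t) (apply_bcontfun (\<Phi> z) t) \<le> 1/2 * dist y z" by (simp add: \<Phi> u_def)
  qed
  obtain y where y: "\<Phi> y = y"
    using banach_fix_type[of "1/2" \<Phi>] contr by auto
  define x where "x t = x0 + integral {0..t} (f y)" for t
  have yx: "exp (\<mu> * t) *\<^sub>R apply_bcontfun y t = x t" if "t \<in> {0..T}" for t
  proof -
    have "apply_bcontfun y t = exp (- \<mu> * t) *\<^sub>R x t"
      using \<Phi>[of y t] y c_id[OF that] by (simp add: g_def x_def)
    then show ?thesis by (simp add: exp_add[symmetric])
  qed
  show ?thesis
  proof (intro exI[of _ x] conjI ballI)
    show "x 0 = x0" by (simp add: x_def)
    fix t assume t: "t \<in> {0..T}"
    have "((\<lambda>t. integral {0..t} (f y)) has_vector_derivative f y t) (at t within {0..T})"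
      by (rule integral_has_vector_derivative[OF contf t])
    then have "(x has_vector_derivative f y t) (at t within {0..T})"
      unfolding x_def by (auto intro!: derivative_eq_intros)
    then show "(x has_vector_derivative F (x t)) (at t within {0..T})"
      using yx[OF t] by (simp add: f_def)
  qed
qed

section \<open>Transport operators in frequency space\<close>

text \<open>
  The coefficients of a real-valued function have this symmetry.
\<close>

definition real_seq :: "(int^'d \<Rightarrow> complex) \<Rightarrow> bool" where
  "real_seq a \<longleftrightarrow> (\<forall>k. a (- k) = cnj (a k))"

lemma powr_diff_le:
  fixes x y s m :: real
  assumes "s \<ge> 1" "0 < x" "0 < y" "x \<le> m" "y \<le> m"
  shows "\<bar>x powr s - y powr s\<bar> \<le> s * \<bar>x - y\<bar> * m powr (s - 1)"
proof -
  have *: "\<bar>x powr s - y powr s\<bar> \<le> s * \<bar>x - y\<bar> * m powr (s - 1)"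
    if "0 < y" "y < x" "x \<le> m" for x y :: real
  proof -
    have "\<exists>\<xi>>y. \<xi> < x \<and> x powr s - y powr s = (x - y) * (s * \<xi> powr (s - 1))"
      by (rule MVT2[OF \<open>y < x\<close>]) (use that in \<open>auto intro!: derivative_eq_intros\<close>)
    then obtain \<xi> where \<xi>: "y < \<xi>" "\<xi> < x" "x powr s - y powr s = (x - y) * (s * \<xi> powr (s - 1))" by blast
    have "\<xi> powr (s - 1) \<le> m powr (s - 1)" using \<xi> that assms(1) by (intro powr_mono2) auto
    then have "(x - y) * (s * \<xi> powr (s - 1)) \<le> (x - y) * (s * m powr (s - 1))"
      using that assms(1) by (intro mult_left_mono) auto
    moreover have "0 \<le> (x - y) * (s * \<xi> powr (s - 1))" using that assms(1) by simp
    ultimately show ?thesis using \<xi> that by (simp add: mult_ac)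
  qed
  consider "x = y" | "x < y" | "y < x" by linarith
  then show ?thesis
    by cases (use *[of y x] *[of x y] assms in \<open>auto simp: abs_minus_commute\<close>)
qed

lemma powr_add_le:
  fixes u v q :: real
  assumes "0 \<le> q" "0 \<le> u" "0 \<le> v"
  shows "(u + v) powr q \<le> 2 powr q * (u powr q + v powr q)"
proof -
  have "(u + v) powr q \<le> (2 * max u v) powr q" using assms by (intro powr_mono2) auto
  also have "\<dots> = 2 powr q * (max u v) powr q" using assms by (simp add: powr_mult)
  also have "(max u v) powr q \<le> u powr q + v powr q" by (simp add: max_def)
  finally show ?thesis by simp
qed

lemma cmod_sq_derivative:
  assumes "(u has_vector_derivative u') (at t within A)"
  shows "((\<lambda>t. (cmod (u t))\<^sup>2) has_real_derivative 2 * Re (cnj (u t) * u')) (at t within A)"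
proof -
  have 1: "((\<lambda>t. Re (u t)) has_real_derivative Re u') (at t within A)"
    using bounded_linear.has_vector_derivative[OF bounded_linear_Re assms]
    by (simp add: has_real_derivative_iff_has_vector_derivative)
  have 2: "((\<lambda>t. Im (u t)) has_real_derivative Im u') (at t within A)"
    using bounded_linear.has_vector_derivative[OF bounded_linear_Im assms]
    by (simp add: has_real_derivative_iff_has_vector_derivative)
  show ?thesis unfolding cmod_power2
    by (rule derivative_eq_intros 1 2 | simp)+
qed

text \<open>
  The symbol of the bilinear map \<open>(a, b) \<mapsto> u[a] \<bullet> \<nabla>b\<close>, where \<open>p\<close> is the frequency of \<open>b\<close> and \<open>l\<close>
  that of \<open>a\<close>. The second assumption says that \<open>u[a]\<close> is divergence free, the third that \<open>u\<close> maps real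
  functions to real functions, and the first that \<open>u\<close> is of order zero.
\<close>

locale transport_symbol =
  fixes \<sigma> :: "int^'d::finite \<Rightarrow> int^'d \<Rightarrow> complex" and K s :: real
  assumes symbol_le: "cmod (\<sigma> p l) \<le> K * norm (fr p)"
    and symbol_shift: "\<sigma> (p + l) l = \<sigma> p l"
    and symbol_cnj: "cnj (\<sigma> p l) = - \<sigma> p (- l)"
    and symbol_odd: "\<sigma> (- p) l = - \<sigma> p l"
    and K_nonneg: "0 \<le> K"
    and s_gt: "s > real CARD('d) / 2 + 1"
begin

lemma s_gt1: "s > 1"
  using s_gt by (smt (verit) divide_nonneg_nonneg of_nat_0_le_iff)

definition w :: "int^'d \<Rightarrow> real" where "w k = jb k powr s"

lemma w_ge1: "1 \<le> w k"
  unfolding w_def using jb_ge1[of k] s_gt1 by (intro ge_one_powr_ge_zero) auto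

lemma w_ge0 [simp]: "0 \<le> w k"
  by (simp add: w_def)

text \<open>
  The mean value theorem for \<open>x powr s\<close>, combined with \<open>jb k \<le> jb (k - p) + jb p\<close>.
\<close>

lemma commutator_aux:
  "\<bar>w k - w p\<bar> \<le> s * 2 powr (s - 1) * norm (fr (k - p)) * (jb (k - p) powr (s - 1) + jb p powr (s - 1))"
proof -
  let ?m = "jb (k - p) + jb p"
  have "\<bar>w k - w p\<bar> \<le> s * \<bar>jb k - jb p\<bar> * ?m powr (s - 1)"
    unfolding w_def using s_gt1 jb_add[of "k - p" p] by (intro powr_diff_le jb_pos) auto
  also have "\<dots> \<le> s * norm (fr (k - p)) * (2 powr (s - 1) * (jb (k - p) powr (s - 1) + jb p powr (s - 1)))"
    using s_gt1 by (intro mult_mono powr_add_le jb_diff mult_nonneg_nonneg) auto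
  finally show ?thesis by (simp add: mult_ac)
qed

lemma commutator_le:
  "\<bar>w k - w p\<bar> * jb p \<le> s * 2 powr (s - 1) * (w (k - p) * jb p + jb (k - p) * w p)"
proof -
  let ?l = "k - p"
  have pw: "jb q * jb q powr (s - 1) = w q" for q :: "int^'d"
    using powr_mult_base[of "jb q" "s - 1"] by (simp add: w_def)
  have "\<bar>w k - w p\<bar> \<le> s * 2 powr (s - 1) * jb ?l * (jb ?l powr (s - 1) + jb p powr (s - 1))"
    using s_gt1 norm_fr_le_jb[of ?l]
    by (intro order_trans[OF commutator_aux] mult_right_mono mult_left_mono) auto
  then have "\<bar>w k - w p\<bar> * jb p \<le> s * 2 powr (s - 1) * jb ?l * (jb ?l powr (s - 1) + jb p powr (s - 1)) * jb p"
    by (intro mult_right_mono) auto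
  also have "\<dots> = s * 2 powr (s - 1) * ((jb ?l * jb ?l powr (s - 1)) * jb p + jb ?l * (jb p * jb p powr (s - 1)))"
    by (simp add: algebra_simps)
  finally show ?thesis by (simp add: pw)
qed

text \<open>
  The weight that embeds \<open>H\<^sup>s\<close> into the functions whose gradients have summable Fourier coefficients:
  \<open>z\<close> is the square of \<open>jb k / w k\<close> and is summable exactly when \<open>s > d/2 + 1\<close>. The constants
  \<open>\<kappa>\<close> and \<open>\<rho> n\<close> are the norms of this embedding on all frequencies and on those outside \<open>fball n\<close>.
\<close>

definition z :: "int^'d \<Rightarrow> real" where "z k = jb k powr (- (2 * (s - 1)))"

lemma z_nonneg [simp]: "0 \<le> z k" by (simp add: z_def)

lemma z_summable: "z summable_on A"
proof -
  obtain H where "sums_le (\<lambda>k::int^'d. jb k powr (- (2 * (s - 1)))) H"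
    using sums_le_jb_powr[where 'd='d, of "2 * (s - 1)"] s_gt by auto
  then show ?thesis unfolding z_def by (rule sums_le_summable) simp
qed

definition \<kappa> :: real where "\<kappa> = sqrt (infsum z UNIV)"
definition \<rho> :: "nat \<Rightarrow> real" where "\<rho> n = sqrt (infsum z (- fball n))"

lemma \<kappa>_nonneg [simp]: "0 \<le> \<kappa>" by (simp add: \<kappa>_def infsum_nonneg)
lemma \<rho>_nonneg [simp]: "0 \<le> \<rho> n" by (simp add: \<rho>_def infsum_nonneg)

lemma \<rho>_tendsto: "\<rho> \<longlonglongrightarrow> 0"
proof -
  have "(\<lambda>n. infsum z (- fball n)) \<longlonglongrightarrow> 0" by (rule infsum_tail_tendsto[OF z_summable])
  then have "(\<lambda>n. sqrt (infsum z (- fball n))) \<longlonglongrightarrow> sqrt 0"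
    by (intro tendsto_real_sqrt) simp
  then show ?thesis unfolding \<rho>_def by simp
qed

text \<open>
  The squared \<open>H\<^sup>s\<close>-norm of \<open>a\<close> is at most \<open>E\<close>.
\<close>

definition hsb :: "(int^'d \<Rightarrow> complex) \<Rightarrow> real \<Rightarrow> bool" where
  "hsb a E \<longleftrightarrow> sums_le (\<lambda>k. (w k * cmod (a k))\<^sup>2) E"

lemma hsb_nonneg: "hsb a E \<Longrightarrow> 0 \<le> E"
  unfolding hsb_def by (rule sums_le_nonneg)

text \<open>
  Cauchy-Schwarz for the product of \<open>w k * cmod (a k)\<close> and \<open>jb k powr (1 - s)\<close>.
\<close>

lemma hsb_l1_aux:
  assumes "hsb a E" "finite F"
  shows "(\<Sum>k\<in>F. jb k * cmod (a k)) \<le> sqrt E * sqrt (sum z F)"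
proof -
  have eq: "jb k = w k * jb k powr (1 - s)" for k
    using jb_pos[of k] by (simp add: w_def powr_add[symmetric])
  have zeq: "z k = (jb k powr (1 - s))\<^sup>2" for k
    by (simp add: z_def power2_eq_square powr_add[symmetric])
  have "(\<Sum>k\<in>F. jb k * cmod (a k)) = (\<Sum>k\<in>F. \<bar>w k * cmod (a k)\<bar> * \<bar>jb k powr (1 - s)\<bar>)"
    by (subst eq) (simp add: abs_mult mult_ac)
  also have "\<dots> \<le> L2_set (\<lambda>k. w k * cmod (a k)) F * L2_set (\<lambda>k. jb k powr (1 - s)) F"
    by (rule L2_set_mult_ineq)
  also have "\<dots> \<le> sqrt E * sqrt (sum z F)"
    unfolding L2_set_def zeq using assms
    by (intro mult_right_mono) (auto simp: hsb_def sums_le_def intro!: sum_nonneg)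
  finally show ?thesis .
qed

lemma hsb_l1: "hsb a E \<Longrightarrow> sums_le (\<lambda>k. jb k * cmod (a k)) (sqrt E * \<kappa>)"
  unfolding sums_le_def \<kappa>_def
proof (intro allI impI)
  fix F :: "(int^'d) set" assume a: "hsb a E" "finite F"
  have "sqrt E * sqrt (sum z F) \<le> sqrt E * sqrt (infsum z UNIV)"
    using hsb_nonneg[OF a(1)] a by (intro mult_left_mono) (auto intro!: finite_sum_le_infsum z_summable)
  then show "(\<Sum>k\<in>F. jb k * cmod (a k)) \<le> sqrt E * sqrt (infsum z UNIV)"
    using hsb_l1_aux[OF a] by linarith
qed

text \<open>
  The tails are small uniformly over bounded sets of \<open>H\<^sup>s\<close>. This replaces compactness throughout.
\<close>

lemma hsb_l1_tail:
  assumes a: "hsb a E" "finite F" and "F \<inter> fball n = {}"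
  shows "(\<Sum>k\<in>F. jb k * cmod (a k)) \<le> sqrt E * \<rho> n"
proof -
  have "sqrt E * sqrt (sum z F) \<le> sqrt E * sqrt (infsum z (- fball n))"
    using hsb_nonneg[OF a(1)] assms by (intro mult_left_mono) (auto intro!: finite_sum_le_infsum z_summable)
  then show ?thesis using hsb_l1_aux[OF a] by (simp add: \<rho>_def)
qed

lemma hsb_l1_tail0:
  assumes a: "hsb a E" "finite F" and "F \<inter> fball n = {}"
  shows "(\<Sum>k\<in>F. cmod (a k)) \<le> sqrt E * \<rho> n"
  using hsb_l1_tail[OF assms] sum_mono[of F "\<lambda>k. cmod (a k)" "\<lambda>k. jb k * cmod (a k)"] cmod_le_jb_cmod
  by (smt (verit))

lemma hsb_l10: "hsb a E \<Longrightarrow> sums_le (\<lambda>k. cmod (a k)) (sqrt E * \<kappa>)"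
  by (rule sums_le_mono[OF hsb_l1]) (auto intro: cmod_le_jb_cmod)

lemma hsb_l2: "hsb a E \<Longrightarrow> sums_le (\<lambda>k. (cmod (a k))\<^sup>2) E"
  unfolding hsb_def
proof (rule sums_le_mono)
  fix k show "(cmod (a k))\<^sup>2 \<le> (w k * cmod (a k))\<^sup>2"
    using mult_right_mono[OF w_ge1[of k], of "cmod (a k)"] by (intro power_mono) auto
qed auto

lemma hsb_cmod: "hsb a E \<Longrightarrow> cmod (a k) \<le> sqrt E"
  using sums_le_single[OF hsb_l2] by (simp add: real_le_rsqrt)

lemma hsb_diff:
  assumes "hsb a E" "hsb b E"
  shows "hsb (\<lambda>k. a k - b k) (4 * E)"
  unfolding hsb_def sums_le_def
proof (intro allI impI)
  fix F :: "(int^'d) set" assume F: "finite F"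
  have "(\<Sum>k\<in>F. (w k * cmod (a k - b k))\<^sup>2) \<le> (\<Sum>k\<in>F. 2 * (w k * cmod (a k))\<^sup>2 + 2 * (w k * cmod (b k))\<^sup>2)"
  proof (rule sum_mono)
    fix k
    have "(w k * cmod (a k - b k))\<^sup>2 \<le> (w k * cmod (a k) + w k * cmod (b k))\<^sup>2"
      by (intro power_mono) (auto simp: distrib_left[symmetric] intro!: mult_left_mono norm_triangle_ineq4)
    also have "\<dots> \<le> 2 * (w k * cmod (a k))\<^sup>2 + 2 * (w k * cmod (b k))\<^sup>2"
      using sum_squares_bound[of "w k * cmod (a k)" "w k * cmod (b k)"] by (simp add: power2_sum)
    finally show "(w k * cmod (a k - b k))\<^sup>2 \<le> 2 * (w k * cmod (a k))\<^sup>2 + 2 * (w k * cmod (b k))\<^sup>2" .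
  qed
  also have "\<dots> \<le> 4 * E"
    using assms[unfolded hsb_def sums_le_def, rule_format, OF F]
    by (simp add: sum.distrib sum_distrib_left[symmetric])
  finally show "(\<Sum>k\<in>F. (w k * cmod (a k - b k))\<^sup>2) \<le> 4 * E" .
qed

text \<open>
  The interaction of the frequencies \<open>k - p\<close> and \<open>p\<close>; \<open>Bil a b\<close> is the sequence of coefficients of
  \<open>u[a] \<bullet> \<nabla>b\<close>.
\<close>

definition tm :: "(int^'d \<Rightarrow> complex) \<Rightarrow> (int^'d \<Rightarrow> complex) \<Rightarrow> int^'d \<Rightarrow> int^'d \<Rightarrow> complex" where
  "tm a b k p = \<sigma> p (k - p) * a (k - p) * b p"

definition Bil :: "(int^'d \<Rightarrow> complex) \<Rightarrow> (int^'d \<Rightarrow> complex) \<Rightarrow> int^'d \<Rightarrow> complex" where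
  "Bil a b k = infsum (tm a b k) UNIV"

lemma norm_tm: "cmod (tm a b k p) \<le> K * (cmod (a (k - p)) * (jb p * cmod (b p)))"
proof -
  have "cmod (tm a b k p) = cmod (\<sigma> p (k - p)) * (cmod (a (k - p)) * cmod (b p))"
    by (simp add: tm_def norm_mult)
  also have "\<dots> \<le> (K * jb p) * (cmod (a (k - p)) * cmod (b p))"
    using symbol_le[of p "k - p"] mult_left_mono[OF norm_fr_le_jb[of p] K_nonneg]
    by (intro mult_right_mono) auto
  finally show ?thesis by (simp add: mult_ac)
qed

lemma tm_sums_le:
  assumes "\<And>l. cmod (a l) \<le> \<alpha>" "sums_le (\<lambda>k. jb k * cmod (b k)) \<beta>"
  shows "sums_le (\<lambda>p. cmod (tm a b k p)) (K * \<alpha> * \<beta>)"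
  unfolding sums_le_def
proof (intro allI impI)
  fix F :: "(int^'d) set" assume F: "finite F"
  have \<alpha>: "0 \<le> \<alpha>" using assms(1)[of 0] norm_ge_zero[of "a 0"] by linarith
  have "(\<Sum>p\<in>F. cmod (tm a b k p)) \<le> (\<Sum>p\<in>F. K * (\<alpha> * (jb p * cmod (b p))))"
    using K_nonneg assms(1)
    by (intro sum_mono order_trans[OF norm_tm] mult_left_mono mult_right_mono) auto
  also have "\<dots> = K * \<alpha> * (\<Sum>p\<in>F. jb p * cmod (b p))" by (simp add: sum_distrib_left mult_ac)
  also have "\<dots> \<le> K * \<alpha> * \<beta>" using sums_leD[OF assms(2) F] \<alpha> K_nonneg by (intro mult_left_mono) auto
  finally show "(\<Sum>p\<in>F. cmod (tm a b k p)) \<le> K * \<alpha> * \<beta>" .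
qed

lemma Bil_norm:
  assumes "\<And>l. cmod (a l) \<le> \<alpha>" "sums_le (\<lambda>k. jb k * cmod (b k)) \<beta>"
  shows "cmod (Bil a b k) \<le> K * \<alpha> * \<beta>"
  unfolding Bil_def by (rule norm_infsum_sums_le(2)[OF tm_sums_le[OF assms]])

lemma tm_summable:
  assumes "hsb a E" "hsb b E'"
  shows "tm a b k summable_on UNIV"
  by (rule norm_infsum_sums_le(1)[OF tm_sums_le[OF hsb_cmod[OF assms(1)] hsb_l1[OF assms(2)]]])

lemma Bil_lim:
  assumes "hsb a E" "hsb b E'"
  shows "(\<lambda>n. \<Sum>p\<in>fball n. tm a b k p) \<longlonglongrightarrow> Bil a b k"
  unfolding Bil_def by (intro has_sum_fball has_sum_infsum tm_summable[OF assms])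

lemma Bil_diff:
  assumes "hsb a E" "hsb b E"
  shows "Bil a a k - Bil b b k = Bil a (\<lambda>k. a k - b k) k + Bil (\<lambda>k. a k - b k) b k"
proof (rule LIMSEQ_unique)
  have d: "hsb (\<lambda>k. a k - b k) (4 * E)" by (rule hsb_diff[OF assms])
  show "(\<lambda>n. (\<Sum>p\<in>fball n. tm a a k p) - (\<Sum>p\<in>fball n. tm b b k p)) \<longlonglongrightarrow> Bil a a k - Bil b b k"
    by (intro tendsto_diff Bil_lim[OF assms(1) assms(1)] Bil_lim[OF assms(2) assms(2)])
  have "(\<lambda>n. (\<Sum>p\<in>fball n. tm a (\<lambda>k. a k - b k) k p) + (\<Sum>p\<in>fball n. tm (\<lambda>k. a k - b k) b k p))
     \<longlonglongrightarrow> Bil a (\<lambda>k. a k - b k) k + Bil (\<lambda>k. a k - b k) b k"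
    by (intro tendsto_intros Bil_lim[OF assms(1) d] Bil_lim[OF d assms(2)])
  then show "(\<lambda>n. (\<Sum>p\<in>fball n. tm a a k p) - (\<Sum>p\<in>fball n. tm b b k p))
     \<longlonglongrightarrow> Bil a (\<lambda>k. a k - b k) k + Bil (\<lambda>k. a k - b k) b k"
    by (simp add: tm_def sum.distrib[symmetric] sum_subtractf[symmetric] algebra_simps)
qed

text \<open>
  If \<open>k = l + p\<close> lies outside \<open>fball (n + n)\<close>, then \<open>l\<close> or \<open>p\<close> lies outside \<open>fball n\<close>, and the
  corresponding factor contributes only the tail of a summable sequence.
\<close>

lemma Bil_l1_tail:
  assumes a: "hsb a E" and b: "hsb b E" and F: "finite F" "F \<inter> fball (n + n) = {}"
  shows "(\<Sum>k\<in>F. cmod (Bil a b k)) \<le> 2 * K * E * \<kappa> * \<rho> n"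
proof (rule LIMSEQ_le_const2)
  show "(\<lambda>m. \<Sum>k\<in>F. cmod (\<Sum>p\<in>fball m. tm a b k p)) \<longlonglongrightarrow> (\<Sum>k\<in>F. cmod (Bil a b k))"
    by (intro tendsto_intros Bil_lim[OF a b])
  have E: "0 \<le> E" by (rule hsb_nonneg[OF a])
  let ?h = "\<lambda>p. jb p * cmod (b p)"
  show "\<exists>N. \<forall>m\<ge>N. (\<Sum>k\<in>F. cmod (\<Sum>p\<in>fball m. tm a b k p)) \<le> 2 * K * E * \<kappa> * \<rho> n"
  proof (intro exI allI impI)
    fix m :: nat
    have near: "(\<Sum>k\<in>F. cmod (a (k - p))) \<le> sqrt E * \<rho> n" if p: "p \<in> fball n" for p
    proof -
      have "(\<Sum>k\<in>F. cmod (a (k - p))) = (\<Sum>l\<in>(\<lambda>k. k - p) ` F. cmod (a l))"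
        by (subst sum.reindex) (auto simp: inj_on_def)
      also have "\<dots> \<le> sqrt E * \<rho> n"
      proof (rule hsb_l1_tail0[OF a])
        show "(\<lambda>k. k - p) ` F \<inter> fball n = {}"
        proof -
          have "k - p \<notin> fball n" if "k \<in> F" for k
            using fball_add[of "k - p" n p n] p that F by auto
          then show ?thesis by auto
        qed
      qed (use F in auto)
      finally show ?thesis .
    qed
    have all: "(\<Sum>k\<in>F. cmod (a (k - p))) \<le> sqrt E * \<kappa>" for p
      using sums_leD[OF sums_le_reindex[OF hsb_l10[OF a], of "\<lambda>k. k - p"] F(1)] by (simp add: inj_on_def)
    have "(\<Sum>k\<in>F. cmod (\<Sum>p\<in>fball m. tm a b k p)) \<le> (\<Sum>k\<in>F. \<Sum>p\<in>fball m. K * (cmod (a (k - p)) * ?h p))"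
      by (intro sum_mono sum_norm_le norm_tm)
    also have "\<dots> = K * (\<Sum>p\<in>fball m. ?h p * (\<Sum>k\<in>F. cmod (a (k - p))))"
      by (subst sum.swap) (simp add: sum_distrib_left mult_ac)
    also have "\<dots> \<le> K * (sqrt E * \<kappa> * (sqrt E * \<rho> n) + sqrt E * \<rho> n * (sqrt E * \<kappa>))"
    proof (intro mult_left_mono K_nonneg)
      have "(\<Sum>p\<in>fball m. ?h p * (\<Sum>k\<in>F. cmod (a (k - p)))) =
         (\<Sum>p\<in>fball m \<inter> fball n. ?h p * (\<Sum>k\<in>F. cmod (a (k - p)))) +
         (\<Sum>p\<in>fball m - fball n. ?h p * (\<Sum>k\<in>F. cmod (a (k - p))))"
        by (subst sum.union_disjoint[symmetric]) (auto intro!: sum.cong)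
      also have "\<dots> \<le> (\<Sum>p\<in>fball m \<inter> fball n. ?h p * (sqrt E * \<rho> n)) +
         (\<Sum>p\<in>fball m - fball n. ?h p * (sqrt E * \<kappa>))"
        by (intro add_mono sum_mono mult_left_mono near all) auto
      also have "\<dots> = (\<Sum>p\<in>fball m \<inter> fball n. ?h p) * (sqrt E * \<rho> n) +
         (\<Sum>p\<in>fball m - fball n. ?h p) * (sqrt E * \<kappa>)" by (simp add: sum_distrib_right)
      also have "\<dots> \<le> sqrt E * \<kappa> * (sqrt E * \<rho> n) + sqrt E * \<rho> n * (sqrt E * \<kappa>)"
        using E by (intro add_mono mult_right_mono sums_leD[OF hsb_l1[OF b]] hsb_l1_tail[OF b]) auto
      finally show "(\<Sum>p\<in>fball m. ?h p * (\<Sum>k\<in>F. cmod (a (k - p)))) \<le> \<dots>" .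
    qed
    also have "\<dots> = 2 * K * (sqrt E * sqrt E) * \<kappa> * \<rho> n" by (simp add: algebra_simps)
    also have "sqrt E * sqrt E = E" using E by simp
    finally show "(\<Sum>k\<in>F. cmod (\<Sum>p\<in>fball m. tm a b k p)) \<le> 2 * K * E * \<kappa> * \<rho> n" .
  qed
qed

lemma tm_real:
  assumes "real_seq a"
  shows "tm a a (- k) (- p) = cnj (tm a a k p)"
proof -
  have 1: "a (- l) = cnj (a l)" for l using assms by (simp add: real_seq_def)
  have "\<sigma> (- p) (- k + p) = cnj (\<sigma> p (k - p))"
    using symbol_cnj[of p "k - p"] symbol_odd[of p "- k + p"] by simp
  moreover have "a (- k + p) = cnj (a (k - p))" using 1[of "k - p"] by simp
  ultimately show ?thesis by (simp add: tm_def 1)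
qed

text \<open>
  Exchanging \<open>k\<close> and \<open>p\<close> turns each term into minus its conjugate, because \<open>p \<bullet> u = k \<bullet> u\<close> for the
  component \<open>u\<close> of the velocity at the frequency \<open>k - p\<close>. This is \<open>\<integral> d (u \<bullet> \<nabla>d) = 0\<close> for a divergence
  free \<open>u\<close>, and it survives the restriction of \<open>k\<close> and \<open>p\<close> to the same finite set.
\<close>

lemma transport_skew_symmetric:
  assumes "finite F" "real_seq a"
  shows "Re (\<Sum>k\<in>F. \<Sum>p\<in>F. cnj (d k) * tm a d k p) = 0"
proof -
  let ?x = "\<lambda>k p. cnj (d k) * tm a d k p"
  have x: "cnj (?x k p) = - ?x p k" for k p
  proof -
    have "\<sigma> k (p - k) = \<sigma> p (p - k)" using symbol_shift[of k "p - k"] by simp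
    moreover have "cnj (\<sigma> p (k - p)) = - \<sigma> p (p - k)" using symbol_cnj[of p "k - p"] by simp
    moreover have "cnj (a (k - p)) = a (p - k)"
      using assms(2) unfolding real_seq_def by (metis minus_diff_eq)
    ultimately show ?thesis by (simp add: tm_def mult_ac)
  qed
  have "cnj (\<Sum>k\<in>F. \<Sum>p\<in>F. ?x k p) = (\<Sum>k\<in>F. \<Sum>p\<in>F. - ?x p k)" by (simp only: cnj_sum x)
  also have "\<dots> = - (\<Sum>k\<in>F. \<Sum>p\<in>F. ?x k p)" by (subst sum.swap) (simp add: sum_negf)
  finally have "Re (cnj (\<Sum>k\<in>F. \<Sum>p\<in>F. ?x k p)) = Re (- (\<Sum>k\<in>F. \<Sum>p\<in>F. ?x k p))" by simp
  then show ?thesis by simp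
qed

end

section \<open>Energy and stability estimates\<close>

context transport_symbol begin

text \<open>
  Write \<open>(w k)\<^sup>2 = w k * w p + w k * (w k - w p)\<close>. The first part is skew-symmetric in \<open>w k * a k\<close> and
  has no real part. In the second, the commutator bound moves one power of \<open>|k - p|\<close> onto the velocity
  coefficient or leaves it on \<open>a p\<close>, so that two of the three factors are square summable with the full
  weight and the third one is summable with the weight \<open>jb\<close>.
\<close>

lemma energy_estimate:
  assumes F: "finite F" and a: "real_seq a" "hsb a E" and supp: "\<And>k. k \<notin> F \<Longrightarrow> a k = 0"
    and E: "E = (\<Sum>k\<in>F. (w k * cmod (a k))\<^sup>2)"
  shows "\<bar>Re (\<Sum>k\<in>F. \<Sum>p\<in>F. of_real ((w k)\<^sup>2) * (cnj (a k) * tm a a k p))\<bar>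
     \<le> 2 * K * (s * 2 powr (s - 1)) * \<kappa> * (sqrt E * E)"
proof -
  define d where "d k = of_real (w k) * a k" for k
  let ?Q = "s * 2 powr (s - 1)"
  let ?f = "\<lambda>k. w k * cmod (a k)" and ?h = "\<lambda>k. jb k * cmod (a k)"
  have Q: "0 \<le> ?Q" using s_gt1 by simp
  let ?r = "\<lambda>k p. of_real (w k * (w k - w p)) * (cnj (a k) * tm a a k p)"
  have eq: "of_real ((w k)\<^sup>2) * (cnj (a k) * tm a a k p) = cnj (d k) * tm a d k p + ?r k p" for k p
    by (simp add: d_def tm_def algebra_simps power2_eq_square)
  have "Re (\<Sum>k\<in>F. \<Sum>p\<in>F. of_real ((w k)\<^sup>2) * (cnj (a k) * tm a a k p)) = Re (\<Sum>k\<in>F. \<Sum>p\<in>F. ?r k p)"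
    unfolding eq sum.distrib using transport_skew_symmetric[OF F a(1), of d] by simp
  also have "\<bar>\<dots>\<bar> \<le> (\<Sum>k\<in>F. \<Sum>p\<in>F. cmod (?r k p))"
    by (intro order_trans[OF abs_Re_le_cmod] sum_norm_le) auto
  also have "\<dots> \<le> (\<Sum>k\<in>F. \<Sum>p\<in>F. K * ?Q * (?f k * ?f (k - p) * ?h p) + K * ?Q * (?f k * ?h (k - p) * ?f p))"
  proof (intro sum_mono)
    fix k p
    have "cmod (?r k p) = ?f k * \<bar>w k - w p\<bar> * cmod (tm a a k p)"
      by (simp add: norm_mult abs_mult del: of_real_mult of_real_diff)
    also have "\<dots> \<le> ?f k * \<bar>w k - w p\<bar> * (K * (cmod (a (k - p)) * (jb p * cmod (a p))))"
      by (intro mult_left_mono norm_tm) auto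
    also have "\<dots> = (?f k * K * (cmod (a (k - p)) * cmod (a p))) * (\<bar>w k - w p\<bar> * jb p)"
      by (simp add: mult_ac)
    also have "\<dots> \<le> (?f k * K * (cmod (a (k - p)) * cmod (a p))) * (?Q * (w (k - p) * jb p + jb (k - p) * w p))"
      using K_nonneg by (intro mult_left_mono commutator_le) auto
    finally show "cmod (?r k p) \<le> K * ?Q * (?f k * ?f (k - p) * ?h p) + K * ?Q * (?f k * ?h (k - p) * ?f p)"
      by (simp add: algebra_simps)
  qed
  also have "\<dots> = K * ?Q * ((\<Sum>k\<in>F. \<Sum>p\<in>F. ?f k * ?f (k - p) * ?h p) + (\<Sum>k\<in>F. \<Sum>p\<in>F. ?f k * ?h (k - p) * ?f p))"
    by (simp add: sum.distrib sum_distrib_left[symmetric] distrib_left)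
  also have "\<dots> \<le> K * ?Q * ((sqrt E * \<kappa>) * (E + E) / 2 + (sqrt E * \<kappa>) * (E + E) / 2)"
  proof (intro mult_left_mono add_mono)
    have "(\<Sum>k\<in>F. \<Sum>p\<in>F. ?f k * ?f (k - p) * ?h p) \<le> sum ?h F * ((\<Sum>k\<in>F. (?f k)\<^sup>2) + E) / 2"
      by (rule young_finite[OF F F]) (use a(2) in \<open>auto simp: hsb_def\<close>)
    also have "\<dots> \<le> (sqrt E * \<kappa>) * (E + E) / 2"
      unfolding E[symmetric] using hsb_nonneg[OF a(2)] F
      by (intro divide_right_mono mult_right_mono sums_leD[OF hsb_l1[OF a(2)]]) auto
    finally show "(\<Sum>k\<in>F. \<Sum>p\<in>F. ?f k * ?f (k - p) * ?h p) \<le> (sqrt E * \<kappa>) * (E + E) / 2" .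
    have "(\<Sum>k\<in>F. \<Sum>p\<in>F. ?f k * ?h (k - p) * ?f p) \<le> (sqrt E * \<kappa>) * ((\<Sum>k\<in>F. (?f k)\<^sup>2) + (\<Sum>k\<in>F. (?f k)\<^sup>2)) / 2"
      by (rule young_kernel_finite[OF F F _ hsb_l1[OF a(2)]]) auto
    then show "(\<Sum>k\<in>F. \<Sum>p\<in>F. ?f k * ?h (k - p) * ?f p) \<le> (sqrt E * \<kappa>) * (E + E) / 2"
      unfolding E[symmetric] .
  qed (use K_nonneg Q in auto)
  also have "\<dots> = 2 * K * ?Q * \<kappa> * (sqrt E * E)" by (simp add: algebra_simps)
  finally show ?thesis .
qed

text \<open>
  The difference \<open>d = a - b\<close> satisfies \<open>Bil a a - Bil b b = Bil a d + Bil d b\<close>. In \<open>Bil a d\<close> the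
  frequencies \<open>p\<close> in \<open>fball n\<close> cancel by skew-symmetry, and the others only see the tail of \<open>d\<close>. In
  \<open>Bil d b\<close> no derivative falls on \<open>d\<close>, and Young's inequality applies. Both \<open>a\<close> and \<open>b\<close> may have
  arbitrary coefficients outside \<open>fball n\<close>; only their \<open>H\<^sup>s\<close>-bounds enter. The sum over \<open>p\<close> runs over
  a finite \<open>G\<close>, which grows to all frequencies in the next lemma.
\<close>

lemma difference_energy_finite:
  assumes a: "real_seq a" "hsb a E" and b: "hsb b E" and G: "finite G" "fball n \<subseteq> G"
  defines "d \<equiv> \<lambda>k. a k - b k"
  shows "\<bar>Re (\<Sum>k\<in>fball n. \<Sum>p\<in>G. cnj (d k) * (tm a d k p + tm d b k p))\<bar>
     \<le> K * sqrt E * \<kappa> * (\<Sum>k\<in>fball n. (cmod (d k))\<^sup>2) + K * sqrt E * (5 * E + 2 * E * \<kappa>) * \<rho> n"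
proof -
  let ?B = "fball n"
  let ?E = "\<Sum>k\<in>?B. (cmod (d k))\<^sup>2"
  have E: "0 \<le> E" by (rule hsb_nonneg[OF b])
  have d: "hsb d (4 * E)" unfolding d_def by (rule hsb_diff[OF a(2) b])
  have s4: "sqrt (4 * E) = 2 * sqrt E" by (simp add: real_sqrt_mult)
  let ?x = "\<lambda>k p. cnj (d k) * tm a d k p" and ?y = "\<lambda>k p. cnj (d k) * tm d b k p"
  define h where "h p = (if p \<in> ?B then 0 else jb p * cmod (d p))" for p
  have h0: "0 \<le> h p" for p by (simp add: h_def)
  have split: "(\<Sum>p\<in>G. u p) = (\<Sum>p\<in>?B. u p) + (\<Sum>p\<in>G - ?B. u p)" for u :: "int^'d \<Rightarrow> 'b::comm_monoid_add"
    using sum.subset_diff[OF G(2) G(1), of u] by (simp add: add.commute)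
  have "(\<Sum>k\<in>?B. \<Sum>p\<in>G. cnj (d k) * (tm a d k p + tm d b k p)) =
     (\<Sum>k\<in>?B. \<Sum>p\<in>?B. ?x k p) + ((\<Sum>k\<in>?B. \<Sum>p\<in>G - ?B. ?x k p) + (\<Sum>k\<in>?B. \<Sum>p\<in>G. ?y k p))"
    by (simp add: distrib_left sum.distrib split[of "\<lambda>p. ?x _ p"])
  then have "\<bar>Re (\<Sum>k\<in>?B. \<Sum>p\<in>G. cnj (d k) * (tm a d k p + tm d b k p))\<bar> =
     \<bar>Re ((\<Sum>k\<in>?B. \<Sum>p\<in>G - ?B. ?x k p) + (\<Sum>k\<in>?B. \<Sum>p\<in>G. ?y k p))\<bar>"
    using transport_skew_symmetric[OF finite_fball a(1), of d] by simp
  also have "\<dots> \<le> cmod (\<Sum>k\<in>?B. \<Sum>p\<in>G - ?B. ?x k p) + cmod (\<Sum>k\<in>?B. \<Sum>p\<in>G. ?y k p)"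
    by (rule order_trans[OF abs_Re_le_cmod norm_triangle_ineq])
  also have "\<dots> \<le> K * (2 * sqrt E * \<rho> n * (4 * E + E) / 2)
       + K * (sqrt E * \<kappa> * (?E + (?E + 4 * E * \<rho> n)) / 2)"
  proof (intro add_mono)
    have "cmod (\<Sum>k\<in>?B. \<Sum>p\<in>G - ?B. ?x k p) \<le> (\<Sum>k\<in>?B. \<Sum>p\<in>G - ?B. K * (cmod (d k) * cmod (a (k - p)) * h p))"
    proof (intro sum_norm_le)
      fix k p assume "p \<in> G - ?B"
      then show "cmod (?x k p) \<le> K * (cmod (d k) * cmod (a (k - p)) * h p)"
        using mult_left_mono[OF norm_tm[of a d k p], of "cmod (d k)"] by (simp add: norm_mult h_def mult_ac)
    qed
    also have "\<dots> = K * (\<Sum>k\<in>?B. \<Sum>p\<in>G - ?B. cmod (d k) * cmod (a (k - p)) * h p)"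
      by (simp add: sum_distrib_left)
    also have "\<dots> \<le> K * (sum h (G - ?B) * ((\<Sum>k\<in>?B. (cmod (d k))\<^sup>2) + E) / 2)"
      using G by (intro mult_left_mono K_nonneg young_finite h0 hsb_l2[OF a(2)]) auto
    also have "\<dots> \<le> K * ((2 * sqrt E * \<rho> n) * (4 * E + E) / 2)"
    proof (intro mult_left_mono divide_right_mono mult_mono add_mono K_nonneg)
      have "sum h (G - ?B) = (\<Sum>p\<in>G - ?B. jb p * cmod (d p))" by (intro sum.cong) (auto simp: h_def)
      also have "\<dots> \<le> sqrt (4 * E) * \<rho> n" using G by (intro hsb_l1_tail[OF d]) auto
      finally show "sum h (G - ?B) \<le> 2 * sqrt E * \<rho> n" by (simp add: s4)
      show "?E \<le> 4 * E" by (rule sums_leD[OF hsb_l2[OF d]]) simp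
    qed (use E in \<open>auto intro!: add_nonneg_nonneg sum_nonneg\<close>)
    finally show "cmod (\<Sum>k\<in>?B. \<Sum>p\<in>G - ?B. ?x k p) \<le> K * (2 * sqrt E * \<rho> n * (4 * E + E) / 2)" .
  next
    have tail: "sums_le (\<lambda>k. (cmod (d k))\<^sup>2) (?E + 4 * E * \<rho> n)"
      unfolding sums_le_def
    proof (intro allI impI)
      fix F :: "(int^'d) set" assume F: "finite F"
      have "(\<Sum>k\<in>F. (cmod (d k))\<^sup>2) \<le> (\<Sum>k\<in>?B \<union> (F - ?B). (cmod (d k))\<^sup>2)"
        using F by (intro sum_mono2) auto
      also have "\<dots> = ?E + (\<Sum>k\<in>F - ?B. (cmod (d k))\<^sup>2)"
        using F by (subst sum.union_disjoint) auto
      also have "(\<Sum>k\<in>F - ?B. (cmod (d k))\<^sup>2) \<le> (\<Sum>k\<in>F - ?B. 2 * sqrt E * cmod (d k))"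
        unfolding power2_eq_square using hsb_cmod[OF d] by (intro sum_mono mult_right_mono) (auto simp: s4)
      also have "\<dots> = 2 * sqrt E * (\<Sum>k\<in>F - ?B. cmod (d k))" by (simp add: sum_distrib_left)
      also have "\<dots> \<le> 2 * sqrt E * (sqrt (4 * E) * \<rho> n)"
        using F E by (intro mult_left_mono hsb_l1_tail0[OF d]) auto
      also have "\<dots> = 4 * (sqrt E * sqrt E) * \<rho> n" by (simp add: s4)
      finally show "(\<Sum>k\<in>F. (cmod (d k))\<^sup>2) \<le> ?E + 4 * E * \<rho> n" using E by simp
    qed
    have "cmod (\<Sum>k\<in>?B. \<Sum>p\<in>G. ?y k p) \<le> (\<Sum>k\<in>?B. \<Sum>p\<in>G. K * (cmod (d k) * cmod (d (k - p)) * (jb p * cmod (b p))))"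
    proof (intro sum_norm_le)
      fix k p
      show "cmod (?y k p) \<le> K * (cmod (d k) * cmod (d (k - p)) * (jb p * cmod (b p)))"
        using mult_left_mono[OF norm_tm[of d b k p], of "cmod (d k)"] by (simp add: norm_mult mult_ac)
    qed
    also have "\<dots> = K * (\<Sum>k\<in>?B. \<Sum>p\<in>G. cmod (d k) * cmod (d (k - p)) * (jb p * cmod (b p)))"
      by (simp add: sum_distrib_left)
    also have "\<dots> \<le> K * ((\<Sum>p\<in>G. jb p * cmod (b p)) * (?E + (?E + 4 * E * \<rho> n)) / 2)"
      using G by (intro mult_left_mono K_nonneg young_finite tail) auto
    also have "\<dots> \<le> K * (sqrt E * \<kappa> * (?E + (?E + 4 * E * \<rho> n)) / 2)"
      using E G by (intro mult_left_mono divide_right_mono mult_right_mono K_nonneg sums_leD[OF hsb_l1[OF b]])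
        (auto intro!: add_nonneg_nonneg sum_nonneg)
    finally show "cmod (\<Sum>k\<in>?B. \<Sum>p\<in>G. ?y k p) \<le> K * (sqrt E * \<kappa> * (?E + (?E + 4 * E * \<rho> n)) / 2)" .
  qed
  also have "\<dots> = K * sqrt E * \<kappa> * ?E + K * sqrt E * (5 * E + 2 * E * \<kappa>) * \<rho> n"
    by (simp add: field_simps)
  finally show ?thesis .
qed

lemma difference_energy:
  assumes a: "real_seq a" "hsb a E" and b: "hsb b E"
  defines "d \<equiv> \<lambda>k. a k - b k"
  shows "\<bar>Re (\<Sum>k\<in>fball n. cnj (d k) * (Bil a a k - Bil b b k))\<bar>
     \<le> K * sqrt E * \<kappa> * (\<Sum>k\<in>fball n. (cmod (d k))\<^sup>2) + K * sqrt E * (5 * E + 2 * E * \<kappa>) * \<rho> n"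
proof (rule LIMSEQ_le_const2)
  have d: "hsb d (4 * E)" unfolding d_def by (rule hsb_diff[OF a(2) b])
  have "(\<lambda>m. \<Sum>k\<in>fball n. cnj (d k) * ((\<Sum>p\<in>fball m. tm a d k p) + (\<Sum>p\<in>fball m. tm d b k p)))
     \<longlonglongrightarrow> (\<Sum>k\<in>fball n. cnj (d k) * (Bil a d k + Bil d b k))"
    by (intro tendsto_intros Bil_lim[OF a(2) d] Bil_lim[OF d b])
  also have "(\<Sum>k\<in>fball n. cnj (d k) * (Bil a d k + Bil d b k)) = (\<Sum>k\<in>fball n. cnj (d k) * (Bil a a k - Bil b b k))"
    unfolding d_def by (simp add: Bil_diff[OF a(2) b])
  also have "(\<lambda>m. \<Sum>k\<in>fball n. cnj (d k) * ((\<Sum>p\<in>fball m. tm a d k p) + (\<Sum>p\<in>fball m. tm d b k p))) =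
     (\<lambda>m. \<Sum>k\<in>fball n. \<Sum>p\<in>fball m. cnj (d k) * (tm a d k p + tm d b k p))"
    by (simp add: sum.distrib sum_distrib_left distrib_left)
  finally show "(\<lambda>m. \<bar>Re (\<Sum>k\<in>fball n. \<Sum>p\<in>fball m. cnj (d k) * (tm a d k p + tm d b k p))\<bar>)
     \<longlonglongrightarrow> \<bar>Re (\<Sum>k\<in>fball n. cnj (d k) * (Bil a a k - Bil b b k))\<bar>"
    by (intro tendsto_rabs tendsto_Re)
  show "\<exists>N. \<forall>m\<ge>N. \<bar>Re (\<Sum>k\<in>fball n. \<Sum>p\<in>fball m. cnj (d k) * (tm a d k p + tm d b k p))\<bar> \<le>
     K * sqrt E * \<kappa> * (\<Sum>k\<in>fball n. (cmod (d k))\<^sup>2) + K * sqrt E * (5 * E + 2 * E * \<kappa>) * \<rho> n"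
    unfolding d_def by (intro exI[of _ n] allI impI difference_energy_finite a b fball_mono) auto
qed

text \<open>
  The error in \<open>stability\<close>, as Gronwall's inequality produces it.
\<close>

definition \<eta> :: "real \<Rightarrow> real \<Rightarrow> nat \<Rightarrow> real" where
  "\<eta> E T n = 2 * (K * sqrt E * (5 * E + 2 * E * \<kappa>)) * \<rho> n * T * exp (2 * (K * sqrt E * \<kappa>) * T)"

lemma \<eta>_tendsto: "\<eta> E T \<longlonglongrightarrow> 0"
proof -
  have "(\<lambda>n. 2 * (K * sqrt E * (5 * E + 2 * E * \<kappa>)) * \<rho> n * T * exp (2 * (K * sqrt E * \<kappa>) * T))
    \<longlonglongrightarrow> 2 * (K * sqrt E * (5 * E + 2 * E * \<kappa>)) * 0 * T * exp (2 * (K * sqrt E * \<kappa>) * T)"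
    by (intro tendsto_intros \<rho>_tendsto)
  then show ?thesis unfolding \<eta>_def[abs_def] by simp
qed

text \<open>
  Both \<open>a\<close> and \<open>b\<close> solve the system for the frequencies in \<open>fball n\<close> only. This covers two exact
  solutions, where \<open>n\<close> is arbitrary, as well as two Galerkin approximations of orders at least \<open>n\<close>.
\<close>

lemma stability:
  assumes a: "\<And>t. t \<in> {0..T} \<Longrightarrow> real_seq (a t) \<and> hsb (a t) E"
    and b: "\<And>t. t \<in> {0..T} \<Longrightarrow> hsb (b t) E"
    and da: "\<And>t k. t \<in> {0..T} \<Longrightarrow> k \<in> fball n \<Longrightarrow>
      ((\<lambda>t. a t k) has_vector_derivative S k - Bil (a t) (a t) k) (at t within {0..T})"
    and db: "\<And>t k. t \<in> {0..T} \<Longrightarrow> k \<in> fball n \<Longrightarrow>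
      ((\<lambda>t. b t k) has_vector_derivative S k - Bil (b t) (b t) k) (at t within {0..T})"
    and init: "\<And>k. k \<in> fball n \<Longrightarrow> a 0 k = b 0 k"
    and t: "t \<in> {0..T}"
  shows "(\<Sum>k\<in>fball n. (cmod (a t k - b t k))\<^sup>2) \<le> \<eta> E T n"
proof -
  have E: "0 \<le> E" using b[OF t] hsb_nonneg by blast
  let ?f' = "\<lambda>t. \<Sum>k\<in>fball n. 2 * Re (cnj (a t k - b t k) * ((S k - Bil (a t) (a t) k) - (S k - Bil (b t) (b t) k)))"
  show ?thesis unfolding \<eta>_def
  proof (rule gronwall[where f' = ?f' and t = t and f="\<lambda>t. \<Sum>k\<in>fball n. (cmod (a t k - b t k))\<^sup>2"])
    fix r assume r: "r \<in> {0..T}"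
    show "((\<lambda>t. \<Sum>k\<in>fball n. (cmod (a t k - b t k))\<^sup>2) has_real_derivative ?f' r) (at r within {0..T})"
      by (intro DERIV_sum cmod_sq_derivative has_vector_derivative_diff da db r)
    have "?f' r = - 2 * Re (\<Sum>k\<in>fball n. cnj (a r k - b r k) * (Bil (a r) (a r) k - Bil (b r) (b r) k))"
      unfolding Re_sum sum_distrib_left by (intro sum.cong refl) (simp add: algebra_simps)
    also have "\<dots> \<le> 2 * \<bar>Re (\<Sum>k\<in>fball n. cnj (a r k - b r k) * (Bil (a r) (a r) k - Bil (b r) (b r) k))\<bar>"
      by linarith
    also have "\<dots> \<le> 2 * (K * sqrt E * \<kappa> * (\<Sum>k\<in>fball n. (cmod (a r k - b r k))\<^sup>2) + K * sqrt E * (5 * E + 2 * E * \<kappa>) * \<rho> n)"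
      using a[OF r] b[OF r] by (intro mult_left_mono difference_energy) auto
    finally show "?f' r \<le> 2 * (K * sqrt E * \<kappa>) * (\<Sum>k\<in>fball n. (cmod (a r k - b r k))\<^sup>2) +
       2 * (K * sqrt E * (5 * E + 2 * E * \<kappa>)) * \<rho> n" by (simp add: algebra_simps)
  qed (use E K_nonneg t init in auto)
qed

lemma uniqueness:
  assumes a: "\<And>t. t \<in> {0..T} \<Longrightarrow> real_seq (a t) \<and> hsb (a t) E"
    and b: "\<And>t. t \<in> {0..T} \<Longrightarrow> hsb (b t) E"
    and da: "\<And>t k. t \<in> {0..T} \<Longrightarrow>
      ((\<lambda>t. a t k) has_vector_derivative S k - Bil (a t) (a t) k) (at t within {0..T})"
    and db: "\<And>t k. t \<in> {0..T} \<Longrightarrow>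
      ((\<lambda>t. b t k) has_vector_derivative S k - Bil (b t) (b t) k) (at t within {0..T})"
    and init: "\<And>k. a 0 k = b 0 k"
    and t: "t \<in> {0..T}"
  shows "a t k = b t k"
proof -
  obtain N where N: "{k} \<subseteq> fball N" using finite_subset_fball[of "{k}"] by blast
  have "(cmod (a t k - b t k))\<^sup>2 \<le> \<eta> E T n" if "n \<ge> N" for n
  proof -
    have "(cmod (a t k - b t k))\<^sup>2 \<le> (\<Sum>k\<in>fball n. (cmod (a t k - b t k))\<^sup>2)"
      using N fball_mono[OF that] by (intro member_le_sum) auto
    also have "\<dots> \<le> \<eta> E T n" by (rule stability[OF a b da db init t])
    finally show ?thesis .
  qed
  then have "(cmod (a t k - b t k))\<^sup>2 \<le> 0" by (intro LIMSEQ_le_const[OF \<eta>_tendsto]) blast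
  then show ?thesis by simp
qed

end

section \<open>Galerkin approximations\<close>

text \<open>
  Galerkin systems are differential equations in the Banach space of bounded sequences, here the bounded
  continuous functions on the frequencies with the discrete topology. The number of active frequencies
  varies with the order of the approximation, so a fixed finite-dimensional space would not do.
\<close>

lemma finite_support_bcontfun:
  fixes f :: "'a \<Rightarrow> complex"
  assumes "finite F" "\<And>k. k \<notin> F \<Longrightarrow> f k = 0"
  shows "(\<lambda>k. f (of_discrete k)) \<in> bcontfun"
  unfolding bcontfun_def
proof (intro CollectI conjI)
  show "continuous_on UNIV (\<lambda>k. f (of_discrete k))"
    using Discrete_Topology.open_discrete by (auto simp: continuous_on_open_vimage)
  have "range (\<lambda>k. f (of_discrete k)) \<subseteq> insert 0 (f ` F)" using assms by auto
  then show "bounded (range (\<lambda>k. f (of_discrete k)))"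
    using assms(1) by (meson finite_imp_bounded finite_imageI finite_insert finite_subset)
qed

definition dapply :: "('a discrete \<Rightarrow>\<^sub>C complex) \<Rightarrow> 'a \<Rightarrow> complex" where
  "dapply x k = apply_bcontfun x (discrete k)"

definition dfun :: "('a \<Rightarrow> complex) \<Rightarrow> 'a discrete \<Rightarrow>\<^sub>C complex" where
  "dfun f = Bcontfun (\<lambda>k. f (of_discrete k))"

lemma dapply_dfun:
  assumes "finite F" "\<And>k. k \<notin> F \<Longrightarrow> f k = 0"
  shows "dapply (dfun f) = f"
proof
  fix k
  have "apply_bcontfun (Bcontfun (\<lambda>k. f (of_discrete k))) = (\<lambda>k. f (of_discrete k))"
    by (rule Bcontfun_inverse, rule finite_support_bcontfun[of F]) (use assms in auto)
  then show "dapply (dfun f) k = f k" by (simp add: dapply_def dfun_def discrete_inverse)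
qed

lemma cmod_dapply_diff: "cmod (dapply x k - dapply y k) \<le> norm (x - y)"
  using norm_bounded[of "x - y" "discrete k"] by (simp add: dapply_def)

lemma norm_dapply_bound:
  assumes "\<And>k. cmod (dapply x k) \<le> b" shows "norm x \<le> b"
proof (rule norm_bound)
  fix k show "cmod (apply_bcontfun x k) \<le> b"
    using assms[of "of_discrete k"] by (simp add: dapply_def of_discrete_inverse)
qed

lemma bounded_linear_dapply: "bounded_linear (\<lambda>x. dapply x k)"
  by (rule bounded_linear_intro[where K=1]) (auto simp: norm_bounded dapply_def)

instance bcontfun :: (metric_space, banach) banach ..

definition clip_real :: "real \<Rightarrow> real \<Rightarrow> real" where "clip_real R x = max (- R) (min R x)"

text \<open>
  Clipping makes the quadratic right hand side globally Lipschitz. Real and imaginary part are treated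
  separately so that the map commutes with conjugation.
\<close>

definition clip :: "real \<Rightarrow> complex \<Rightarrow> complex" where
  "clip R z = Complex (clip_real R (Re z)) (clip_real R (Im z))"

lemma clip_lipschitz: "cmod (clip R z - clip R z') \<le> 2 * cmod (z - z')"
proof -
  have *: "\<bar>clip_real R x - clip_real R y\<bar> \<le> \<bar>x - y\<bar>" for x y by (simp add: clip_real_def)
  have "cmod (clip R z - clip R z') \<le> \<bar>clip_real R (Re z) - clip_real R (Re z')\<bar> + \<bar>clip_real R (Im z) - clip_real R (Im z')\<bar>"
    using cmod_le[of "clip R z - clip R z'"] by (simp add: clip_def)
  also have "\<dots> \<le> \<bar>Re (z - z')\<bar> + \<bar>Im (z - z')\<bar>" using * by (intro add_mono) auto
  also have "\<dots> \<le> 2 * cmod (z - z')" using abs_Re_le_cmod[of "z - z'"] abs_Im_le_cmod[of "z - z'"] by linarith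
  finally show ?thesis .
qed

lemma clip_bound: "0 \<le> R \<Longrightarrow> cmod (clip R z) \<le> 2 * R"
  using cmod_le[of "clip R z"] unfolding clip_def clip_real_def complex.sel by linarith

lemma clip_cnj: "0 \<le> R \<Longrightarrow> clip R (cnj z) = cnj (clip R z)"
  by (auto simp: clip_def clip_real_def complex_eq_iff)

lemma clip_id: "cmod z \<le> R \<Longrightarrow> clip R z = z"
  using abs_Re_le_cmod[of z] abs_Im_le_cmod[of z] by (auto simp: clip_def clip_real_def complex_eq_iff)

definition symmetrize :: "(int^'d \<Rightarrow> complex) \<Rightarrow> int^'d \<Rightarrow> complex" where
  "symmetrize a k = (a k + cnj (a (- k))) / 2"

lemma real_seq_symmetrize: "real_seq (symmetrize a)"
  by (simp add: real_seq_def symmetrize_def add.commute)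

lemma symmetrize_id: "real_seq a \<Longrightarrow> symmetrize a = a"
  by (rule ext) (simp add: real_seq_def symmetrize_def)

context transport_symbol begin

definition galerkin_rhs :: "nat \<Rightarrow> real \<Rightarrow> (int^'d \<Rightarrow> complex) \<Rightarrow> (int^'d \<Rightarrow> complex) \<Rightarrow> int^'d \<Rightarrow> complex" where
  "galerkin_rhs n R S a k = (if k \<in> fball n then S k - (\<Sum>p\<in>fball n. tm (\<lambda>l. clip R (a l)) (\<lambda>l. clip R (a l)) k p) else 0)"

lemma galerkin_rhs_real:
  assumes "real_seq S" "real_seq a" "0 \<le> R"
  shows "real_seq (galerkin_rhs n R S a)"
  unfolding real_seq_def
proof
  fix k
  let ?c = "\<lambda>l. clip R (a l)"
  have "real_seq ?c" using assms by (simp add: real_seq_def clip_cnj)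
  note t = tm_real[OF this, of k]
  have "(\<Sum>p\<in>fball n. tm ?c ?c (- k) p) = (\<Sum>p\<in>fball n. tm ?c ?c (- k) (- p))"
    by (rule sum.reindex_bij_witness[of _ uminus uminus]) auto
  also have "\<dots> = cnj (\<Sum>p\<in>fball n. tm ?c ?c k p)" by (simp add: t)
  finally show "galerkin_rhs n R S a (- k) = cnj (galerkin_rhs n R S a k)"
    using assms(1) by (simp add: galerkin_rhs_def real_seq_def)
qed

lemma galerkin_rhs_lipschitz:
  assumes "0 \<le> R" and D: "\<And>k. cmod (a k - b k) \<le> D"
  shows "cmod (galerkin_rhs n R S a k - galerkin_rhs n R S b k) \<le> (\<Sum>p\<in>(fball n :: (int^'d) set). K * norm (fr p)) * (8 * R) * D"
proof (cases "k \<in> fball n")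
  case True
  let ?a = "\<lambda>l. clip R (a l)" and ?b = "\<lambda>l. clip R (b l)"
  have "cmod (galerkin_rhs n R S a k - galerkin_rhs n R S b k) = cmod (\<Sum>p\<in>fball n. tm ?b ?b k p - tm ?a ?a k p)"
    using True by (simp add: galerkin_rhs_def sum_subtractf)
  also have "\<dots> \<le> (\<Sum>p\<in>(fball n :: (int^'d) set). K * norm (fr p) * ((8 * R) * D))"
  proof (intro sum_norm_le)
    fix p
    have q: "cmod (?b l - ?a l) \<le> 2 * D" for l
      using clip_lipschitz[of R "a l" "b l"] D[of l] by (simp add: norm_minus_commute)
    have D0: "0 \<le> D" using D[of 0] norm_ge_zero[of "a 0 - b 0"] by linarith
    let ?Y = "?b (k - p) * (?b p - ?a p) + (?b (k - p) - ?a (k - p)) * ?a p"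
    have "cmod ?Y \<le> cmod (?b (k - p)) * cmod (?b p - ?a p) + cmod (?b (k - p) - ?a (k - p)) * cmod (?a p)"
      by (rule order_trans[OF norm_triangle_ineq]) (simp add: norm_mult)
    also have "\<dots> \<le> (2 * R) * (2 * D) + (2 * D) * (2 * R)"
      using assms(1) D0 by (intro add_mono mult_mono clip_bound q) auto
    also have "\<dots> = (8 * R) * D" by simp
    finally have Y: "cmod ?Y \<le> (8 * R) * D" .
    have "cmod (tm ?b ?b k p - tm ?a ?a k p) = cmod (\<sigma> p (k - p)) * cmod ?Y"
      by (simp add: tm_def norm_mult[symmetric] algebra_simps)
    also have "\<dots> \<le> K * norm (fr p) * ((8 * R) * D)"
      by (rule mult_mono[OF symbol_le Y]) (use K_nonneg in auto)
    finally show "cmod (tm ?b ?b k p - tm ?a ?a k p) \<le> K * norm (fr p) * ((8 * R) * D)" .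
  qed
  also have "\<dots> = (\<Sum>p\<in>(fball n :: (int^'d) set). K * norm (fr p)) * (8 * R) * D"
    by (simp only: sum_distrib_right mult.assoc)
  finally show ?thesis .
next
  case False
  have "0 \<le> D" using D[of 0] norm_ge_zero[of "a 0 - b 0"] by linarith
  then show ?thesis using False assms K_nonneg by (simp add: galerkin_rhs_def sum_nonneg)
qed

text \<open>
  The equation is solved with the right hand side composed with \<open>symmetrize\<close>. Since the right hand side
  preserves real sequences, the symmetrization of that solution solves the original equation and is real.
\<close>

lemma galerkin_ode:
  assumes R: "0 \<le> R" and "0 \<le> T" and S: "real_seq S" and \<alpha>: "real_seq \<alpha>"
  shows "\<exists>y. (\<forall>t. real_seq (y t)) \<and> (\<forall>k\<in>fball n. y 0 k = \<alpha> k) \<and>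
     (\<forall>t\<in>{0..T}. (\<forall>k. k \<notin> fball n \<longrightarrow> y t k = 0) \<and>
        (\<forall>k. ((\<lambda>t. y t k) has_vector_derivative galerkin_rhs n R S (y t) k) (at t within {0..T})))"
proof -
  let ?B = "fball n :: (int^'d) set"
  define F where "F x = dfun (galerkin_rhs n R S (symmetrize (dapply x)))" for x :: "(int^'d) discrete \<Rightarrow>\<^sub>C complex"
  have F: "dapply (F x) = galerkin_rhs n R S (symmetrize (dapply x))" for x
    unfolding F_def by (intro dapply_dfun[of ?B]) (auto simp: galerkin_rhs_def)
  define L where "L = (\<Sum>p\<in>?B. K * norm (fr p)) * (8 * R)"
  have L: "norm (F x - F y) \<le> L * norm (x - y)" for x y
  proof (rule norm_dapply_bound)
    fix k
    have "cmod (symmetrize (dapply x) l - symmetrize (dapply y) l) \<le> norm (x - y)" for l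
    proof -
      have "symmetrize (dapply x) l - symmetrize (dapply y) l =
        ((dapply x l - dapply y l) + cnj (dapply x (- l) - dapply y (- l))) / 2"
        by (simp add: symmetrize_def field_simps)
      also have "cmod \<dots> \<le> (cmod (dapply x l - dapply y l) + cmod (dapply x (- l) - dapply y (- l))) / 2"
        unfolding norm_divide
        by (simp, metis complex_cnj_diff complex_mod_cnj norm_triangle_ineq)
      also have "\<dots> \<le> norm (x - y)" using cmod_dapply_diff[of x l y] cmod_dapply_diff[of x "- l" y] by simp
      finally show ?thesis .
    qed
    then have "cmod (dapply (F x) k - dapply (F y) k) \<le> L * norm (x - y)"
      unfolding L_def F by (intro galerkin_rhs_lipschitz R)
    then show "cmod (dapply (F x - F y) k) \<le> L * norm (x - y)" by (simp add: dapply_def)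
  qed
  have "0 \<le> L" unfolding L_def using K_nonneg R by (simp add: sum_nonneg)
  define x0 where "x0 = dfun (\<lambda>k. if k \<in> ?B then \<alpha> k else 0)"
  have x0: "dapply x0 = (\<lambda>k. if k \<in> ?B then \<alpha> k else 0)"
    unfolding x0_def by (intro dapply_dfun[of ?B]) auto
  obtain x where x: "x 0 = x0" "\<And>t. t \<in> {0..T} \<Longrightarrow> (x has_vector_derivative F (x t)) (at t within {0..T})"
    using ode_global_lipschitz[of F L T x0, OF L \<open>0 \<le> L\<close> \<open>0 \<le> T\<close>] by blast
  define y where "y t = symmetrize (dapply (x t))" for t
  have dx: "((\<lambda>t. dapply (x t) k) has_vector_derivative galerkin_rhs n R S (y t) k) (at t within {0..T})"
    if "t \<in> {0..T}" for t k
    using bounded_linear.has_vector_derivative[OF bounded_linear_dapply x(2)[OF that], of k] by (simp add: F y_def)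
  have real_y: "real_seq (y t)" for t by (simp add: y_def real_seq_symmetrize)
  have dy: "((\<lambda>t. y t k) has_vector_derivative galerkin_rhs n R S (y t) k) (at t within {0..T})"
    if t: "t \<in> {0..T}" for t k
  proof -
    have eq: "(\<lambda>t. y t k) = (\<lambda>t. (dapply (x t) k + cnj (dapply (x t) (- k))) / 2)"
      by (simp add: y_def symmetrize_def)
    have "((\<lambda>t. y t k) has_vector_derivative symmetrize (galerkin_rhs n R S (y t)) k) (at t within {0..T})"
      unfolding eq symmetrize_def[of "galerkin_rhs n R S (y t)"]
      by (intro has_vector_derivative_divide has_vector_derivative_add dx[OF t]
          bounded_linear.has_vector_derivative[OF bounded_linear_cnj dx[OF t]])
    then show ?thesis using symmetrize_id[OF galerkin_rhs_real[OF S real_y R]] by simp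
  qed
  have init: "y 0 k = (if k \<in> ?B then \<alpha> k else 0)" for k
    using \<alpha> by (simp add: y_def x x0 symmetrize_def real_seq_def)
  have "y t k = 0" if tk: "t \<in> {0..T}" "k \<notin> ?B" for t k
  proof -
    obtain c where c: "\<And>t. t \<in> {0..T} \<Longrightarrow> y t k = c"
    proof (rule has_vector_derivative_zero_constant[of "{0..T}" "\<lambda>t. y t k"])
      fix t assume "t \<in> {0..T}"
      then show "((\<lambda>t. y t k) has_vector_derivative 0) (at t within {0..T})"
        using dy[of t k] tk(2) by (simp add: galerkin_rhs_def)
    qed auto
    show ?thesis using c[OF tk(1)] c[of 0] tk(2) init[of k] \<open>0 \<le> T\<close> by simp
  qed
  then show ?thesis using real_y init dy by (intro exI[of _ y]) auto
qed

text \<open>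
  The bound on the derivative of the energy while the energy is at most \<open>E\<close> and the forcing has squared
  \<open>H\<^sup>s\<close>-norm \<open>ES\<close>. It does not depend on the order of the approximation.
\<close>

definition growth :: "real \<Rightarrow> real \<Rightarrow> real" where
  "growth E ES = 2 * (2 * K * (s * 2 powr (s - 1)) * \<kappa> * (sqrt E * E)) + E + ES"

text \<open>
  As long as the energy is at most \<open>E\<close>, every coefficient is at most \<open>sqrt E\<close> in modulus, so that clipping
  at \<open>R = sqrt E\<close> has no effect and the energy estimate applies. By \<open>bootstrap_bound\<close> this remains so up
  to time \<open>T\<close>.
\<close>

lemma galerkin_solution:
  assumes S: "real_seq S" "hsb S ES" and \<alpha>: "real_seq \<alpha>" "hsb \<alpha> E0"
    and E: "0 < E" and T: "0 \<le> T" "E0 + growth E ES * T < E"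
  shows "\<exists>y. (\<forall>k\<in>fball n. y 0 k = \<alpha> k) \<and>
     (\<forall>t\<in>{0..T}. real_seq (y t) \<and> hsb (y t) E \<and>
        (\<forall>k\<in>fball n. ((\<lambda>t. y t k) has_vector_derivative S k - Bil (y t) (y t) k) (at t within {0..T})))"
proof -
  let ?B = "fball n :: (int^'d) set"
  have E0: "0 \<le> E0" and ES: "0 \<le> ES" using assms hsb_nonneg by auto
  let ?f = "\<lambda>a. \<Sum>k\<in>?B. (w k * cmod (a k))\<^sup>2"
  have growth0: "0 \<le> growth E ES" if "0 \<le> E" for E
    unfolding growth_def using K_nonneg s_gt1 that ES by auto
  define R where "R = sqrt E"
  have R: "0 \<le> R" using E by (simp add: R_def)
  obtain y where y: "\<And>t. real_seq (y t)" "\<And>k. k \<in> ?B \<Longrightarrow> y 0 k = \<alpha> k"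
     "\<And>t k. t \<in> {0..T} \<Longrightarrow> k \<notin> ?B \<Longrightarrow> y t k = 0"
     "\<And>t k. t \<in> {0..T} \<Longrightarrow> ((\<lambda>t. y t k) has_vector_derivative galerkin_rhs n R S (y t) k) (at t within {0..T})"
    using galerkin_ode[OF R T(1) S(1) \<alpha>(1), of n] by blast
  have hsb_y: "hsb (y t) (?f (y t))" if t: "t \<in> {0..T}" for t
    unfolding hsb_def sums_le_def
  proof (intro allI impI)
    fix F :: "(int^'d) set" assume "finite F"
    then have "(\<Sum>k\<in>F. (w k * cmod (y t k))\<^sup>2) = (\<Sum>k\<in>F \<inter> ?B. (w k * cmod (y t k))\<^sup>2)"
      using y(3)[OF t] by (intro sum.mono_neutral_right) auto
    also have "\<dots> \<le> ?f (y t)" by (intro sum_mono2) auto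
    finally show "(\<Sum>k\<in>F. (w k * cmod (y t k))\<^sup>2) \<le> ?f (y t)" .
  qed
  have galerkin_rhs_eq: "galerkin_rhs n R S (y t) k = S k - (\<Sum>p\<in>?B. tm (y t) (y t) k p)"
    if t: "t \<in> {0..T}" and le: "?f (y t) \<le> E" and k: "k \<in> ?B" for t k
  proof -
    have "cmod (y t l) \<le> R" for l
      using hsb_cmod[OF hsb_y[OF t], of l] real_sqrt_le_mono[OF le] unfolding R_def by linarith
    then show ?thesis using k by (simp add: galerkin_rhs_def clip_id)
  qed
  let ?f' = "\<lambda>t. \<Sum>k\<in>?B. (w k)\<^sup>2 * (2 * Re (cnj (y t k) * galerkin_rhs n R S (y t) k))"
  have bound: "?f (y t) < E" if t: "t \<in> {0..T}" for t
  proof (rule bootstrap_bound[where f="\<lambda>t. ?f (y t)" and f' = ?f' and c="growth E ES" and T=T])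
    fix t assume t: "t \<in> {0..T}"
    show "((\<lambda>t. ?f (y t)) has_real_derivative ?f' t) (at t within {0..T})"
      unfolding power_mult_distrib
      by (intro DERIV_sum DERIV_cmult cmod_sq_derivative y(4) t)
    assume le: "?f (y t) \<le> E"
    let ?X = "\<Sum>k\<in>?B. \<Sum>p\<in>?B. of_real ((w k)\<^sup>2) * (cnj (y t k) * tm (y t) (y t) k p)"
    have "?f' t = (\<Sum>k\<in>?B. 2 * (w k)\<^sup>2 * Re (cnj (y t k) * S k)) - 2 * Re ?X"
      unfolding Re_sum sum_distrib_left sum_subtractf[symmetric]
    proof (intro sum.cong refl)
      fix k assume k: "k \<in> ?B"
      have "(\<Sum>p\<in>?B. 2 * Re (of_real ((w k)\<^sup>2) * (cnj (y t k) * tm (y t) (y t) k p)))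
         = 2 * (w k)\<^sup>2 * Re (cnj (y t k) * (\<Sum>p\<in>?B. tm (y t) (y t) k p))"
        by (simp only: Re_complex_of_real Im_complex_of_real times_complex.sel sum_distrib_left Re_sum) (simp add: mult_ac)
      then show "(w k)\<^sup>2 * (2 * Re (cnj (y t k) * galerkin_rhs n R S (y t) k)) =
        2 * (w k)\<^sup>2 * Re (cnj (y t k) * S k) - (\<Sum>p\<in>?B. 2 * Re (of_real ((w k)\<^sup>2) * (cnj (y t k) * tm (y t) (y t) k p)))"
        by (simp only: galerkin_rhs_eq[OF t le k]) (simp add: algebra_simps)
    qed
    also have "(\<Sum>k\<in>?B. 2 * (w k)\<^sup>2 * Re (cnj (y t k) * S k)) \<le> (\<Sum>k\<in>?B. (w k * cmod (y t k))\<^sup>2 + (w k * cmod (S k))\<^sup>2)"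
    proof (rule sum_mono)
      fix k
      have "2 * (w k)\<^sup>2 * Re (cnj (y t k) * S k) \<le> 2 * (w k)\<^sup>2 * (cmod (y t k) * cmod (S k))"
        by (intro mult_left_mono order_trans[OF complex_Re_le_cmod]) (auto simp: norm_mult)
      also have "\<dots> \<le> (w k * cmod (y t k))\<^sup>2 + (w k * cmod (S k))\<^sup>2"
        using sum_squares_bound[of "w k * cmod (y t k)" "w k * cmod (S k)"] by (simp add: power2_eq_square mult_ac)
      finally show "2 * (w k)\<^sup>2 * Re (cnj (y t k) * S k) \<le> (w k * cmod (y t k))\<^sup>2 + (w k * cmod (S k))\<^sup>2" .
    qed
    also have "\<dots> \<le> E + ES"
      using le S(2) by (simp add: sum.distrib add_mono hsb_def sums_le_def)
    finally have 1: "?f' t \<le> E + ES - 2 * Re ?X" by simp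
    define u where "u = ?f (y t)"
    have u: "0 \<le> u" "u \<le> E" using le by (auto simp: u_def intro!: sum_nonneg)
    define c where "c = 2 * K * (s * 2 powr (s - 1)) * \<kappa>"
    have c: "0 \<le> c" unfolding c_def using K_nonneg s_gt1 by simp
    have "sqrt u * u \<le> sqrt E * E" using u by (intro mult_mono) auto
    then have "c * (sqrt u * u) \<le> c * (sqrt E * E)" using c by (intro mult_left_mono) auto
    moreover have "- 2 * Re ?X \<le> 2 * (c * (sqrt u * u))"
      using energy_estimate[OF finite_fball y(1) hsb_y[OF t] y(3)[OF t] refl] unfolding u_def c_def by linarith
    ultimately show "?f' t \<le> growth E ES" using 1 unfolding growth_def c_def[symmetric] by linarith
  next
    show "0 \<le> growth E ES" using growth0 E by simp
    have "?f (y 0) \<le> E0"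
      using \<alpha>(2) y(2) by (simp add: hsb_def sums_le_def)
    then show "?f (y 0) + growth E ES * T < E" using T by linarith
  qed (use t in auto)
  show ?thesis
  proof (intro exI[of _ y] conjI ballI)
    show "y 0 k = \<alpha> k" if "k \<in> ?B" for k by (rule y(2)[OF that])
    fix t assume t: "t \<in> {0..T}"
    show "real_seq (y t)" by (rule y(1))
    show "hsb (y t) E" unfolding hsb_def
      by (rule sums_le_mono[OF hsb_y[OF t, unfolded hsb_def]]) (use bound[OF t] in auto)
    fix k assume k: "k \<in> ?B"
    have "Bil (y t) (y t) k = infsum (tm (y t) (y t) k) ?B"
      unfolding Bil_def by (rule infsum_cong_neutral) (auto simp: tm_def y(3)[OF t])
    then show "((\<lambda>t. y t k) has_vector_derivative S k - Bil (y t) (y t) k) (at t within {0..T})"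
      using y(4)[OF t, of k] galerkin_rhs_eq[OF t less_imp_le[OF bound[OF t]] k] by simp
  qed
qed

end

context transport_symbol begin

text \<open>
  By \<open>stability\<close> the Galerkin solutions form a Cauchy sequence, at each frequency and uniformly in time.
  Together with the uniform smallness of the tails, the convergence is uniform in time even in the norm
  \<open>\<Sum>k. jb k * cmod (a k)\<close>, in which \<open>Bil\<close> is continuous. Hence the derivatives converge uniformly as
  well.
\<close>

theorem fourier_existence:
  assumes \<alpha>: "real_seq \<alpha>" "hsb \<alpha> E0" and S: "real_seq S" "hsb S ES"
  shows "\<exists>T>0. \<exists>E a. (\<forall>t\<in>{0..T}. real_seq (a t) \<and> hsb (a t) E) \<and> (\<forall>k. a 0 k = \<alpha> k) \<and>
     (\<forall>t\<in>{0..T}. \<forall>k. ((\<lambda>t. a t k) has_vector_derivative S k - Bil (a t) (a t) k) (at t within {0..T}))"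
proof -
  define E where "E = E0 + 1"
  have E: "0 < E" using hsb_nonneg[OF \<alpha>(2)] by (simp add: E_def)
  have g: "0 \<le> growth E ES"
    unfolding growth_def using K_nonneg s_gt1 E hsb_nonneg[OF S(2)] by simp
  \<comment> \<open>On this interval the energy grows by less than \<open>1 = E - E0\<close>.\<close>
  define T where "T = 1 / (growth E ES + 1)"
  have T: "0 < T" using g by (simp add: T_def)
  have ET: "E0 + growth E ES * T < E" using g by (simp add: T_def E_def field_simps)
  have "\<forall>n. \<exists>y. (\<forall>k\<in>fball n. y 0 k = \<alpha> k) \<and>
     (\<forall>t\<in>{0..T}. real_seq (y t) \<and> hsb (y t) E \<and>
        (\<forall>k\<in>fball n. ((\<lambda>t. y t k) has_vector_derivative S k - Bil (y t) (y t) k) (at t within {0..T})))"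
    using galerkin_solution[OF S \<alpha> E less_imp_le[OF T] ET] by blast
  then obtain x where x0: "\<And>n k. k \<in> fball n \<Longrightarrow> x n 0 k = \<alpha> k"
    and xr: "\<And>n t. t \<in> {0..T} \<Longrightarrow> real_seq (x n t)" and xh: "\<And>n t. t \<in> {0..T} \<Longrightarrow> hsb (x n t) E"
    and xd: "\<And>n t k. t \<in> {0..T} \<Longrightarrow> k \<in> fball n \<Longrightarrow>
      ((\<lambda>t. x n t k) has_vector_derivative S k - Bil (x n t) (x n t) k) (at t within {0..T})"
    unfolding choice_iff by blast
  define h where "h N = sqrt (\<eta> E T N)" for N
  have "(\<lambda>N. sqrt (\<eta> E T N)) \<longlonglongrightarrow> sqrt 0" by (intro tendsto_real_sqrt \<eta>_tendsto)
  then have h: "h \<longlonglongrightarrow> 0" unfolding h_def[abs_def] by simp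
  have close: "cmod (x n t k - x m t k) \<le> h N"
    if "N \<le> n" "N \<le> m" "t \<in> {0..T}" "k \<in> fball N" for n m N t k
  proof -
    have sub: "l \<in> fball n \<and> l \<in> fball m" if "l \<in> fball N" for l :: "int^'d"
      using fball_mono[OF \<open>N \<le> n\<close>] fball_mono[OF \<open>N \<le> m\<close>] that by blast
    have "(cmod (x n t k - x m t k))\<^sup>2 \<le> (\<Sum>k\<in>fball N. (cmod (x n t k - x m t k))\<^sup>2)"
      using that by (intro member_le_sum) auto
    also have "\<dots> \<le> \<eta> E T N"
      by (rule stability[where S=S]) (use xr xh xd sub x0 that in auto)
    finally show ?thesis unfolding h_def by (rule real_le_rsqrt)
  qed
  have lim: "\<exists>l. (\<lambda>n. x n t k) \<longlonglongrightarrow> l" if t: "t \<in> {0..T}" for t k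
    unfolding convergent_eq_Cauchy
  proof (rule metric_CauchyI)
    fix e :: real assume "0 < e"
    obtain N1 where N1: "{k} \<subseteq> fball N1" using finite_subset_fball[of "{k}"] by blast
    obtain N2 where N2: "\<And>N. N \<ge> N2 \<Longrightarrow> h N < e"
      using order_tendstoD(2)[OF h \<open>0 < e\<close>] by (auto simp: eventually_sequentially)
    let ?N = "max N1 N2"
    have "k \<in> fball ?N" using N1 fball_mono[of N1 ?N] by auto
    then have "dist (x m t k) (x n t k) < e" if "m \<ge> ?N" "n \<ge> ?N" for m n
      using close[OF that t] N2[of ?N] by (fastforce simp: dist_norm)
    then show "\<exists>M. \<forall>m\<ge>M. \<forall>n\<ge>M. dist (x m t k) (x n t k) < e" by blast
  qed
  then obtain a where a: "\<And>t k. t \<in> {0..T} \<Longrightarrow> (\<lambda>n. x n t k) \<longlonglongrightarrow> a t k" by metis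
  have close': "cmod (x n t k - a t k) \<le> h N"
    if "N \<le> n" "t \<in> {0..T}" "k \<in> fball N" for n N t k
  proof (rule LIMSEQ_le_const2)
    show "(\<lambda>m. cmod (x n t k - x m t k)) \<longlonglongrightarrow> cmod (x n t k - a t k)"
      by (intro tendsto_intros a that)
  qed (use close that in blast)
  have ah: "hsb (a t) E" if t: "t \<in> {0..T}" for t
    unfolding hsb_def sums_le_def
  proof (intro allI impI)
    fix F :: "(int^'d) set" assume F: "finite F"
    have "(\<lambda>n. \<Sum>k\<in>F. (w k * cmod (x n t k))\<^sup>2) \<longlonglongrightarrow> (\<Sum>k\<in>F. (w k * cmod (a t k))\<^sup>2)"
      by (intro tendsto_intros a t)
    then show "(\<Sum>k\<in>F. (w k * cmod (a t k))\<^sup>2) \<le> E"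
      by (rule LIMSEQ_le_const2) (use xh[OF t] F in \<open>auto simp: hsb_def sums_le_def\<close>)
  qed
  have ar: "real_seq (a t)" if t: "t \<in> {0..T}" for t
    unfolding real_seq_def
  proof
    fix k
    have "(\<lambda>n. cnj (x n t k)) \<longlonglongrightarrow> cnj (a t k)" by (intro tendsto_intros a t)
    then have "(\<lambda>n. x n t (- k)) \<longlonglongrightarrow> cnj (a t k)" using xr[OF t] by (simp add: real_seq_def)
    then show "a t (- k) = cnj (a t k)" by (rule LIMSEQ_unique[OF a[OF t]])
  qed
  have a0: "a 0 k = \<alpha> k" for k
  proof -
    obtain N where N: "{k} \<subseteq> fball N" using finite_subset_fball[of "{k}"] by blast
    have "\<forall>\<^sub>F n in sequentially. x n 0 k = \<alpha> k"
      unfolding eventually_sequentially using N fball_mono x0 by (intro exI[of _ N]) blast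
    then have "(\<lambda>n. x n 0 k) \<longlonglongrightarrow> \<alpha> k" by (rule tendsto_eventually)
    then show ?thesis using LIMSEQ_unique[OF a[of 0 k]] T by simp
  qed
  have l1: "\<exists>N. \<forall>n\<ge>N. \<forall>t\<in>{0..T}. sums_le (\<lambda>k. jb k * cmod (x n t k - a t k)) e" if e: "0 < e" for e
  proof -
    have "(\<lambda>n. sqrt (4 * E) * \<rho> n) \<longlonglongrightarrow> sqrt (4 * E) * 0" by (intro tendsto_intros \<rho>_tendsto)
    then have "\<forall>\<^sub>F n in sequentially. sqrt (4 * E) * \<rho> n < e / 2"
      using e by (intro order_tendstoD(2)) auto
    then obtain K0 where K0: "sqrt (4 * E) * \<rho> K0 < e / 2" by (auto simp: eventually_sequentially)
    let ?J = "\<Sum>k\<in>(fball K0 :: (int^'d) set). jb k"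
    have "(\<lambda>N. ?J * h N) \<longlonglongrightarrow> ?J * 0" by (intro tendsto_intros h)
    then have "\<forall>\<^sub>F N in sequentially. ?J * h N < e / 2"
      using e by (intro order_tendstoD(2)) auto
    then obtain N1 where N1: "\<And>N. N \<ge> N1 \<Longrightarrow> ?J * h N < e / 2" by (auto simp: eventually_sequentially)
    define N where "N = max N1 K0"
    show ?thesis
    proof (intro exI[of _ N] allI impI ballI)
      fix n t assume n: "N \<le> n" and t: "t \<in> {0..T}"
      let ?d = "\<lambda>k. x n t k - a t k"
      have d: "hsb ?d (4 * E)" by (rule hsb_diff[OF xh[OF t] ah[OF t]])
      have hN: "0 \<le> h N" using close'[OF n t, of 0] by (simp add: h_def \<eta>_def) (use E K_nonneg T in simp)
      show "sums_le (\<lambda>k. jb k * cmod (?d k)) e"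
        unfolding sums_le_def
      proof (intro allI impI)
        fix F :: "(int^'d) set" assume F: "finite F"
        have "(\<Sum>k\<in>F. jb k * cmod (?d k)) = (\<Sum>k\<in>F \<inter> fball K0. jb k * cmod (?d k)) + (\<Sum>k\<in>F - fball K0. jb k * cmod (?d k))"
          using F by (subst sum.union_disjoint[symmetric]) (auto intro!: sum.cong)
        also have "(\<Sum>k\<in>F \<inter> fball K0. jb k * cmod (?d k)) \<le> (\<Sum>k\<in>(fball K0 :: (int^'d) set). jb k * h N)"
        proof (rule order_trans[OF sum_mono sum_mono2])
          fix k assume "k \<in> F \<inter> fball K0"
          then have "k \<in> fball N" using fball_mono[of K0 N] by (auto simp: N_def)
          then show "jb k * cmod (?d k) \<le> jb k * h N" by (intro mult_left_mono close' n t) auto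
        qed (use hN in auto)
        also have "\<dots> = ?J * h N" by (simp add: sum_distrib_right)
        also have "\<dots> \<le> e / 2" using N1[of N] by (simp add: N_def)
        also have "(\<Sum>k\<in>F - fball K0. jb k * cmod (?d k)) \<le> sqrt (4 * E) * \<rho> K0"
          using F by (intro hsb_l1_tail[OF d]) auto
        also have "\<dots> \<le> e / 2" using K0 by simp
        finally show "(\<Sum>k\<in>F. jb k * cmod (?d k)) \<le> e" by simp
      qed
    qed
  qed
  have conv: "\<exists>N. \<forall>n\<ge>N. \<forall>t\<in>{0..T}. \<forall>k. cmod (Bil (x n t) (x n t) k - Bil (a t) (a t) k) \<le> e" if e: "0 < e" for e
  proof -
    define c where "c = K * sqrt E + K * (sqrt E * \<kappa>) + 1"
    have c: "0 < c" unfolding c_def using K_nonneg E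
      by (intro add_nonneg_pos add_nonneg_nonneg mult_nonneg_nonneg) auto
    obtain N where N: "\<And>n t. n \<ge> N \<Longrightarrow> t \<in> {0..T} \<Longrightarrow> sums_le (\<lambda>k. jb k * cmod (x n t k - a t k)) (e / c)"
      using l1[OF divide_pos_pos[OF e c]] by blast
    show ?thesis
    proof (intro exI[of _ N] allI impI ballI)
      fix n t k assume n: "N \<le> n" and t: "t \<in> {0..T}"
      let ?d = "\<lambda>k. x n t k - a t k"
      note sd = N[OF n t]
      have dle: "cmod (?d l) \<le> e / c" for l
        using sums_le_single[OF sd, of l] cmod_le_jb_cmod[of "?d l" l] by linarith
      have "cmod (Bil (x n t) (x n t) k - Bil (a t) (a t) k) \<le> cmod (Bil (x n t) ?d k) + cmod (Bil ?d (a t) k)"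
        unfolding Bil_diff[OF xh[OF t] ah[OF t]] by (rule norm_triangle_ineq)
      also have "\<dots> \<le> K * sqrt E * (e / c) + K * (e / c) * (sqrt E * \<kappa>)"
        by (intro add_mono Bil_norm hsb_cmod[OF xh[OF t]] sd dle hsb_l1[OF ah[OF t]])
      also have "\<dots> = (e / c) * (c - 1)"
      proof -
        have "K * sqrt E * u + K * u * (sqrt E * \<kappa>) = u * (c - 1)" for u
          by (simp add: c_def algebra_simps)
        then show ?thesis .
      qed
      also have "\<dots> \<le> (e / c) * c" using e c by (intro mult_left_mono) auto
      also have "\<dots> = e" using c by simp
      finally show "cmod (Bil (x n t) (x n t) k - Bil (a t) (a t) k) \<le> e" .
    qed
  qed
  have ad: "((\<lambda>t. a t k) has_vector_derivative S k - Bil (a t) (a t) k) (at t within {0..T})"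
    if t: "t \<in> {0..T}" for t k
  proof -
    obtain N1 where N1: "{k} \<subseteq> fball N1" using finite_subset_fball[of "{k}"] by blast
    have kn: "k \<in> fball (n + N1)" for n using N1 fball_mono[of N1 "n + N1"] by auto
    have "\<exists>g. \<forall>t\<in>{0..T}. (\<lambda>n. x (n + N1) t k) \<longlonglongrightarrow> g t \<and>
       (g has_derivative (\<lambda>r. r *\<^sub>R (S k - Bil (a t) (a t) k))) (at t within {0..T})"
    proof (rule has_derivative_sequence)
      show "((\<lambda>t. x (n + N1) t k) has_derivative (\<lambda>r. r *\<^sub>R (S k - Bil (x (n + N1) t) (x (n + N1) t) k))) (at t within {0..T})"
        if "t \<in> {0..T}" for n t
        using xd[OF that kn] by (simp add: has_vector_derivative_def)
      show "\<forall>\<^sub>F n in sequentially. \<forall>t\<in>{0..T}. \<forall>r.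
          norm (r *\<^sub>R (S k - Bil (x (n + N1) t) (x (n + N1) t) k) - r *\<^sub>R (S k - Bil (a t) (a t) k)) \<le> e * norm r"
        if e: "0 < e" for e
      proof -
        obtain N where N: "\<And>n t k. n \<ge> N \<Longrightarrow> t \<in> {0..T} \<Longrightarrow> cmod (Bil (x n t) (x n t) k - Bil (a t) (a t) k) \<le> e"
          using conv[OF e] by blast
        have "norm (r *\<^sub>R (S k - Bil (x (n + N1) t) (x (n + N1) t) k) - r *\<^sub>R (S k - Bil (a t) (a t) k)) \<le> e * norm r"
          if "n \<ge> N" "t \<in> {0..T}" for n t r
        proof -
          have "r *\<^sub>R (S k - Bil (x (n + N1) t) (x (n + N1) t) k) - r *\<^sub>R (S k - Bil (a t) (a t) k)
            = r *\<^sub>R (Bil (a t) (a t) k - Bil (x (n + N1) t) (x (n + N1) t) k)"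
            by (simp add: scaleR_diff_right)
          then show ?thesis using mult_left_mono[OF N[of "n + N1" t k], of "\<bar>r\<bar>"] that
            by (simp add: norm_minus_commute mult.commute)
        qed
        then show ?thesis unfolding eventually_sequentially by blast
      qed
      show "(\<lambda>n. x (n + N1) 0 k) \<longlonglongrightarrow> a 0 k"
        using T by (intro LIMSEQ_ignore_initial_segment a) auto
    qed (use T in auto)
    then obtain g where g: "\<And>t. t \<in> {0..T} \<Longrightarrow> (\<lambda>n. x (n + N1) t k) \<longlonglongrightarrow> g t"
      "\<And>t. t \<in> {0..T} \<Longrightarrow> (g has_derivative (\<lambda>r. r *\<^sub>R (S k - Bil (a t) (a t) k))) (at t within {0..T})"
      by blast
    have "g t = a t k" if "t \<in> {0..T}" for t
      using LIMSEQ_unique[OF g(1)[OF that] LIMSEQ_ignore_initial_segment[OF a[OF that]]] .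
    then show ?thesis unfolding has_vector_derivative_def
      by (intro has_derivative_transform[OF t _ g(2)[OF t]]) simp
  qed
  show ?thesis using T ah ar a0 ad by blast
qed

end

section \<open>Completeness of the exponentials\<close>

definition ew :: "int^'d::finite \<Rightarrow> real^'d \<Rightarrow> complex" where
  "ew k x = cis (freq_dot k x)"

lemma freq_dot_add: "freq_dot (k + l) x = freq_dot k x + freq_dot l x"
  and freq_dot_uminus: "freq_dot (- k) x = - freq_dot k x"
  and freq_dot_0 [simp]: "freq_dot 0 x = 0"
  by (simp_all add: freq_dot_fr fr_add fr_uminus inner_add_left)

lemma ew_add: "ew (k + l) x = ew k x * ew l x"
  by (simp add: ew_def freq_dot_add cis_mult)

lemma ew_0 [simp]: "ew 0 x = 1"
  by (simp add: ew_def)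

lemma ew_uminus: "ew (- k) x = cnj (ew k x)"
  by (simp add: ew_def freq_dot_uminus cis_cnj)

lemma norm_ew [simp]: "cmod (ew k x) = 1"
  by (simp add: ew_def)

lemma cis_minus_freq: "cis (- freq_dot k x) = ew (- k) x"
  by (simp add: ew_def freq_dot_uminus)

lemma continuous_ew: "continuous_on A (ew k)"
  unfolding ew_def freq_dot_fr by (intro continuous_intros continuous_on_cis)

lemma ew_measurable [measurable]: "ew k \<in> borel_measurable borel"
  by (rule borel_measurable_continuous_onI[OF continuous_ew])

lemma periodic_ew: "periodic (ew (k :: int^'d::finite))"
  unfolding periodic_def
proof (intro allI)
  fix x :: "real^'d" and i
  have "freq_dot k (x + (2 * pi) *\<^sub>R axis i 1) = freq_dot k x + 2 * pi * real_of_int (k $ i)"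
    by (simp add: freq_dot_fr inner_add_right inner_axis fr_nth)
  then show "ew k (x + (2 * pi) *\<^sub>R axis i 1) = ew k x"
    by (simp add: ew_def cis_mult[symmetric])
qed

text \<open>
  Lebesgue measure is a product measure, so the integral over the cell of an exponential is a product of
  integrals over \<open>{0..2*pi}\<close>.
\<close>

lemma lborel_integral_prod:
  fixes f :: "'a::euclidean_space \<Rightarrow> real \<Rightarrow> complex"
  assumes f: "\<And>b. b \<in> Basis \<Longrightarrow> integrable lborel (f b)"
  shows "(LINT x|lborel. (\<Prod>b\<in>Basis. f b (x \<bullet> b))) = (\<Prod>b\<in>Basis. integral\<^sup>L lborel (f b))"
proof -
  interpret product_sigma_finite "\<lambda>_::'a. lborel :: real measure"
    by standard
  have m: "f b \<in> borel_measurable borel" if "b \<in> Basis" for b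
    using f[OF that] borel_measurable_integrable by auto
  have "(LINT x|lborel. (\<Prod>b\<in>Basis. f b (x \<bullet> b))) =
     (LINT g|(\<Pi>\<^sub>M b\<in>Basis. lborel). (\<Prod>b\<in>Basis. f b ((\<Sum>c\<in>Basis. g c *\<^sub>R c) \<bullet> (b::'a))))"
    unfolding lborel_eq[where 'a='a]
  proof (rule integral_distr)
    have "(\<lambda>x. f b (x \<bullet> b)) \<in> borel_measurable borel" if "b \<in> Basis" for b :: 'a
      using measurable_compose[OF _ m[OF that], of "\<lambda>x. x \<bullet> b" borel] by simp
    then show "(\<lambda>x. \<Prod>b\<in>Basis. f b (x \<bullet> b)) \<in> borel_measurable borel"
      by (intro borel_measurable_prod) auto
  qed measurable
  also have "\<dots> = (LINT g|(\<Pi>\<^sub>M b\<in>Basis. lborel). (\<Prod>b\<in>Basis. f b (g (b::'a))))"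
    by (intro Bochner_Integration.integral_cong refl prod.cong)
       (simp add: inner_sum_left inner_Basis if_distrib cong: if_cong)
  also have "\<dots> = (\<Prod>b\<in>Basis. integral\<^sup>L lborel (f b))"
    by (rule product_integral_prod) (use f in auto)
  finally show ?thesis .
qed

lemma integral_cis_interval:
  "integrable lborel (\<lambda>y. indicator {0..2*pi} y *\<^sub>R cis (of_int n * y))"
  "(LINT y|lborel. indicator {0..2*pi} y *\<^sub>R cis (of_int n * y)) = (if n = 0 then 2 * pi else 0)"
proof -
  define F where "F y = (if n = 0 then of_real y else cis (of_int n * y) / (\<i> * of_int n))" for y
  have "has_bochner_integral lborel (\<lambda>y. indicator {0..2*pi} y *\<^sub>R cis (of_int n * y)) (F (2 * pi) - F 0)"
  proof (rule has_bochner_integral_FTC_Icc)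
    fix y
    have c: "((\<lambda>y. cis (of_int n * y)) has_vector_derivative (\<i> * of_int n * cis (of_int n * y))) (at y within A)" for A
    proof -
      have "((\<lambda>y. exp (\<i> * of_int n * of_real y)) has_vector_derivative (\<i> * of_int n * exp (\<i> * of_int n * of_real y))) (at y within A)"
        by (rule has_vector_derivative_real_field derivative_eq_intros | simp)+
      then show ?thesis by (simp add: cis_conv_exp mult_ac)
    qed
    show "(F has_vector_derivative cis (of_int n * y)) (at y within {0..2*pi})"
    proof (cases "n = 0")
      case True
      have "(complex_of_real has_vector_derivative 1) (at y within {0..2*pi})"
        using bounded_linear.has_vector_derivative[OF bounded_linear_of_real has_vector_derivative_id] by simp
      then show ?thesis using True by (simp add: F_def[abs_def])
    next
      case False
      have "((\<lambda>y. cis (of_int n * y) / (\<i> * of_int n)) has_vector_derivative (\<i> * of_int n * cis (of_int n * y)) / (\<i> * of_int n)) (at y within {0..2*pi})"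
        by (intro has_vector_derivative_divide c)
      then show ?thesis using False by (simp add: F_def[abs_def])
    qed
    show "continuous_on {0..2*pi} (\<lambda>y. cis (of_int n * y))"
      by (intro continuous_intros continuous_on_cis)
  qed simp
  moreover have "F (2 * pi) - F 0 = (if n = 0 then 2 * pi else 0)"
    using cis_multiple_2pi[of "of_int n"] by (auto simp: F_def mult.commute)
  ultimately show "integrable lborel (\<lambda>y. indicator {0..2*pi} y *\<^sub>R cis (of_int n * y))"
    "(LINT y|lborel. indicator {0..2*pi} y *\<^sub>R cis (of_int n * y)) = (if n = 0 then 2 * pi else 0)"
    by (auto simp: has_bochner_integral_iff)
qed

lemma torus_cell_eq: "torus_cell = {x::real^'d. \<forall>i. 0 \<le> x $ i \<and> x $ i \<le> 2 * pi}"
  by (auto simp: torus_cell_def mem_box_cart)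

lemma torus_cell_borel [measurable]: "torus_cell \<in> sets borel" "torus_cell \<in> sets lebesgue"
  by (auto simp: torus_cell_def)

lemma emeasure_torus_cell: "emeasure lborel (torus_cell :: (real^'d) set) < \<infinity>"
  by (simp add: torus_cell_def emeasure_lborel_cbox_eq)

lemma cell_integral_ew:
  "(LINT x:torus_cell|lebesgue. ew k x) = (if k = (0 :: int^'d::finite) then (2 * pi) ^ CARD('d) else 0)"
proof -
  define n where "n b = (THE j::int. real_of_int j = fr k \<bullet> b)" for b :: "real^'d"
  have n: "n (axis i 1) = k $ i" for i
    unfolding n_def by (rule the_equality) (auto simp: inner_axis fr_nth)
  define f where "f b y = indicator {0..2*pi} y *\<^sub>R cis (of_int (n b) * y)" for b :: "real^'d" and y :: real
  have bas: "(Basis :: (real^'d) set) = (\<lambda>i. axis i 1) ` UNIV"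
    by (auto simp: Basis_vec_def)
  have reind: "(\<Prod>b\<in>(Basis :: (real^'d) set). g b) = (\<Prod>i\<in>UNIV. g (axis i 1))" for g :: "real^'d \<Rightarrow> complex"
    unfolding bas by (subst prod.reindex) (auto simp: inj_on_def axis_eq_axis)
  have pt: "indicator torus_cell x *\<^sub>R ew k x = (\<Prod>b\<in>Basis. f b (x \<bullet> b))" for x :: "real^'d"
  proof -
    have ind: "(\<Prod>i\<in>UNIV. indicator {0..2*pi} (x $ i)) = (indicator torus_cell x :: real)"
    proof (cases "x \<in> torus_cell")
      case False
      then obtain i where "\<not> (0 \<le> x $ i \<and> x $ i \<le> 2 * pi)" by (auto simp: torus_cell_eq)
      then have "indicator {0..2*pi} (x $ i) = (0::real)" by auto
      then have "(\<Prod>i\<in>UNIV. indicator {0..2*pi} (x $ i)) = (0::real)" by (meson UNIV_I finite prod_zero)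
      then show ?thesis using False by simp
    qed (auto simp: torus_cell_eq)
    have cs: "(\<Prod>i\<in>I. cis (of_int (k $ i) * x $ i)) = cis (\<Sum>i\<in>I. of_int (k $ i) * x $ i)" for I
      by (induction I rule: infinite_finite_induct) (auto simp: cis_mult)
    have "(\<Prod>b\<in>Basis. f b (x \<bullet> b)) = (\<Prod>i\<in>UNIV. of_real (indicator {0..2*pi} (x $ i)) * cis (of_int (k $ i) * x $ i))"
      unfolding reind f_def by (simp add: n cart_eq_inner_axis[symmetric] scaleR_conv_of_real)
    also have "\<dots> = of_real (\<Prod>i\<in>UNIV. indicator {0..2*pi} (x $ i)) * cis (freq_dot k x)"
      unfolding prod.distrib cs freq_dot_def of_real_prod by simp
    finally show ?thesis unfolding ind ew_def by (simp add: scaleR_conv_of_real)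
  qed
  have "(LINT x:torus_cell|lebesgue. ew k x) = (LINT x|lborel. indicator torus_cell x *\<^sub>R ew k x)"
    unfolding set_lebesgue_integral_def by (intro integral_completion) measurable
  also have "\<dots> = (LINT x|lborel. (\<Prod>b\<in>Basis. f b (x \<bullet> b)))" unfolding pt ..
  also have "\<dots> = (\<Prod>b\<in>Basis. integral\<^sup>L lborel (f b))"
    by (rule lborel_integral_prod) (simp add: f_def integral_cis_interval)
  also have "\<dots> = (\<Prod>i\<in>UNIV. if k $ i = 0 then 2 * pi else 0)"
    unfolding reind f_def integral_cis_interval by (simp add: n)
  also have "\<dots> = (if k = 0 then (2 * pi) ^ CARD('d) else 0)"
    by (auto simp: vec_eq_iff)
  finally show ?thesis .
qed

text \<open>
  The sets over which \<open>h\<close> integrates to zero form a Dynkin system that contains all boxes, hence all Borel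
  sets, and in particular the sets where \<open>h\<close> is positive or negative.
\<close>

lemma AE_zero_of_box_integrals:
  fixes h :: "'a::euclidean_space \<Rightarrow> real"
  assumes int: "integrable lborel h" and tot: "integral\<^sup>L lborel h = 0"
    and box: "\<And>a b. (LINT x:box a b|lborel. h x) = 0"
  shows "AE x in lborel. h x = 0"
proof -
  have si: "set_integrable lborel A h" if "A \<in> sets borel" for A
    unfolding set_integrable_def using that int by (intro integrable_mult_indicator) auto
  have all: "(LINT x:A|lborel. h x) = 0" if "A \<in> sets borel" for A
  proof -
    have "Int_stable (range (\<lambda>(a, b). box a b) :: 'a set set)"
      by (auto simp: Int_stable_def box_Int_box)
    moreover have "(range (\<lambda>(a, b). box a b) :: 'a set set) \<subseteq> Pow UNIV" by auto
    moreover have "A \<in> sigma_sets UNIV (range (\<lambda>(a, b). box a b))"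
      using that unfolding borel_eq_box by simp
    ultimately show ?thesis
    proof (induction rule: sigma_sets_induct_disjoint)
      case (basic A) then show ?case using box by auto
    next
      case empty then show ?case by (simp add: set_lebesgue_integral_def)
    next
      case (compl A)
      have A: "A \<in> sets borel" using compl(1) by (simp add: borel_eq_box)
      have "(LINT x:A \<union> (UNIV - A)|lborel. h x) = (LINT x:A|lborel. h x) + (LINT x:UNIV - A|lborel. h x)"
        using A si by (intro set_integral_Un) auto
      then show ?case using compl tot by (simp add: set_lebesgue_integral_def)
    next
      case (union A)
      have A: "A i \<in> sets borel" for i using union(2) by (auto simp: borel_eq_box)
      have "(LINT x:(\<Union>i. A i)|lborel. h x) = (\<Sum>i. (LINT x:A i|lborel. h x))"
        using A union(1) by (intro lebesgue_integral_countable_add si)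
          (auto simp: disjoint_family_on_def)
      then show ?case using union by simp
    qed
  qed
  have hm [measurable]: "h \<in> borel_measurable borel" using int by auto
  have pos: "AE x in lborel. indicator {x. g x > 0} x * g x = 0"
    if "g = h \<or> g = (\<lambda>x. - h x)" for g
  proof -
    have [measurable]: "g \<in> borel_measurable borel" using that by auto
    have A: "{x. g x > 0} \<in> sets borel" by measurable
    have gi: "integrable lborel g" using that int by auto
    have i: "integrable lborel (\<lambda>x. indicator {x. g x > 0} x * g x)"
      using integrable_mult_indicator[OF _ gi, of "{x. g x > 0}"] A by simp
    have "(LINT x|lborel. indicator {x. g x > 0} x * g x) = 0"
      using that all[OF A] by (auto simp: set_lebesgue_integral_def)
    then show ?thesis
      using integral_nonneg_eq_0_iff_AE[OF i] by (auto simp: indicator_def)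
  qed
  have "AE x in lborel. indicator {x. h x > 0} x * h x = 0"
    "AE x in lborel. indicator {x. - h x > 0} x * (- h x) = 0"
    using pos[of h] pos[of "\<lambda>x. - h x"] by blast+
  then show ?thesis
  proof eventually_elim
    case (elim x) then show ?case by (cases "h x > 0"; cases "h x < 0") auto
  qed
qed

text \<open>
  Arcs of the circle are superlevel sets of a shifted cosine. This makes boxes accessible to
  trigonometric polynomials.
\<close>

lemma arc_iff_cos:
  assumes "0 \<le> a" "a < b" "b \<le> 2 * pi" "0 \<le> x" "x \<le> 2 * pi"
  shows "cos ((b - a) / 2) < cos (x - (a + b) / 2) \<longleftrightarrow> a < x \<and> x < b"
proof -
  define \<delta> where "\<delta> = (b - a) / 2"
  define u where "u = \<bar>x - (a + b) / 2\<bar>"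
  have cu: "cos (x - (a + b) / 2) = cos u" by (simp add: u_def)
  have \<delta>: "0 < \<delta>" "\<delta> \<le> pi" using assms by (auto simp: \<delta>_def)
  have u: "0 \<le> u" "u \<le> 2 * pi - \<delta>" using assms by (auto simp: u_def \<delta>_def abs_if field_simps)
  have iff: "a < x \<and> x < b \<longleftrightarrow> u < \<delta>" by (auto simp: u_def \<delta>_def abs_if field_simps)
  show ?thesis
  proof (cases "u < \<delta>")
    case True
    then have "cos \<delta> < cos u" using u \<delta> by (intro cos_monotone_0_pi) auto
    then show ?thesis using iff True cu by (simp add: \<delta>_def)
  next
    case False
    have "cos u \<le> cos \<delta>"
    proof (cases "u \<le> pi")
      case True then show ?thesis using False \<delta> by (intro cos_monotone_0_pi_le) auto
    next
      case F: False
      have "cos u = cos (2 * pi - u)" by (simp add: cos_diff)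
      also have "\<dots> \<le> cos \<delta>" using F u \<delta> by (intro cos_monotone_0_pi_le) auto
      finally show ?thesis .
    qed
    then show ?thesis using iff False cu by (simp add: \<delta>_def)
  qed
qed

text \<open>
  \<open>g\<close> belongs to the class of bounded functions for which all Fourier coefficients of \<open>h * g\<close> vanish. If
  \<open>h\<close> has vanishing coefficients itself, this class contains \<open>1\<close>; the next lemmas show that it is closed
  under multiplication by \<open>cos (x $ i - c)\<close>, by polynomials in it, by continuous functions of it
  (Stone-Weierstrass) and finally by the indicator functions of arcs (dominated convergence).
\<close>

definition annihilates :: "(real^'d::finite \<Rightarrow> real) \<Rightarrow> (real^'d \<Rightarrow> complex) \<Rightarrow> bool" where
  "annihilates h g \<longleftrightarrow> g \<in> borel_measurable borel \<and> (\<exists>B. \<forall>x. cmod (g x) \<le> B) \<and>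
     (\<forall>k. (LINT x|lebesgue. of_real (h x) * (g x * ew k x)) = 0)"

lemma borel_measurable_lebesgueI: "g \<in> borel_measurable borel \<Longrightarrow> g \<in> borel_measurable lebesgue"
  by (rule measurable_completion) simp

lemma integrable_times_bounded:
  fixes h :: "'a::euclidean_space \<Rightarrow> real" and g :: "'a \<Rightarrow> complex"
  assumes h: "integrable lebesgue h" and g: "g \<in> borel_measurable borel" "\<And>x. cmod (g x) \<le> B"
  shows "integrable lebesgue (\<lambda>x. of_real (h x) * g x)"
proof (rule Bochner_Integration.integrable_bound)
  show "integrable lebesgue (\<lambda>x. B * h x)" using h by simp
  show "(\<lambda>x. of_real (h x) * g x) \<in> borel_measurable lebesgue"
    using borel_measurable_integrable[OF h] borel_measurable_lebesgueI[OF g(1)] by measurable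
  show "AE x in lebesgue. norm (of_real (h x) * g x) \<le> norm (B * h x)"
  proof (rule AE_I2)
    fix x
    have "0 \<le> B" using g(2)[of x] norm_ge_zero[of "g x"] by linarith
    then show "norm (of_real (h x) * g x) \<le> norm (B * h x)"
      using mult_left_mono[OF g(2)[of x], of "\<bar>h x\<bar>"] by (simp add: norm_mult abs_mult mult.commute)
  qed
qed

lemma annihilates_integrable:
  assumes "integrable lebesgue h" "annihilates h g"
  shows "integrable lebesgue (\<lambda>x. of_real (h x) * (g x * ew k x))"
proof -
  obtain B where B: "\<And>x. cmod (g x) \<le> B" using assms(2) by (auto simp: annihilates_def)
  have [measurable]: "g \<in> borel_measurable borel" using assms(2) by (simp add: annihilates_def)
  show ?thesis
    by (rule integrable_times_bounded[OF assms(1), of _ B]) (auto simp: norm_mult B)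
qed

lemma annihilates_add:
  assumes "integrable lebesgue h" "annihilates h f" "annihilates h g"
  shows "annihilates h (\<lambda>x. f x + g x)"
  unfolding annihilates_def
proof (intro conjI allI)
  show "(\<lambda>x. f x + g x) \<in> borel_measurable borel" using assms by (auto simp: annihilates_def)
  obtain B C where "\<And>x. cmod (f x) \<le> B" "\<And>x. cmod (g x) \<le> C" using assms by (auto simp: annihilates_def)
  then have "\<And>x. cmod (f x + g x) \<le> B + C" by (meson add_mono norm_triangle_le)
  then show "\<exists>B. \<forall>x. cmod (f x + g x) \<le> B" by blast
  fix k
  show "(LINT x|lebesgue. of_real (h x) * ((f x + g x) * ew k x)) = 0"
    using Bochner_Integration.integral_add[OF annihilates_integrable[OF assms(1,2), of k] annihilates_integrable[OF assms(1,3), of k]] assms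
    by (simp add: annihilates_def algebra_simps)
qed

lemma annihilates_cmult:
  assumes "annihilates h g"
  shows "annihilates h (\<lambda>x. c * g x)"
  unfolding annihilates_def
proof (intro conjI allI)
  show "(\<lambda>x. c * g x) \<in> borel_measurable borel" using assms by (auto simp: annihilates_def)
  obtain B where "\<And>x. cmod (g x) \<le> B" using assms by (auto simp: annihilates_def)
  then have "\<And>x. cmod (c * g x) \<le> cmod c * B" by (simp add: norm_mult mult_left_mono)
  then show "\<exists>B. \<forall>x. cmod (c * g x) \<le> B" by blast
  fix k
  have "(LINT x|lebesgue. c * (of_real (h x) * (g x * ew k x))) = 0"
    using assms by (simp add: annihilates_def)
  then show "(LINT x|lebesgue. of_real (h x) * (c * g x * ew k x)) = 0" by (simp add: mult_ac)
qed

lemma annihilates_ew: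
  assumes "annihilates h g"
  shows "annihilates h (\<lambda>x. g x * ew l x)"
  using assms unfolding annihilates_def by (auto simp: norm_mult ew_add[symmetric] mult.assoc)

lemma annihilates_cos:
  assumes h: "integrable lebesgue h" and g: "annihilates h g"
  shows "annihilates h (\<lambda>x. g x * of_real (cos (x $ i - c)))"
proof -
  let ?e = "axis i 1 :: int^'a"
  have e: "freq_dot ?e x = x $ i" for x :: "real^'a"
  proof -
    have "fr ?e = axis i (1::real)" by (simp add: vec_eq_iff fr_nth axis_def)
    then show ?thesis by (simp add: freq_dot_fr inner_commute[of "axis i 1"] inner_axis)
  qed
  have "annihilates h (\<lambda>x. (cis (- c) / 2) * (g x * ew ?e x) + (cis c / 2) * (g x * ew (- ?e) x))"
    by (intro annihilates_add h annihilates_cmult annihilates_ew g)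
  moreover have "(cis (- c) / 2) * (g x * ew ?e x) + (cis c / 2) * (g x * ew (- ?e) x) = g x * of_real (cos (x $ i - c))" for x
  proof -
    have "of_real (cos y) = (cis y + cis (- y)) / 2" for y
      by (simp add: complex_eq_iff)
    moreover have "cis (- c) * ew ?e x = cis (x $ i - c)" "cis c * ew (- ?e) x = cis (- (x $ i - c))"
      by (simp_all add: ew_def freq_dot_uminus e cis_mult)
    ultimately show ?thesis by (simp add: field_simps)
  qed
  ultimately show ?thesis by simp
qed

lemma annihilates_limit:
  assumes h: "integrable lebesgue h" and g: "\<And>n. annihilates h (g n)"
    and lim: "\<And>x. (\<lambda>n. g n x) \<longlonglongrightarrow> G x" and B: "\<And>n x. cmod (g n x) \<le> B"
  shows "annihilates h G"
  unfolding annihilates_def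
proof (intro conjI allI)
  show Gm: "G \<in> borel_measurable borel"
    by (rule borel_measurable_LIMSEQ_metric[OF _ lim]) (use g in \<open>auto simp: annihilates_def\<close>)
  have "cmod (G x) \<le> B" for x
    by (rule LIMSEQ_le_const2[OF tendsto_norm[OF lim]]) (use B in auto)
  then show "\<exists>B. \<forall>x. cmod (G x) \<le> B" by blast
  fix k
  have gm: "g n \<in> borel_measurable borel" for n using g by (auto simp: annihilates_def)
  have "(\<lambda>n. LINT x|lebesgue. of_real (h x) * (g n x * ew k x)) \<longlonglongrightarrow> (LINT x|lebesgue. of_real (h x) * (G x * ew k x))"
  proof (rule integral_dominated_convergence[where w="\<lambda>x. B * \<bar>h x\<bar>"])
    note [measurable] = borel_measurable_integrable[OF h] borel_measurable_lebesgueI[OF Gm]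
       borel_measurable_lebesgueI[OF gm] borel_measurable_lebesgueI[OF ew_measurable]
    show "(\<lambda>x. of_real (h x) * (G x * ew k x)) \<in> borel_measurable lebesgue" by measurable
    show "(\<lambda>x. of_real (h x) * (g n x * ew k x)) \<in> borel_measurable lebesgue" for n by measurable
    show "integrable lebesgue (\<lambda>x. B * \<bar>h x\<bar>)" using h by simp
    show "AE x in lebesgue. (\<lambda>n. of_real (h x) * (g n x * ew k x)) \<longlonglongrightarrow> of_real (h x) * (G x * ew k x)"
      by (intro AE_I2 tendsto_intros lim)
    show "AE x in lebesgue. norm (of_real (h x) * (g n x * ew k x)) \<le> B * \<bar>h x\<bar>" for n
      using mult_right_mono[OF B[of n], of "\<bar>h _\<bar>"] by (intro AE_I2) (simp add: norm_mult mult.commute)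
  qed
  moreover have "(LINT x|lebesgue. of_real (h x) * (g n x * ew k x)) = 0" for n
    using g by (simp add: annihilates_def)
  ultimately show "(LINT x|lebesgue. of_real (h x) * (G x * ew k x)) = 0"
    by (simp add: LIMSEQ_const_iff)
qed

lemma annihilates_poly:
  fixes p :: "real \<Rightarrow> real"
  assumes p: "real_polynomial_function p" and h: "integrable lebesgue h"
  shows "annihilates h g \<Longrightarrow> annihilates h (\<lambda>x. g x * of_real (p (cos (x $ i - c))))"
  using p
proof (induction p arbitrary: g)
  case (linear f)
  have f: "f y = f 1 * y" for y using linear_cmul[OF bounded_linear.linear[OF linear(1)], of y 1] by simp
  have "annihilates h (\<lambda>x. of_real (f 1) * (g x * of_real (cos (x $ i - c))))"
    by (intro annihilates_cmult annihilates_cos h linear)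
  then show ?case by (subst f) (simp add: mult_ac)
next
  case (const d)
  then show ?case using annihilates_cmult[OF const(1), of "of_real d"] by (simp add: mult_ac)
next
  case (add p q)
  then show ?case using annihilates_add[OF h add(3)[OF add(5)] add(4)[OF add(5)]] by (simp add: algebra_simps)
next
  case (mult p q)
  then show ?case using mult(4)[OF mult(3)[OF mult(5)]] by (simp add: mult_ac)
qed

lemma annihilates_continuous:
  fixes \<phi> :: "real \<Rightarrow> real"
  assumes \<phi>: "continuous_on UNIV \<phi>" and h: "integrable lebesgue h" and g: "annihilates h g"
  shows "annihilates h (\<lambda>x. g x * of_real (\<phi> (cos (x $ i - c))))"
proof -
  have "\<exists>p. real_polynomial_function p \<and> (\<forall>y\<in>{-1..1}. \<bar>\<phi> y - p y\<bar> < 1 / real (Suc n))" for n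
    using Stone_Weierstrass_real_polynomial_function[of "{-1..1}" \<phi> "1 / real (Suc n)"]
      continuous_on_subset[OF \<phi>] by (metis compact_Icc of_nat_0_less_iff subset_UNIV zero_less_Suc zero_less_divide_1_iff)
  then obtain p where p: "\<And>n. real_polynomial_function (p n)"
     "\<And>n y. y \<in> {-1..1} \<Longrightarrow> \<bar>\<phi> y - p n y\<bar> < 1 / real (Suc n)" by metis
  have cs: "cos y \<in> {-1..1}" for y :: real by simp
  obtain M where M: "\<And>y. y \<in> {-1..1} \<Longrightarrow> \<bar>\<phi> y\<bar> \<le> M"
    using compact_imp_bounded[OF compact_continuous_image[OF continuous_on_subset[OF \<phi>, of "{-1..1}"]]]
    unfolding bounded_iff by fastforce
  obtain B where B: "\<And>x. cmod (g x) \<le> B" using g by (auto simp: annihilates_def)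
  show ?thesis
  proof (rule annihilates_limit[OF h])
    show "annihilates h (\<lambda>x. g x * of_real (p n (cos (x $ i - c))))" for n by (rule annihilates_poly[OF p(1) h g])
    fix x
    let ?y = "cos (x $ i - c)"
    have "(\<lambda>n. p n ?y) \<longlonglongrightarrow> \<phi> ?y"
    proof (rule LIMSEQ_I)
      fix e :: real assume "0 < e"
      then obtain N where N: "1 / real (Suc N) < e" using nat_approx_posE by blast
      have "norm (p n ?y - \<phi> ?y) < e" if "n \<ge> N" for n
      proof -
        have "1 / real (Suc n) \<le> 1 / real (Suc N)" using that by (simp add: frac_le)
        then show ?thesis using p(2)[OF cs, of "x $ i - c" n] N by (simp add: abs_minus_commute)
      qed
      then show "\<exists>N. \<forall>n\<ge>N. norm (p n ?y - \<phi> ?y) < e" by blast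
    qed
    then show "(\<lambda>n. g x * of_real (p n ?y)) \<longlonglongrightarrow> g x * of_real (\<phi> ?y)" by (intro tendsto_intros)
    fix n
    have "1 / real (Suc n) \<le> 1" by simp
    then have "\<bar>p n ?y\<bar> \<le> M + 1" using p(2)[OF cs, of "x $ i - c" n] M[OF cs, of "x $ i - c"] by linarith
    moreover have "0 \<le> B" using B[of x] norm_ge_zero[of "g x"] by linarith
    ultimately show "cmod (g x * of_real (p n ?y)) \<le> B * (M + 1)"
      by (simp add: norm_mult) (intro mult_mono B, auto)
  qed
qed

lemma annihilates_step:
  assumes h: "integrable lebesgue h" and g: "annihilates h g"
  shows "annihilates h (\<lambda>x. g x * of_real (indicator {r<..} (cos (x $ i - c))))"
proof -
  obtain B where B: "\<And>x. cmod (g x) \<le> B" using g by (auto simp: annihilates_def)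
  show ?thesis
  proof (rule annihilates_limit[OF h])
    let ?\<phi> = "\<lambda>n::nat. \<lambda>y. min 1 (max 0 (real n * (y - r)))"
    show "annihilates h (\<lambda>x. g x * of_real (?\<phi> n (cos (x $ i - c))))" for n
      by (rule annihilates_continuous[OF _ h g]) (intro continuous_intros)
    fix x
    let ?y = "cos (x $ i - c)"
    have "(\<lambda>n. ?\<phi> n ?y) \<longlonglongrightarrow> indicator {r<..} ?y"
    proof (cases "r < ?y")
      case True
      obtain N where N: "1 / (?y - r) < real N" using reals_Archimedean2 by blast
      have "?\<phi> n ?y = 1" if "n \<ge> N" for n
      proof -
        have "1 / (?y - r) \<le> real n" using N that by (smt (verit) of_nat_le_iff)
        then have "1 \<le> real n * (?y - r)" using True by (simp add: field_simps)
        then show ?thesis by simp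
      qed
      then have "\<forall>\<^sub>F n in sequentially. ?\<phi> n ?y = indicator {r<..} ?y"
        unfolding eventually_sequentially using True by auto
      then show ?thesis by (rule tendsto_eventually)
    next
      case False
      then have "?\<phi> n ?y = 0" for n by (simp add: max_absorb1 mult_nonneg_nonpos)
      then show ?thesis using False by simp
    qed
    then show "(\<lambda>n. g x * of_real (?\<phi> n ?y)) \<longlonglongrightarrow> g x * of_real (indicator {r<..} ?y)"
      by (intro tendsto_intros)
    show "cmod (g x * of_real (?\<phi> n ?y)) \<le> B" for n
    proof -
      have "cmod (g x * of_real (?\<phi> n ?y)) = cmod (g x) * ?\<phi> n ?y" by (simp add: norm_mult)
      also have "\<dots> \<le> cmod (g x) * 1" by (intro mult_left_mono) auto
      finally show ?thesis using B[of x] by simp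
    qed
  qed
qed

lemma annihilates_prod:
  assumes h: "integrable lebesgue h" and g: "annihilates h (\<lambda>x. 1)" and "finite I"
  shows "annihilates h (\<lambda>x. of_real (\<Prod>i\<in>I. indicator {r i<..} (cos (x $ i - c i))))"
  using \<open>finite I\<close>
proof (induction I)
  case empty then show ?case using g by simp
next
  case (insert i I)
  show ?case using annihilates_step[OF h insert.IH, of "r i" i "c i"] insert.hyps
    by (simp add: mult.commute)
qed

lemma periodic_shift_int:
  fixes f :: "real^'d::finite \<Rightarrow> 'b"
  assumes "periodic f"
  shows "f (x + (2 * pi * real_of_int n) *\<^sub>R axis i 1) = f x"
proof -
  have P: "f (x + (2 * pi) *\<^sub>R axis i 1) = f x" for x using assms by (simp add: periodic_def)
  have nat: "f (x + (2 * pi * real m) *\<^sub>R axis i 1) = f x" for m :: nat and x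
  proof (induction m)
    case (Suc m)
    have "x + (2 * pi * real (Suc m)) *\<^sub>R axis i 1 = (x + (2 * pi * real m) *\<^sub>R axis i 1) + (2 * pi) *\<^sub>R axis i 1"
      by (simp add: algebra_simps)
    then show ?case by (simp only: P Suc)
  qed simp
  show ?thesis
  proof (cases "0 \<le> n")
    case True then show ?thesis using nat[of x "nat n"] by simp
  next
    case False
    then show ?thesis using nat[of "x + (2 * pi * real_of_int n) *\<^sub>R axis i 1" "nat (- n)"]
      by (simp add: algebra_simps)
  qed
qed

lemma periodic_shift:
  fixes f :: "real^'d::finite \<Rightarrow> 'b"
  assumes "periodic f"
  shows "f (x + (2 * pi) *\<^sub>R fr k) = f x"
proof -
  have "f (x + (\<Sum>i\<in>I. (2 * pi * real_of_int (k $ i)) *\<^sub>R axis i 1)) = f x" for I :: "'d set"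
    by (induction I rule: infinite_finite_induct)
      (simp_all add: add.assoc[symmetric] add.commute[of "_ *\<^sub>R axis _ 1"] periodic_shift_int[OF assms])
  moreover have "(\<Sum>i\<in>UNIV. (2 * pi * real_of_int (k $ i)) *\<^sub>R axis i 1) = (2 * pi) *\<^sub>R fr k"
    by (simp add: vec_eq_iff fr_nth axis_def if_distrib cong: if_cong)
  ultimately show ?thesis by metis
qed

lemma cell_representative:
  fixes x :: "real^'d::finite"
  shows "\<exists>k. x - (2 * pi) *\<^sub>R fr k \<in> torus_cell"
proof
  let ?k = "\<chi> i. \<lfloor>x $ i / (2 * pi)\<rfloor>"
  have "0 \<le> x $ i - 2 * pi * of_int \<lfloor>x $ i / (2 * pi)\<rfloor>" "x $ i - 2 * pi * of_int \<lfloor>x $ i / (2 * pi)\<rfloor> \<le> 2 * pi" for i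
    using floor_divide_lower[of "2 * pi" "x $ i"] floor_divide_upper[of "2 * pi" "x $ i"]
    by (simp_all add: algebra_simps)
  then show "x - (2 * pi) *\<^sub>R fr ?k \<in> torus_cell" by (simp add: torus_cell_eq fr_nth)
qed

text \<open>
  Products of indicators of arcs are the indicators of boxes inside the cell, up to the faces of the cell.
  So \<open>f\<close> integrates to zero over all boxes and vanishes almost everywhere in the cell. By periodicity
  the set where it does not vanish is a countable union of translates of a null set.
\<close>

lemma fcoeff_zero_AE:
  fixes f :: "real^'d::finite \<Rightarrow> real"
  assumes f: "f \<in> torus_L1" and zero: "\<And>k. fcoeff f k = 0"
  shows "AE x in lebesgue. f x = 0"
proof -
  define h where "h x = indicator torus_cell x * f x" for x
  have h: "integrable lebesgue h"
    using f by (simp add: torus_L1_def set_integrable_def h_def[abs_def])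
  have h1: "annihilates h (\<lambda>x. 1)"
    unfolding annihilates_def
  proof (intro conjI allI)
    fix k
    have "(LINT x:torus_cell|lebesgue. complex_of_real (f x) * cis (- freq_dot (- k) x)) = 0"
      using zero[of "- k"] by (simp add: fcoeff_def)
    then show "(LINT x|lebesgue. of_real (h x) * (1 * ew k x)) = 0"
      by (simp add: set_lebesgue_integral_def h_def cis_minus_freq scaleR_conv_of_real mult.assoc)
  qed (auto intro: exI[of _ 1])
  have hz: "h x = 0" if "x \<notin> torus_cell" for x using that by (simp add: h_def)
  have hyp: "AE x::real^'d in lebesgue. \<forall>i. x $ i \<noteq> 0 \<and> x $ i \<noteq> 2 * pi"
  proof -
    have "negligible {x::real^'d. x $ i = c}" for i c
      using negligible_standard_hyperplane[of "axis i 1 :: real^'d" c] by (simp add: cart_eq_inner_axis)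
    then have "AE x::real^'d in lebesgue. x $ i \<noteq> c" for i c
      by (intro AE_I'[of "{x. x $ i = c}"]) (auto simp: negligible_iff_null_sets)
    then have "AE x::real^'d in lebesgue. \<forall>i\<in>UNIV. x $ i \<noteq> 0 \<and> x $ i \<noteq> 2 * pi"
      by (intro AE_finite_allI) (auto intro: AE_conjI)
    then show ?thesis by simp
  qed
  have box: "(LINT x|lebesgue. indicator (box a b) x * h x) = 0" for a b
  proof (cases "\<forall>i. max 0 (a $ i) < min (2 * pi) (b $ i)")
    case False
    then obtain i where "\<not> max 0 (a $ i) < min (2 * pi) (b $ i)" by blast
    then have i: "min (2 * pi) (b $ i) \<le> max 0 (a $ i)" by linarith
    have "indicator (box a b) x * h x = 0" for x
    proof (cases "x \<in> box a b \<inter> torus_cell")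
      case True
      then have "a $ i < x $ i" "x $ i < b $ i" "0 \<le> x $ i" "x $ i \<le> 2 * pi"
        by (auto simp: torus_cell_eq mem_box_cart)
      then have False using i pi_gt_zero by linarith
      then show ?thesis ..
    qed (use hz in auto)
    then show ?thesis by (intro integral_eq_zero_AE) auto
  next
    case True
    define a' b' where "a' i = max 0 (a $ i)" and "b' i = min (2 * pi) (b $ i)" for i
    let ?P = "\<lambda>x. \<Prod>i\<in>UNIV. indicator {cos ((b' i - a' i) / 2)<..} (cos (x $ i - (a' i + b' i) / 2)) :: real"
    have "annihilates h (\<lambda>x. of_real (?P x))" by (rule annihilates_prod[OF h h1]) simp
    then have "(LINT x|lebesgue. of_real (h x) * (of_real (?P x) * ew 0 x)) = 0" by (simp only: annihilates_def)
    then have "(LINT x|lebesgue. complex_of_real (h x * ?P x)) = 0"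
      by (simp only: ew_0 mult_1_right of_real_mult)
    then have "complex_of_real (LINT x|lebesgue. h x * ?P x) = 0" by (subst (asm) integral_complex_of_real)
    then have "(LINT x|lebesgue. h x * ?P x) = 0" by (simp only: of_real_eq_0_iff)
    moreover have "(LINT x|lebesgue. indicator (box a b) x * h x) = (LINT x|lebesgue. h x * ?P x)"
    proof (rule integral_cong_AE)
      have hm: "h \<in> borel_measurable lebesgue" using h by auto
      show "(\<lambda>x. indicator (box a b) x * h x) \<in> borel_measurable lebesgue"
        by (intro borel_measurable_times borel_measurable_indicator hm) auto
      have "(\<lambda>x. complex_of_real (?P x)) \<in> borel_measurable borel"
        using \<open>annihilates h (\<lambda>x. of_real (?P x))\<close> by (simp only: annihilates_def)
      then have "(\<lambda>x. Re (complex_of_real (?P x))) \<in> borel_measurable borel" by measurable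
      then have "?P \<in> borel_measurable borel" by simp
      then show "(\<lambda>x. h x * ?P x) \<in> borel_measurable lebesgue"
        by (intro borel_measurable_times hm borel_measurable_lebesgueI[OF \<open>?P \<in> borel_measurable borel\<close>])
      show "AE x in lebesgue. indicator (box a b) x * h x = h x * ?P x"
        using hyp
      proof eventually_elim
        case (elim x)
        show ?case
        proof (cases "x \<in> torus_cell")
          case True
          have "indicator {cos ((b' i - a' i) / 2)<..} (cos (x $ i - (a' i + b' i) / 2)) =
             (if a $ i < x $ i \<and> x $ i < b $ i then 1 else 0 :: real)" for i
          proof -
            have xi: "0 \<le> x $ i" "x $ i \<le> 2 * pi" "x $ i \<noteq> 0" "x $ i \<noteq> 2 * pi"
              using True elim by (auto simp: torus_cell_eq)
            have "cos ((b' i - a' i) / 2) < cos (x $ i - (a' i + b' i) / 2) \<longleftrightarrow> a' i < x $ i \<and> x $ i < b' i"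
              using \<open>\<forall>i. max 0 (a $ i) < min (2 * pi) (b $ i)\<close>[rule_format, of i] xi
              by (intro arc_iff_cos) (auto simp: a'_def b'_def)
            also have "\<dots> \<longleftrightarrow> a $ i < x $ i \<and> x $ i < b $ i" using xi by (auto simp: a'_def b'_def)
            finally show ?thesis by (simp add: indicator_def)
          qed
          then have "?P x = (\<Prod>i\<in>UNIV. if a $ i < x $ i \<and> x $ i < b $ i then 1 else 0)" by simp
          also have "\<dots> = indicator (box a b) x"
          proof (cases "x \<in> box a b")
            case True then show ?thesis by (auto simp: mem_box_cart)
          next
            case False
            then obtain i where "\<not> (a $ i < x $ i \<and> x $ i < b $ i)" by (auto simp: mem_box_cart)
            then have "(\<Prod>i\<in>UNIV. if a $ i < x $ i \<and> x $ i < b $ i then 1 else 0) = (0::real)"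
              by (intro prod_zero) auto
            then show ?thesis using False by simp
          qed
          finally show ?thesis by simp
        qed (simp add: hz)
      qed
    qed
    ultimately show ?thesis by simp
  qed
  obtain h' where h': "h' \<in> borel_measurable lborel" "AE x in lborel. h x = h' x"
    using completion_ex_borel_measurable_real[of h lborel] h by auto
  have AEl: "AE x in lebesgue. h x = h' x" using h'(2) by (rule AE_completion)
  have h'm: "h' \<in> borel_measurable lebesgue" using h'(1) by (rule measurable_completion)
  have ih: "integrable lebesgue h'"
    using integrable_cong_AE[OF _ h'm AEl] h by auto
  have int: "integrable lborel h'" using ih h'(1) by (simp add: integrable_completion)
  have tr: "(LINT x|lborel. indicator A x * h' x) = (LINT x|lebesgue. indicator A x * h x)" if "A \<in> sets borel" for A
  proof -
    have Al: "A \<in> sets lebesgue" using that by (intro sets_completionI_sets) simp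
    have "(LINT x|lborel. indicator A x * h' x) = (LINT x|lebesgue. indicator A x * h' x)"
      using h'(1) that by (subst integral_completion) auto
    also have "\<dots> = (LINT x|lebesgue. indicator A x * h x)"
    proof (rule integral_cong_AE)
      show "(\<lambda>x. indicator A x * h' x) \<in> borel_measurable lebesgue"
        by (intro borel_measurable_times borel_measurable_indicator h'm Al)
      show "(\<lambda>x. indicator A x * h x) \<in> borel_measurable lebesgue"
        using h by (intro borel_measurable_times borel_measurable_indicator Al) auto
      show "AE x in lebesgue. indicator A x * h' x = indicator A x * h x" using AEl by eventually_elim simp
    qed
    finally show ?thesis .
  qed
  have "AE x in lborel. h' x = 0"
  proof (rule AE_zero_of_box_integrals[OF int])
    show "(LINT x:box a b|lborel. h' x) = 0" for a b
      using tr[of "box a b"] box by (simp add: set_lebesgue_integral_def)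
    have "(LINT x|lborel. h' x) = (LINT x|lebesgue. h x)" using tr[of UNIV] by simp
    also have "\<dots> = 0"
    proof -
      have "(LINT x|lebesgue. of_real (h x) * (1 * ew 0 x)) = 0" using h1 by (simp only: annihilates_def)
      then have "complex_of_real (LINT x|lebesgue. h x) = 0" by simp
      then show ?thesis by (simp only: of_real_eq_0_iff)
    qed
    finally show "integral\<^sup>L lborel h' = 0" .
  qed
  then have "AE x in lebesgue. h' x = 0" by (rule AE_completion)
  with AEl have "AE x in lebesgue. h x = 0" by eventually_elim simp
  then have "negligible {x. h x \<noteq> 0}"
    by (auto simp: eventually_ae_filter_negligible intro: negligible_subset)
  then have "negligible (\<Union>k::int^'d. (+) ((2 * pi) *\<^sub>R fr k) ` {x. h x \<noteq> 0})"
    by (intro negligible_countable_Union) (auto intro: negligible_translation)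
  moreover have "{x. f x \<noteq> 0} \<subseteq> (\<Union>k::int^'d. (+) ((2 * pi) *\<^sub>R fr k) ` {x. h x \<noteq> 0})"
  proof
    fix x assume "x \<in> {x. f x \<noteq> 0}"
    obtain k where k: "x - (2 * pi) *\<^sub>R fr k \<in> torus_cell" using cell_representative by blast
    have "f (x - (2 * pi) *\<^sub>R fr k) = f x"
      using periodic_shift[of f "x - (2 * pi) *\<^sub>R fr k" k] f by (simp add: torus_L1_def)
    then have "h (x - (2 * pi) *\<^sub>R fr k) \<noteq> 0" using k \<open>x \<in> {x. f x \<noteq> 0}\<close> by (simp add: h_def)
    then show "x \<in> (\<Union>k::int^'d. (+) ((2 * pi) *\<^sub>R fr k) ` {x. h x \<noteq> 0})"
      by (intro UN_I[of k] image_eqI[of _ _ "x - (2 * pi) *\<^sub>R fr k"]) auto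
  qed
  ultimately have "negligible {x. f x \<noteq> 0}" by (rule negligible_subset)
  then show ?thesis by (intro AE_I'[of "{x. f x \<noteq> 0}"]) (auto simp: negligible_iff_null_sets)
qed

lemma continuous_AE_eq:
  fixes f g :: "'a::euclidean_space \<Rightarrow> real"
  assumes "continuous_on UNIV f" "continuous_on UNIV g" "AE x in lebesgue. f x = g x"
  shows "f x = g x"
proof (rule ccontr)
  assume ne: "f x \<noteq> g x"
  have op: "open {x. f x \<noteq> g x}" using assms(1,2) by (intro open_Collect_neq) auto
  have "negligible {x. f x \<noteq> g x}"
    using assms(3) by (auto simp: eventually_ae_filter_negligible intro: negligible_subset)
  then show False using open_not_negligible[OF op] ne by auto
qed

section \<open>Fourier series\<close>

text \<open>
  The real part is taken to obtain a real-valued function; for real sequences the sum is already real.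
\<close>

definition fser :: "(int^'d::finite \<Rightarrow> complex) \<Rightarrow> real^'d \<Rightarrow> real" where
  "fser c x = Re (infsum (\<lambda>k. c k * ew k x) UNIV)"

lemma abs_summable_ew:
  assumes "sums_le (\<lambda>k. cmod (c k)) H"
  shows "sums_le (\<lambda>k. cmod (c k * ew k x)) H" "(\<lambda>k. c k * ew k x) summable_on A"
proof -
  show *: "sums_le (\<lambda>k. cmod (c k * ew k x)) H" using assms by (simp add: norm_mult)
  show "(\<lambda>k. c k * ew k x) summable_on A" by (rule norm_infsum_sums_le(1)[OF *])
qed

lemma fser_partial_lim:
  assumes "sums_le (\<lambda>k. cmod (c k)) H"
  shows "(\<lambda>n. \<Sum>k\<in>fball n. c k * ew k x) \<longlonglongrightarrow> infsum (\<lambda>k. c k * ew k x) UNIV"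
  by (intro has_sum_fball has_sum_infsum abs_summable_ew[OF assms])

lemma fser_complex:
  assumes c: "sums_le (\<lambda>k. cmod (c k)) H" and r: "real_seq c"
  shows "infsum (\<lambda>k. c k * ew k x) UNIV = of_real (fser c x)"
proof -
  have "cnj (infsum (\<lambda>k. c k * ew k x) UNIV) = infsum (\<lambda>k. cnj (c k * ew k x)) UNIV"
    by (rule infsum_cnj[symmetric])
  also have "\<dots> = infsum (\<lambda>k. c (- k) * ew (- k) x) UNIV"
    using r by (simp add: real_seq_def ew_uminus)
  also have "\<dots> = infsum (\<lambda>k. c k * ew k x) UNIV"
    by (rule infsum_reindex_bij_betw[of uminus UNIV UNIV "\<lambda>k. c k * ew k x"]) (simp add: bij_uminus)
  finally have "cnj (infsum (\<lambda>k. c k * ew k x) UNIV) = infsum (\<lambda>k. c k * ew k x) UNIV" .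
  then have "Im (infsum (\<lambda>k. c k * ew k x) UNIV) = 0" by (simp add: complex_eq_iff)
  then show ?thesis by (simp add: fser_def complex_eq_iff)
qed

lemma fser_measurable:
  assumes "sums_le (\<lambda>k. cmod (c k)) H"
  shows "(\<lambda>x. infsum (\<lambda>k. c k * ew k x) UNIV) \<in> borel_measurable borel"
  by (rule borel_measurable_LIMSEQ_metric[OF _ fser_partial_lim[OF assms]]) measurable

lemma norm_fser_complex:
  assumes "sums_le (\<lambda>k. cmod (c k)) H"
  shows "cmod (infsum (\<lambda>k. c k * ew k x) UNIV) \<le> H"
  by (rule norm_infsum_sums_le(2)[OF abs_summable_ew(1)[OF assms]])

lemma periodic_fser: "periodic (fser c)"
  by (simp add: periodic_def fser_def periodic_ew[unfolded periodic_def])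

lemma emeasure_cell_lebesgue: "emeasure lebesgue (torus_cell :: (real^'d::finite) set) < \<infinity>"
  using emeasure_torus_cell[where 'd='d] by simp

lemma cell_bounded_integrable:
  fixes g :: "real^'d::finite \<Rightarrow> 'b::{banach, second_countable_topology}"
  assumes "g \<in> borel_measurable borel" "\<And>x. norm (g x) \<le> B"
  shows "set_integrable lebesgue torus_cell g"
proof -
  have "set_integrable lebesgue torus_cell (\<lambda>x::real^'d. B)"
    unfolding set_integrable_def using emeasure_cell_lebesgue
    by (intro integrable_scaleR_left) (simp add: integrable_indicator_iff)
  then show ?thesis unfolding set_integrable_def
  proof (rule Bochner_Integration.integrable_bound)
    show "(\<lambda>x. indicator torus_cell x *\<^sub>R g x) \<in> borel_measurable lebesgue"
      using borel_measurable_lebesgueI[OF assms(1)] by measurable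
    show "AE x in lebesgue. norm (indicator torus_cell x *\<^sub>R g x) \<le> norm (indicator torus_cell x *\<^sub>R B)"
    proof (rule AE_I2)
      fix x
      show "norm (indicator torus_cell x *\<^sub>R g x) \<le> norm (indicator torus_cell x *\<^sub>R B)"
        using assms(2)[of x] by (auto simp: indicator_def)
    qed
  qed
qed

lemma fser_L1:
  assumes "sums_le (\<lambda>k. cmod (c k)) H"
  shows "fser c \<in> torus_L1"
proof -
  have m: "fser c \<in> borel_measurable borel"
    using measurable_compose[OF fser_measurable[OF assms] borel_measurable_Re] by (simp add: fser_def[abs_def] o_def)
  have "norm (fser c x) \<le> H" for x
    using norm_fser_complex[OF assms, of x] abs_Re_le_cmod[of "infsum (\<lambda>k. c k * ew k x) UNIV"] by (simp add: fser_def)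
  then have "set_integrable lebesgue torus_cell (fser c)" by (rule cell_bounded_integrable[OF m])
  then show ?thesis using borel_measurable_lebesgueI[OF m] by (simp add: torus_L1_def periodic_fser)
qed

lemma set_integrable_times_bounded:
  fixes h :: "real^'d::finite \<Rightarrow> complex"
  assumes h: "set_integrable lebesgue torus_cell h" and g: "g \<in> borel_measurable borel" "\<And>x. cmod (g x) \<le> B"
  shows "set_integrable lebesgue torus_cell (\<lambda>x. h x * g x)"
  unfolding set_integrable_def
proof (rule Bochner_Integration.integrable_bound)
  have hi: "integrable lebesgue (\<lambda>x. indicator torus_cell x *\<^sub>R h x)" using h by (simp add: set_integrable_def)
  show "integrable lebesgue (\<lambda>x. B *\<^sub>R (indicator torus_cell x *\<^sub>R h x))"
    by (intro integrable_scaleR_right hi)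
  have "(\<lambda>x. (indicator torus_cell x *\<^sub>R h x) * g x) \<in> borel_measurable lebesgue"
    using borel_measurable_integrable[OF hi] borel_measurable_lebesgueI[OF g(1)] by measurable
  then show "(\<lambda>x. indicator torus_cell x *\<^sub>R (h x * g x)) \<in> borel_measurable lebesgue" by simp
  show "AE x in lebesgue. norm (indicator torus_cell x *\<^sub>R (h x * g x)) \<le> norm (B *\<^sub>R (indicator torus_cell x *\<^sub>R h x))"
  proof (rule AE_I2)
    fix x
    have "cmod (h x) * cmod (g x) \<le> cmod (h x) * \<bar>B\<bar>" using g(2)[of x] by (intro mult_left_mono) auto
    then show "norm (indicator torus_cell x *\<^sub>R (h x * g x)) \<le> norm (B *\<^sub>R (indicator torus_cell x *\<^sub>R h x))"
      by (simp add: norm_mult indicator_def mult.commute)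
  qed
qed

text \<open>
  Dominated convergence for the partial sums. With \<open>h = 1\<close> it yields the coefficients of a series, with
  \<open>h = f\<close> those of a product as a convolution.
\<close>

lemma cell_integral_series:
  fixes h :: "real^'d::finite \<Rightarrow> complex"
  assumes h: "set_integrable lebesgue torus_cell h" and c: "sums_le (\<lambda>k. cmod (c k)) H"
  shows "(\<lambda>n. \<Sum>p\<in>fball n. c p * (LINT x:torus_cell|lebesgue. h x * ew (p - l) x)) \<longlonglongrightarrow>
     (LINT x:torus_cell|lebesgue. h x * infsum (\<lambda>k. c k * ew k x) UNIV * ew (- l) x)"
proof -
  have hi: "integrable lebesgue (\<lambda>x. indicator torus_cell x *\<^sub>R h x)" using h by (simp add: set_integrable_def)
  have eq: "(\<Sum>p\<in>F. c p * (LINT x:torus_cell|lebesgue. h x * ew (p - l) x)) =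
     (LINT x|lebesgue. indicator torus_cell x *\<^sub>R h x * (\<Sum>p\<in>F. c p * ew p x) * ew (- l) x)" if "finite F" for F
  proof -
    have si: "integrable lebesgue (\<lambda>x. indicator torus_cell x *\<^sub>R (h x * ew (p - l) x))" for p
      using set_integrable_times_bounded[OF h ew_measurable, of "p - l" 1] by (simp add: set_integrable_def)
    have "(\<Sum>p\<in>F. c p * (LINT x:torus_cell|lebesgue. h x * ew (p - l) x)) =
      (\<Sum>p\<in>F. (LINT x|lebesgue. c p * (indicator torus_cell x *\<^sub>R (h x * ew (p - l) x))))"
      unfolding set_lebesgue_integral_def by (simp only: integral_mult_right_zero)
    also have "\<dots> = (LINT x|lebesgue. (\<Sum>p\<in>F. c p * (indicator torus_cell x *\<^sub>R (h x * ew (p - l) x))))"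
      by (rule Bochner_Integration.integral_sum[symmetric]) (intro integrable_mult_right si)
    also have "\<dots> = (LINT x|lebesgue. indicator torus_cell x *\<^sub>R h x * (\<Sum>p\<in>F. c p * ew p x) * ew (- l) x)"
    proof (rule Bochner_Integration.integral_cong[OF refl])
      fix x
      have "ew (p - l) x = ew p x * ew (- l) x" for p using ew_add[of p "- l" x] by simp
      then show "(\<Sum>p\<in>F. c p * (indicator torus_cell x *\<^sub>R (h x * ew (p - l) x))) =
        indicator torus_cell x *\<^sub>R h x * (\<Sum>p\<in>F. c p * ew p x) * ew (- l) x"
        by (simp add: sum_distrib_left sum_distrib_right scaleR_conv_of_real mult_ac)
    qed
    finally show ?thesis .
  qed
  have "(\<lambda>n. LINT x|lebesgue. indicator torus_cell x *\<^sub>R h x * (\<Sum>p\<in>fball n. c p * ew p x) * ew (- l) x) \<longlonglongrightarrow>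
     (LINT x|lebesgue. indicator torus_cell x *\<^sub>R h x * infsum (\<lambda>k. c k * ew k x) UNIV * ew (- l) x)"
  proof (rule integral_dominated_convergence[where w="\<lambda>x. H * norm (indicator torus_cell x *\<^sub>R h x)"])
    note [measurable] = borel_measurable_integrable[OF hi] borel_measurable_lebesgueI[OF fser_measurable[OF c]]
       borel_measurable_lebesgueI[OF ew_measurable]
    show "(\<lambda>x. indicator torus_cell x *\<^sub>R h x * infsum (\<lambda>k. c k * ew k x) UNIV * ew (- l) x) \<in> borel_measurable lebesgue"
      by measurable
    show "(\<lambda>x. indicator torus_cell x *\<^sub>R h x * (\<Sum>p\<in>fball n. c p * ew p x) * ew (- l) x) \<in> borel_measurable lebesgue" for n
      by measurable
    show "integrable lebesgue (\<lambda>x. H * norm (indicator torus_cell x *\<^sub>R h x))"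
      by (intro integrable_mult_right integrable_norm hi)
    show "AE x in lebesgue. (\<lambda>n. indicator torus_cell x *\<^sub>R h x * (\<Sum>p\<in>fball n. c p * ew p x) * ew (- l) x)
       \<longlonglongrightarrow> indicator torus_cell x *\<^sub>R h x * infsum (\<lambda>k. c k * ew k x) UNIV * ew (- l) x"
      by (intro AE_I2 tendsto_mult tendsto_const fser_partial_lim[OF c])
    show "AE x in lebesgue. norm (indicator torus_cell x *\<^sub>R h x * (\<Sum>p\<in>fball n. c p * ew p x) * ew (- l) x)
        \<le> H * norm (indicator torus_cell x *\<^sub>R h x)" for n
    proof (rule AE_I2)
      fix x
      have "cmod (\<Sum>p\<in>fball n. c p * ew p x) \<le> (\<Sum>p\<in>fball n. cmod (c p))"
        by (intro sum_norm_le) (simp add: norm_mult)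
      also have "\<dots> \<le> H" by (rule sums_leD[OF c]) simp
      finally have "norm (indicator torus_cell x *\<^sub>R h x) * cmod (\<Sum>p\<in>fball n. c p * ew p x) \<le> norm (indicator torus_cell x *\<^sub>R h x) * H"
        by (intro mult_left_mono) auto
      then show "norm (indicator torus_cell x *\<^sub>R h x * (\<Sum>p\<in>fball n. c p * ew p x) * ew (- l) x)
        \<le> H * norm (indicator torus_cell x *\<^sub>R h x)"
        by (simp only: norm_mult norm_ew mult_1_right mult.commute)
    qed
  qed
  then show ?thesis unfolding eq[OF finite_fball] by (simp add: set_lebesgue_integral_def mult.assoc)
qed

lemma fcoeff_ew: "fcoeff f k = (LINT x:torus_cell|lebesgue. of_real (f x) * ew (- k) x) / (2 * pi) ^ CARD('d)"
  for f :: "real^'d::finite \<Rightarrow> real"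
  by (simp add: fcoeff_def cis_minus_freq)

lemma fcoeff_fser:
  fixes c :: "int^'d::finite \<Rightarrow> complex"
  assumes c: "sums_le (\<lambda>k. cmod (c k)) H" and r: "real_seq c"
  shows "fcoeff (fser c) = c"
proof
  fix l
  have 1: "set_integrable lebesgue torus_cell (\<lambda>x::real^'d. 1::complex)"
    by (rule cell_bounded_integrable[where B=1]) auto
  have "(\<lambda>n. \<Sum>p\<in>fball n. c p * (LINT x:torus_cell|lebesgue. 1 * ew (p - l) x)) \<longlonglongrightarrow>
     (LINT x:torus_cell|lebesgue. 1 * infsum (\<lambda>k. c k * ew k x) UNIV * ew (- l) x)"
    by (rule cell_integral_series[OF 1 c])
  moreover have "(\<lambda>n. \<Sum>p\<in>fball n. c p * (LINT x:torus_cell|lebesgue. 1 * ew (p - l) x)) \<longlonglongrightarrow> (2 * pi) ^ CARD('d) * c l"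
  proof (rule tendsto_eventually)
    obtain N where N: "{l} \<subseteq> fball N" using finite_subset_fball[of "{l}"] by blast
    have "(\<Sum>p\<in>fball n. c p * (LINT x:torus_cell|lebesgue. 1 * ew (p - l) x)) = (2 * pi) ^ CARD('d) * c l" if "n \<ge> N" for n
    proof -
      have "l \<in> fball n" using N fball_mono[OF that] by auto
      moreover have "c p * (LINT x:torus_cell|lebesgue. 1 * ew (p - l) x) = (if p = l then (2 * pi) ^ CARD('d) * c l else 0)" for p
        by (simp add: cell_integral_ew)
      ultimately show ?thesis by (simp only: sum.delta finite_fball) simp
    qed
    then show "\<forall>\<^sub>F n in sequentially. (\<Sum>p\<in>fball n. c p * (LINT x:torus_cell|lebesgue. 1 * ew (p - l) x)) = (2 * pi) ^ CARD('d) * c l"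
      unfolding eventually_sequentially by blast
  qed
  ultimately have "(LINT x:torus_cell|lebesgue. 1 * infsum (\<lambda>k. c k * ew k x) UNIV * ew (- l) x) = (2 * pi) ^ CARD('d) * c l"
    by (rule LIMSEQ_unique)
  then show "fcoeff (fser c) l = c l"
    by (simp add: fcoeff_ew fser_complex[OF c r])
qed

lemma L1_ew_integrable:
  assumes "f \<in> torus_L1"
  shows "set_integrable lebesgue torus_cell (\<lambda>x. of_real (f x) * ew k x)"
proof (rule set_integrable_times_bounded[where B=1])
  show "set_integrable lebesgue torus_cell (\<lambda>x. complex_of_real (f x))"
    using assms integrable_of_real[of lebesgue "\<lambda>x. indicator torus_cell x *\<^sub>R f x", where 'a=complex]
    by (simp add: torus_L1_def set_integrable_def scaleR_conv_of_real)
qed auto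

lemma fcoeff_diff:
  assumes "f \<in> torus_L1" "g \<in> torus_L1"
  shows "fcoeff (\<lambda>x. f x - g x) k = fcoeff f k - fcoeff g k"
  using set_integral_diff(2)[OF L1_ew_integrable[OF assms(1), of "- k"] L1_ew_integrable[OF assms(2), of "- k"]]
  by (simp add: fcoeff_ew left_diff_distrib diff_divide_distrib)

lemma fcoeff_add:
  assumes "f \<in> torus_L1" "g \<in> torus_L1"
  shows "fcoeff (\<lambda>x. f x + g x) k = fcoeff f k + fcoeff g k"
  using set_integral_add(2)[OF L1_ew_integrable[OF assms(1), of "- k"] L1_ew_integrable[OF assms(2), of "- k"]]
  by (simp add: fcoeff_ew distrib_right add_divide_distrib)

lemma L1_diff: "f \<in> torus_L1 \<Longrightarrow> g \<in> torus_L1 \<Longrightarrow> (\<lambda>x. f x - g x) \<in> torus_L1"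
  by (auto simp: torus_L1_def periodic_def intro!: set_integral_diff)

lemma L1_add: "f \<in> torus_L1 \<Longrightarrow> g \<in> torus_L1 \<Longrightarrow> (\<lambda>x. f x + g x) \<in> torus_L1"
  by (auto simp: torus_L1_def periodic_def intro!: set_integral_add)

lemma fcoeff_real: "real_seq (fcoeff f)"
  unfolding real_seq_def
proof
  fix k
  have "cnj (LINT x:torus_cell|lebesgue. of_real (f x) * ew (- k) x) = (LINT x:torus_cell|lebesgue. of_real (f x) * ew k x)"
    unfolding set_lebesgue_integral_def
    by (subst integral_bounded_linear'[OF bounded_linear_cnj bounded_linear_cnj, symmetric])
      (auto simp: ew_uminus intro: exI[of _ 1])
  then show "fcoeff f (- k) = cnj (fcoeff f k)" by (simp add: fcoeff_ew)
qed

lemma fcoeff_AE_cong: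
  assumes "f \<in> borel_measurable lebesgue" "g \<in> borel_measurable lebesgue" "AE x in lebesgue. f x = g x"
  shows "fcoeff f k = fcoeff g k"
proof -
  note [measurable] = assms(1,2) borel_measurable_lebesgueI[OF ew_measurable]
  have "(LINT x:torus_cell|lebesgue. of_real (f x) * ew (- k) x) = (LINT x:torus_cell|lebesgue. of_real (g x) * ew (- k) x)"
    unfolding set_lebesgue_integral_def
  proof (rule integral_cong_AE)
    show "AE x in lebesgue. indicator torus_cell x *\<^sub>R (complex_of_real (f x) * ew (- k) x) = indicator torus_cell x *\<^sub>R (of_real (g x) * ew (- k) x)"
      using assms(3) by eventually_elim simp
  qed measurable
  then show ?thesis by (simp add: fcoeff_ew)
qed

lemma AE_eq_of_fcoeff:
  assumes "f \<in> torus_L1" "g \<in> torus_L1" "\<And>k. fcoeff f k = fcoeff g k"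
  shows "AE x in lebesgue. f x = g x"
  using fcoeff_zero_AE[OF L1_diff[OF assms(1,2)]] fcoeff_diff[OF assms(1,2)] assms(3) by simp

lemma continuous_eq_of_fcoeff:
  assumes "f \<in> torus_L1" "g \<in> torus_L1" "\<And>k. fcoeff f k = fcoeff g k"
    "continuous_on UNIV f" "continuous_on UNIV g"
  shows "f x = g x"
  by (rule continuous_AE_eq[OF assms(4,5) AE_eq_of_fcoeff[OF assms(1-3)]])

lemma periodic_continuous_bounded:
  fixes f :: "real^'d::finite \<Rightarrow> real"
  assumes "periodic f" "continuous_on UNIV f"
  shows "\<exists>B. \<forall>x. \<bar>f x\<bar> \<le> B"
proof -
  have "compact (f ` torus_cell)"
    using assms(2) by (intro compact_continuous_image) (auto simp: torus_cell_def intro: continuous_on_subset)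
  then obtain B where B: "\<And>y. y \<in> torus_cell \<Longrightarrow> \<bar>f y\<bar> \<le> B"
    using compact_imp_bounded[of "f ` torus_cell"] unfolding bounded_iff by fastforce
  have "\<bar>f x\<bar> \<le> B" for x
  proof -
    obtain k where k: "x - (2 * pi) *\<^sub>R fr k \<in> torus_cell" using cell_representative by blast
    then show ?thesis using B[OF k] periodic_shift[OF assms(1), of "x - (2 * pi) *\<^sub>R fr k" k] by simp
  qed
  then show ?thesis by blast
qed

lemma periodic_continuous_L1:
  assumes "periodic f" "continuous_on UNIV f"
  shows "f \<in> torus_L1"
proof -
  obtain B where "\<And>x. \<bar>f x\<bar> \<le> B" using periodic_continuous_bounded[OF assms] by blast
  moreover have m: "f \<in> borel_measurable borel" by (rule borel_measurable_continuous_onI[OF assms(2)])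
  ultimately show ?thesis using cell_bounded_integrable[OF m, of B] borel_measurable_lebesgueI[OF m] assms(1)
    by (simp add: torus_L1_def)
qed

lemma fcoeff_mult_fser:
  assumes f: "f \<in> torus_L1" and c: "sums_le (\<lambda>k. cmod (c k)) H" "real_seq c"
  shows "(\<lambda>n. \<Sum>p\<in>fball n. c p * fcoeff f (k - p)) \<longlonglongrightarrow> fcoeff (\<lambda>x. f x * fser c x) k"
proof -
  have h: "set_integrable lebesgue torus_cell (\<lambda>x. complex_of_real (f x))"
    using L1_ew_integrable[OF f, of 0] by simp
  have "(\<lambda>n. (\<Sum>p\<in>fball n. c p * (LINT x:torus_cell|lebesgue. of_real (f x) * ew (p - k) x)) / (2 * pi) ^ CARD('a)) \<longlonglongrightarrow>
     (LINT x:torus_cell|lebesgue. of_real (f x) * infsum (\<lambda>k. c k * ew k x) UNIV * ew (- k) x) / (2 * pi) ^ CARD('a)"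
    by (intro tendsto_divide tendsto_const cell_integral_series[OF h c(1)]) auto
  then show ?thesis
    by (simp add: fcoeff_ew fser_complex[OF c] sum_divide_distrib)
qed

lemma fser_tail:
  assumes c: "sums_le (\<lambda>k. cmod (c k)) H"
    and tail: "\<And>F. finite F \<Longrightarrow> F \<inter> fball n = {} \<Longrightarrow> (\<Sum>k\<in>F. cmod (c k)) \<le> r"
  shows "\<bar>Re (\<Sum>k\<in>fball n. c k * ew k x) - fser c x\<bar> \<le> r"
proof -
  have "cmod ((\<Sum>k\<in>fball n. c k * ew k x) - infsum (\<lambda>k. c k * ew k x) UNIV) \<le> r"
    by (rule partial_sum_diff_le[OF fser_partial_lim[OF c]]) (simp add: norm_mult tail)
  then show ?thesis
    using abs_Re_le_cmod[of "(\<Sum>k\<in>fball n. c k * ew k x) - infsum (\<lambda>k. c k * ew k x) UNIV"]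
    unfolding fser_def by simp
qed

lemma sums_le_of_tail:
  assumes tail: "\<And>F. finite F \<Longrightarrow> F \<inter> fball n = {} \<Longrightarrow> sum f F \<le> r" and f: "\<And>k. 0 \<le> f k"
  shows "sums_le f (sum f (fball n) + r)"
  unfolding sums_le_def
proof (intro allI impI)
  fix F :: "(int^'a) set" assume F: "finite F"
  have "sum f F \<le> sum f (fball n \<union> (F - fball n))" using F f by (intro sum_mono2) auto
  also have "\<dots> = sum f (fball n) + sum f (F - fball n)" using F by (subst sum.union_disjoint) auto
  also have "sum f (F - fball n) \<le> r" using F by (intro tail) auto
  finally show "sum f F \<le> sum f (fball n) + r" by simp
qed

lemma ew_derivative:
  "((\<lambda>x. ew k x) has_derivative (\<lambda>\<xi>. \<i> * of_real (fr k \<bullet> \<xi>) * ew k x)) (at x within A)"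
proof -
  have "((\<lambda>x. exp (\<i> * of_real (fr k \<bullet> x))) has_derivative (\<lambda>\<xi>. exp (\<i> * of_real (fr k \<bullet> x)) * (\<i> * of_real (fr k \<bullet> \<xi>)))) (at x within A)"
    by (intro has_derivative_compose[OF _ DERIV_exp[unfolded has_field_derivative_def]]
        has_derivative_mult_right has_derivative_of_real has_derivative_inner_right has_derivative_ident)
  then show ?thesis by (simp add: ew_def freq_dot_fr cis_conv_exp mult_ac)
qed

definition dcoef :: "'d \<Rightarrow> (int^'d \<Rightarrow> complex) \<Rightarrow> int^'d \<Rightarrow> complex" where
  "dcoef j c k = \<i> * of_int (k $ j) * c k"

lemma cmod_dcoef: "cmod (dcoef j c k) \<le> jb k * cmod (c k)"
proof -
  have "cmod (dcoef j c k) = \<bar>real_of_int (k $ j)\<bar> * cmod (c k)" by (simp add: dcoef_def norm_mult)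
  also have "\<dots> \<le> jb k * cmod (c k)"
    using comp_le_norm_fr[of k j] norm_fr_le_jb[of k] by (intro mult_right_mono) auto
  finally show ?thesis .
qed

lemma real_seq_dcoef: "real_seq c \<Longrightarrow> real_seq (dcoef j c)"
  by (simp add: real_seq_def dcoef_def)

text \<open>
  The partial sums converge together with all their first derivatives, uniformly in space and time,
  because the tails are bounded by \<open>r n\<close>. Uniform convergence of derivatives on the convex set
  \<open>{0..T} \<times> UNIV\<close> allows termwise differentiation, one-sidedly at the end points.
\<close>

lemma spacetime_C1:
  fixes c c' :: "real \<Rightarrow> int^'d::finite \<Rightarrow> complex"
  assumes T: "0 \<le> T"
    and der: "\<And>t k. t \<in> {0..T} \<Longrightarrow> ((\<lambda>t. c t k) has_vector_derivative c' t k) (at t within {0..T})"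
    and cont': "\<And>k. continuous_on {0..T} (\<lambda>t. c' t k)"
    and r: "r \<longlonglongrightarrow> 0"
    and tail: "\<And>n t F. t \<in> {0..T} \<Longrightarrow> finite F \<Longrightarrow> F \<inter> fball n = {} \<Longrightarrow> (\<Sum>k\<in>F. jb k * cmod (c t k)) \<le> r n"
    and tail': "\<And>n t F. t \<in> {0..T} \<Longrightarrow> finite F \<Longrightarrow> F \<inter> fball n = {} \<Longrightarrow> (\<Sum>k\<in>F. cmod (c' t k)) \<le> r n"
  shows "continuous_on ({0..T} \<times> UNIV) (\<lambda>(t, x). fser (c' t) x)"
    and "continuous_on ({0..T} \<times> UNIV) (\<lambda>(t, x). fser (dcoef j (c t)) x)"
    and "\<And>t x. t \<in> {0..T} \<Longrightarrow> ((\<lambda>(t, x). fser (c t) x) has_derivative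
        (\<lambda>(\<tau>, \<xi>). \<tau> * fser (c' t) x + (\<Sum>j\<in>UNIV. \<xi> $ j * fser (dcoef j (c t)) x))) (at (t, x) within {0..T} \<times> UNIV)"
proof -
  let ?S = "{0..T} \<times> (UNIV :: (real^'d) set)"
  have contc: "continuous_on {0..T} (\<lambda>t. c t k)" for k
    unfolding continuous_on_eq_continuous_within
    using der has_vector_derivative_continuous by blast
  have tail0: "(\<Sum>k\<in>F. cmod (c t k)) \<le> r n" if "t \<in> {0..T}" "finite F" "F \<inter> fball n = {}" for n t F
  proof -
    have "(\<Sum>k\<in>F. cmod (c t k)) \<le> (\<Sum>k\<in>F. jb k * cmod (c t k))"
      by (intro sum_mono cmod_le_jb_cmod)
    also have "\<dots> \<le> r n" by (rule tail[OF that])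
    finally show ?thesis .
  qed
  have taild: "(\<Sum>k\<in>F. cmod (dcoef j (c t) k)) \<le> r n" if "t \<in> {0..T}" "finite F" "F \<inter> fball n = {}" for n t F j
    using tail[OF that] sum_mono[of F "\<lambda>k. cmod (dcoef j (c t) k)" "\<lambda>k. jb k * cmod (c t k)"] cmod_dcoef
    by (meson order_trans)
  have near: "\<bar>Re (\<Sum>k\<in>fball n. b k * ew k x) - fser b x\<bar> \<le> r n"
    if "\<And>F n. finite F \<Longrightarrow> F \<inter> fball n = {} \<Longrightarrow> (\<Sum>k\<in>F. cmod (b k)) \<le> r n" for b n x
    by (rule fser_tail[OF sums_le_of_tail[OF that]]) (use that in auto)
  have unif: "continuous_on ?S (\<lambda>(t, x). fser (b t) x)"
    if b: "\<And>k. continuous_on {0..T} (\<lambda>t. b t k)"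
      and bt: "\<And>n t F. t \<in> {0..T} \<Longrightarrow> finite F \<Longrightarrow> F \<inter> fball n = {} \<Longrightarrow> (\<Sum>k\<in>F. cmod (b t k)) \<le> r n" for b
  proof (rule uniform_limit_theorem)
    show "\<forall>\<^sub>F n in sequentially. continuous_on ?S (\<lambda>p. Re (\<Sum>k\<in>fball n. b (fst p) k * ew k (snd p)))"
      by (intro always_eventually allI continuous_intros continuous_on_compose2[OF b] continuous_on_compose2[OF continuous_ew[of UNIV]]) auto
    show "uniform_limit ?S (\<lambda>n p. Re (\<Sum>k\<in>fball n. b (fst p) k * ew k (snd p))) (\<lambda>(t, x). fser (b t) x) sequentially"
    proof (rule uniform_limitI)
      fix e :: real assume "0 < e"
      then have "\<forall>\<^sub>F n in sequentially. r n < e" using order_tendstoD(2)[OF r] by blast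
      then show "\<forall>\<^sub>F n in sequentially. \<forall>p\<in>?S. dist (Re (\<Sum>k\<in>fball n. b (fst p) k * ew k (snd p))) (case p of (t, x) \<Rightarrow> fser (b t) x) < e"
      proof eventually_elim
        case (elim n)
        show ?case
        proof
          fix p assume "p \<in> ?S"
          then obtain t x where p: "p = (t, x)" "t \<in> {0..T}" by auto
          show "dist (Re (\<Sum>k\<in>fball n. b (fst p) k * ew k (snd p))) (case p of (t, x) \<Rightarrow> fser (b t) x) < e"
          proof -
            have "\<bar>Re (\<Sum>k\<in>fball n. b t k * ew k x) - fser (b t) x\<bar> \<le> r n"
              by (rule near) (rule bt[OF p(2)])
            then show ?thesis using elim by (simp add: p dist_real_def)
          qed
        qed
      qed
    qed
  qed simp
  show "continuous_on ?S (\<lambda>(t, x). fser (c' t) x)" by (rule unif[OF cont' tail'])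
  show "continuous_on ?S (\<lambda>(t, x). fser (dcoef j (c t)) x)"
    by (rule unif[OF _ taild]) (auto simp: dcoef_def intro!: continuous_intros contc)
  define f where "f n p = Re (\<Sum>k\<in>fball n. c (fst p) k * ew k (snd p))" for n and p :: "real \<times> (real^'d)"
  define f' where "f' n p h = fst h * Re (\<Sum>k\<in>fball n. c' (fst p) k * ew k (snd p)) +
     (\<Sum>j\<in>UNIV. snd h $ j * Re (\<Sum>k\<in>fball n. dcoef j (c (fst p)) k * ew k (snd p)))" for n and p h :: "real \<times> (real^'d)"
  define g' where "g' p h = fst h * fser (c' (fst p)) (snd p) + (\<Sum>j\<in>UNIV. snd h $ j * fser (dcoef j (c (fst p))) (snd p))"
    for p h :: "real \<times> (real^'d)"
  have df: "(f n has_derivative f' n p) (at p within ?S)" if p: "p \<in> ?S" for n p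
  proof -
    have t: "fst p \<in> {0..T}" using p by auto
    have summand: "((\<lambda>p. c (fst p) k * ew k (snd p)) has_derivative
        (\<lambda>h. c (fst p) k * (\<i> * of_real (fr k \<bullet> snd h) * ew k (snd p)) + fst h *\<^sub>R c' (fst p) k * ew k (snd p))) (at p within ?S)" for k
    proof (rule has_derivative_mult)
      have "((\<lambda>t. c t k) has_derivative (\<lambda>h. h *\<^sub>R c' (fst p) k)) (at (fst p) within fst ` ?S)"
        using der[OF t, of k] by (simp add: has_vector_derivative_def)
      from has_derivative_in_compose[OF has_derivative_fst[OF has_derivative_ident] this]
      show "((\<lambda>p. c (fst p) k) has_derivative (\<lambda>h. fst h *\<^sub>R c' (fst p) k)) (at p within ?S)" by simp
      show "((\<lambda>p. ew k (snd p)) has_derivative (\<lambda>h. \<i> * of_real (fr k \<bullet> snd h) * ew k (snd p))) (at p within ?S)"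
        by (rule has_derivative_in_compose[OF has_derivative_snd[OF has_derivative_ident] ew_derivative])
    qed
    have "(f n has_derivative (\<lambda>h. Re (\<Sum>k\<in>fball n. c (fst p) k * (\<i> * of_real (fr k \<bullet> snd h) * ew k (snd p)) + fst h *\<^sub>R c' (fst p) k * ew k (snd p)))) (at p within ?S)"
      unfolding f_def[abs_def] by (intro bounded_linear.has_derivative[OF bounded_linear_Re] has_derivative_sum summand)
    moreover have "(\<lambda>h. Re (\<Sum>k\<in>fball n. c (fst p) k * (\<i> * of_real (fr k \<bullet> snd h) * ew k (snd p)) + fst h *\<^sub>R c' (fst p) k * ew k (snd p))) = f' n p"
    proof
      fix h :: "real \<times> (real^'d)"
      have fk: "of_real (fr k \<bullet> snd h) = (\<Sum>j\<in>UNIV. of_real (snd h $ j) * of_int (k $ j) :: complex)" for k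
        by (simp add: inner_vec_def fr_nth mult.commute)
      have 1: "(\<Sum>k\<in>fball n. c (fst p) k * (\<i> * of_real (fr k \<bullet> snd h) * ew k (snd p)))
         = (\<Sum>j\<in>UNIV. of_real (snd h $ j) * (\<Sum>k\<in>fball n. dcoef j (c (fst p)) k * ew k (snd p)))"
        unfolding fk sum_distrib_left sum_distrib_right
        by (subst sum.swap) (simp add: dcoef_def mult_ac)
      have 2: "(\<Sum>k\<in>fball n. fst h *\<^sub>R c' (fst p) k * ew k (snd p)) = of_real (fst h) * (\<Sum>k\<in>fball n. c' (fst p) k * ew k (snd p))"
        by (simp add: sum_distrib_left scaleR_conv_of_real mult_ac)
      have Rr: "Re (of_real a * b) = a * Re b" for a b by simp
      show "Re (\<Sum>k\<in>fball n. c (fst p) k * (\<i> * of_real (fr k \<bullet> snd h) * ew k (snd p)) + fst h *\<^sub>R c' (fst p) k * ew k (snd p)) = f' n p h"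
        unfolding sum.distrib 1 2 f'_def plus_complex.sel(1) Re_sum[of _ UNIV] Rr by simp
    qed
    ultimately show ?thesis by simp
  qed
  have close: "norm (f' n p h - g' p h) \<le> (1 + real CARD('d)) * \<bar>r n\<bar> * norm h" if p: "p \<in> ?S" for n p h
  proof -
    have t: "fst p \<in> {0..T}" using p by auto
    have A: "\<bar>Re (\<Sum>k\<in>fball n. c' (fst p) k * ew k (snd p)) - fser (c' (fst p)) (snd p)\<bar> \<le> \<bar>r n\<bar>"
      by (rule order_trans[OF near[OF tail'[OF t]] abs_ge_self]) auto
    have B: "\<bar>Re (\<Sum>k\<in>fball n. dcoef j (c (fst p)) k * ew k (snd p)) - fser (dcoef j (c (fst p))) (snd p)\<bar> \<le> \<bar>r n\<bar>" for j
      by (rule order_trans[OF near[OF taild[OF t]] abs_ge_self]) auto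
    have "f' n p h - g' p h = fst h * (Re (\<Sum>k\<in>fball n. c' (fst p) k * ew k (snd p)) - fser (c' (fst p)) (snd p))
      + (\<Sum>j\<in>UNIV. snd h $ j * (Re (\<Sum>k\<in>fball n. dcoef j (c (fst p)) k * ew k (snd p)) - fser (dcoef j (c (fst p))) (snd p)))"
      by (simp add: f'_def g'_def right_diff_distrib sum_subtractf)
    also have "norm \<dots> \<le> norm h * \<bar>r n\<bar> + (\<Sum>j\<in>(UNIV::'d set). norm h * \<bar>r n\<bar>)"
    proof (rule order_trans[OF norm_triangle_ineq add_mono])
      have "\<bar>fst h\<bar> \<le> norm h" using norm_fst_le[of "fst h" "snd h"] by simp
      then show "norm (fst h * (Re (\<Sum>k\<in>fball n. c' (fst p) k * ew k (snd p)) - fser (c' (fst p)) (snd p))) \<le> norm h * \<bar>r n\<bar>"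
        unfolding real_norm_def abs_mult by (intro mult_mono A) auto
      show "norm (\<Sum>j\<in>UNIV. snd h $ j * (Re (\<Sum>k\<in>fball n. dcoef j (c (fst p)) k * ew k (snd p)) - fser (dcoef j (c (fst p))) (snd p)))
         \<le> (\<Sum>j\<in>(UNIV::'d set). norm h * \<bar>r n\<bar>)"
      proof (rule sum_norm_le)
        fix j
        have "\<bar>snd h $ j\<bar> \<le> norm h" using norm_snd_le[of "snd h" "fst h"] component_le_norm_cart[of "snd h" j] by simp
        then show "norm (snd h $ j * (Re (\<Sum>k\<in>fball n. dcoef j (c (fst p)) k * ew k (snd p)) - fser (dcoef j (c (fst p))) (snd p))) \<le> norm h * \<bar>r n\<bar>"
          unfolding real_norm_def abs_mult by (intro mult_mono B) auto
      qed
    qed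
    also have "\<dots> = (1 + real CARD('d)) * \<bar>r n\<bar> * norm h" by (simp add: algebra_simps)
    finally show ?thesis .
  qed
  have lim: "(\<lambda>n. f n p) \<longlonglongrightarrow> fser (c (fst p)) (snd p)" if p: "p \<in> ?S" for p
  proof (rule LIM_zero_cancel, rule Lim_null_comparison[OF _ r])
    have t: "fst p \<in> {0..T}" using p by auto
    show "\<forall>\<^sub>F n in sequentially. norm (f n p - fser (c (fst p)) (snd p)) \<le> r n"
      unfolding f_def real_norm_def by (intro always_eventually allI near tail0[OF t])
  qed
  have "\<exists>g. \<forall>p\<in>?S. (\<lambda>n. f n p) \<longlonglongrightarrow> g p \<and> (g has_derivative g' p) (at p within ?S)"
  proof (rule has_derivative_sequence)
    show "convex ?S" by (intro convex_Times) auto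
    show "(f n has_derivative f' n p) (at p within ?S)" if "p \<in> ?S" for n p by (rule df[OF that])
    show "\<forall>\<^sub>F n in sequentially. \<forall>p\<in>?S. \<forall>h. norm (f' n p h - g' p h) \<le> e * norm h" if "0 < e" for e
    proof -
      have "(\<lambda>n. (1 + real CARD('d)) * \<bar>r n\<bar>) \<longlonglongrightarrow> (1 + real CARD('d)) * \<bar>0\<bar>"
        by (intro tendsto_intros r)
      then have "\<forall>\<^sub>F n in sequentially. (1 + real CARD('d)) * \<bar>r n\<bar> < e"
        using \<open>0 < e\<close> by (intro order_tendstoD(2)) auto
      then show ?thesis
      proof eventually_elim
        case (elim n)
        show ?case
        proof (intro ballI allI)
          fix p h assume "p \<in> ?S"
          from close[OF this, of n h] elim
          show "norm (f' n p h - g' p h) \<le> e * norm h"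
            by (meson less_imp_le mult_right_mono norm_ge_zero order_trans)
        qed
      qed
    qed
    show "(0, 0) \<in> ?S" using T by simp
    show "(\<lambda>n. f n (0, 0)) \<longlonglongrightarrow> fser (c 0) 0" using lim[of "(0, 0)"] T by simp
  qed
  then obtain g where g: "\<And>p. p \<in> ?S \<Longrightarrow> (\<lambda>n. f n p) \<longlonglongrightarrow> g p"
    "\<And>p. p \<in> ?S \<Longrightarrow> (g has_derivative g' p) (at p within ?S)" by blast
  fix t x assume t: "t \<in> {0..T}"
  have p: "(t, x) \<in> ?S" using t by simp
  have "((\<lambda>(t, x). fser (c t) x) has_derivative g' (t, x)) (at (t, x) within ?S)"
  proof (rule has_derivative_transform[OF p _ g(2)[OF p]])
    fix q assume q: "q \<in> ?S"
    show "(case q of (t, x) \<Rightarrow> fser (c t) x) = g q"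
      using LIMSEQ_unique[OF lim[OF q] g(1)[OF q]] by (simp add: split_beta)
  qed
  then show "((\<lambda>(t, x). fser (c t) x) has_derivative
        (\<lambda>(\<tau>, \<xi>). \<tau> * fser (c' t) x + (\<Sum>j\<in>UNIV. \<xi> $ j * fser (dcoef j (c t)) x))) (at (t, x) within ?S)"
    by (simp add: g'_def[abs_def] case_prod_unfold)
qed

section \<open>The symbols of the operators\<close>

definition trig :: "real^'d::finite \<Rightarrow> real \<Rightarrow> real \<Rightarrow> real^'d \<Rightarrow> real" where
  "trig v A B x = A * cos (v \<bullet> x) + B * sin (v \<bullet> x)"

lemma trig_derivative:
  "(trig v A B has_derivative (\<lambda>\<xi>. (v \<bullet> \<xi>) * (B * cos (v \<bullet> x) - A * sin (v \<bullet> x)))) (at x)"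
  unfolding trig_def[abs_def]
  by (rule derivative_eq_intros refl | simp add: algebra_simps)+

lemma pd_eqI: "(f has_derivative f') (at x) \<Longrightarrow> pd i f x = f' (axis i 1)"
  by (simp add: pd_def frechet_derivative_at[symmetric])

lemma pd_trig: "pd i (trig v A B) = trig v (v $ i * B) (- (v $ i * A))"
proof
  fix x show "pd i (trig v A B) x = trig v (v $ i * B) (- (v $ i * A)) x"
    unfolding pd_eqI[OF trig_derivative] by (simp add: trig_def inner_axis algebra_simps)
qed

lemma continuous_trig: "continuous_on S (trig v A B)"
  unfolding trig_def[abs_def] by (intro continuous_intros)

lemma Ck_trig: "Ck n (trig v A B)"
proof (induction n arbitrary: A B)
  case (Suc n)
  then show ?case using trig_derivative[of v A B] by (auto simp: pd_trig differentiable_def)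
qed (simp add: continuous_trig)

lemma smooth_trig: "smooth_fun (trig v A B)"
  by (simp add: smooth_fun_def Ck_trig)

text \<open>
  The coefficients of \<open>cos (k \<bullet> x)\<close>. The sum of two terms gives the right value \<open>1\<close> also in the case
  \<open>k = 0\<close>, where both frequencies coincide.
\<close>

definition ctest :: "int^'d::finite \<Rightarrow> int^'d \<Rightarrow> complex" where
  "ctest k l = (if l = k then 1/2 else 0) + (if l = - k then 1/2 else 0)"

lemma ctest_sums_le: "sums_le (\<lambda>l. cmod (ctest k l)) 1"
  unfolding sums_le_def
proof (intro allI impI)
  fix F :: "(int^'a) set" assume F: "finite F"
  have "(\<Sum>l\<in>F. cmod (ctest k l)) \<le> (\<Sum>l\<in>F. (if l = k then 1/2 else 0) + (if l = - k then 1/2 else 0))"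
    by (intro sum_mono) (auto simp: ctest_def)
  also have "\<dots> \<le> 1" using F by (simp add: sum.distrib sum.delta)
  finally show "(\<Sum>l\<in>F. cmod (ctest k l)) \<le> 1" .
qed

lemma real_seq_ctest: "real_seq (ctest k)"
  by (auto simp: real_seq_def ctest_def minus_equation_iff)

lemma ctest_self: "ctest k k \<noteq> 0" "ctest k (- k) = ctest k k" "cnj (ctest k k) = ctest k k"
  by (auto simp: ctest_def)

lemma cmod_ctest_self: "1/2 \<le> cmod (ctest k k)"
  by (auto simp: ctest_def)

lemma fser_ctest:
  assumes b: "b (- k) = cnj (b k)"
  shows "fser (\<lambda>l. b l * ctest k l) = trig (fr k) (Re (b k)) (- Im (b k))"
proof
  fix x
  let ?f = "\<lambda>l. b l * ctest k l * ew l x"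
  have "(?f has_sum ((b k * ew k x + b (- k) * ew (- k) x) / 2)) UNIV"
  proof (rule has_sum_finite_neutralI)
    show "?f l = 0" if "l \<in> UNIV - {k, - k}" for l using that by (auto simp: ctest_def)
    show "(b k * ew k x + b (- k) * ew (- k) x) / 2 = sum ?f {k, - k}"
    proof (cases "k = - k")
      case True show ?thesis unfolding ctest_def True[symmetric] by simp
    next
      case False
      then have "- k \<noteq> k" by metis
      then show ?thesis using False by (simp add: ctest_def add_divide_distrib)
    qed
  qed auto
  then have "infsum ?f UNIV = (b k * ew k x + b (- k) * ew (- k) x) / 2" by (rule infsumI)
  then have "fser (\<lambda>l. b l * ctest k l) x = Re ((b k * ew k x + b (- k) * ew (- k) x) / 2)"
    by (simp only: fser_def)
  then show "fser (\<lambda>l. b l * ctest k l) x = trig (fr k) (Re (b k)) (- Im (b k)) x"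
    by (simp add: b trig_def ew_def freq_dot_fr fr_uminus cis.sel)
qed

lemma fser_ctest1: "fser (ctest k) = trig (fr k) 1 0"
  using fser_ctest[of "\<lambda>_. 1" k] by simp

lemma periodic_trig: "periodic (trig (fr k) 1 0)"
  using periodic_fser[of "ctest k"] by (simp add: fser_ctest1)

lemma fcoeff_trig: "fcoeff (trig (fr k) 1 0) = ctest k"
  using fcoeff_fser[OF ctest_sums_le real_seq_ctest, of k] by (simp add: fser_ctest1)

lemma trig_Linf: "trig (fr k) 1 0 \<in> torus_Linf" "Linf_norm (trig (fr k) 1 0) \<le> 1"
proof -
  have b: "\<bar>trig (fr k) 1 0 x\<bar> \<le> 1" for x by (simp add: trig_def)
  have m: "trig (fr k) 1 0 \<in> borel_measurable lebesgue"
    by (intro borel_measurable_lebesgueI borel_measurable_continuous_onI continuous_trig)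
  show "trig (fr k) 1 0 \<in> torus_Linf"
    using m b periodic_trig by (auto simp: torus_Linf_def intro!: exI[of _ 1])
  show "Linf_norm (trig (fr k) 1 0) \<le> 1"
    unfolding Linf_norm_def
    by (rule cInf_lower) (use b in \<open>auto intro!: bdd_belowI[where m=0]\<close>)
qed

lemma measure_torus_cell: "measure lebesgue (torus_cell :: (real^'d::finite) set) = (2 * pi) ^ CARD('d)"
  by (simp add: torus_cell_def content_cbox_cart interval_ne_empty_cart prod_constant)

lemma torus_cell_cube: "torus_cell \<in> torus_cubes"
  unfolding torus_cubes_def torus_cell_def
  by (intro CollectI exI[of _ 0] exI[of _ "2 * pi"]) auto

text \<open>
  Subtracting the average of \<open>g\<close> does not change the coefficients at nonzero frequencies.
\<close>

lemma fcoeff_le_mean_osc: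
  assumes g: "g \<in> torus_L1" and k: "k \<noteq> 0"
  shows "cmod (fcoeff g k) \<le> mean_osc g torus_cell"
proof -
  define a where "a = avg torus_cell g"
  let ?V = "(2 * pi) ^ CARD('a)"
  have V: "0 < ?V" by simp
  have cst: "set_integrable lebesgue torus_cell (\<lambda>x::real^'a. complex_of_real a * ew (- k) x)"
    using cell_bounded_integrable[of "\<lambda>x::real^'a. complex_of_real a * ew (- k) x" "\<bar>a\<bar>"] by (simp add: norm_mult)
  have "(LINT x:torus_cell|lebesgue. complex_of_real a * ew (- k) x) = 0"
    using cell_integral_ew[of "- k"] k by simp
  then have eq: "(LINT x:torus_cell|lebesgue. of_real (g x) * ew (- k) x) =
     (LINT x:torus_cell|lebesgue. of_real (g x) * ew (- k) x - of_real a * ew (- k) x)"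
    using set_integral_diff(2)[OF L1_ew_integrable[OF g] cst] by simp
  have "cmod (LINT x:torus_cell|lebesgue. of_real (g x) * ew (- k) x - of_real a * ew (- k) x)
    \<le> (LINT x|lebesgue. cmod (indicator torus_cell x *\<^sub>R (of_real (g x) * ew (- k) x - of_real a * ew (- k) x)))"
    unfolding set_lebesgue_integral_def by (rule integral_norm_bound)
  also have "\<dots> = (LINT x:torus_cell|lebesgue. \<bar>g x - a\<bar>)"
    unfolding set_lebesgue_integral_def
  proof (rule Bochner_Integration.integral_cong[OF refl])
    fix x
    have "of_real (g x) * ew (- k) x - of_real a * ew (- k) x = of_real (g x - a) * ew (- k) x"
      by (simp add: algebra_simps)
    then show "cmod (indicator torus_cell x *\<^sub>R (of_real (g x) * ew (- k) x - of_real a * ew (- k) x)) =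
      indicator torus_cell x *\<^sub>R \<bar>g x - a\<bar>" by (simp only: norm_scaleR norm_mult norm_of_real norm_ew) simp
  qed
  also have "\<dots> = mean_osc g torus_cell * ?V"
    by (simp add: mean_osc_def avg_def[of _ "\<lambda>x. \<bar>_ x\<bar>"] a_def measure_torus_cell)
  finally have "cmod (LINT x:torus_cell|lebesgue. of_real (g x) * ew (- k) x) \<le> mean_osc g torus_cell * ?V"
    unfolding eq .
  then show ?thesis using V by (simp add: fcoeff_ew norm_divide norm_power norm_mult divide_le_eq del: power_mult_distrib)
qed

lemma mult_trig:
  assumes "mult b (trig (fr k) 1 0) g"
  shows "g \<in> torus_L1" "fcoeff g = (\<lambda>l. b l * ctest k l)" "b (- k) = cnj (b k)"
proof -
  show "g \<in> torus_L1" using assms by (simp add: mult_def)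
  show f: "fcoeff g = (\<lambda>l. b l * ctest k l)" using assms by (auto simp: mult_def fcoeff_trig)
  have "fcoeff g (- k) = cnj (fcoeff g k)" using fcoeff_real[of g] by (simp add: real_seq_def)
  then have "b (- k) * ctest k k = cnj (b k) * ctest k k"
    by (simp only: f complex_cnj_mult ctest_self(2,3))
  then show "b (- k) = cnj (b k)" using ctest_self(1)[of k] by simp
qed

text \<open>
  Apply the operator to \<open>cos (k \<bullet> x)\<close>, which has norm at most \<open>1\<close> in \<open>L\<^sup>\<infinity>\<close>. The image is real, which
  gives the symmetry, and for \<open>k \<noteq> 0\<close> its coefficient at \<open>k\<close> is at most its mean oscillation over the cell.
\<close>

lemma symbol_bounded_cnj:
  assumes "Linf_to_BMO_bounded m" "0 \<le> \<nu>"
  shows "m \<nu> i j (- k) = cnj (m \<nu> i j k)" "\<exists>C. \<forall>k. cmod (m \<nu> i j k) \<le> C"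
proof -
  obtain C where C: "\<And>f. f \<in> torus_Linf \<Longrightarrow> \<exists>g\<in>BMO. mult (m \<nu> i j) f g \<and> BMO_norm g \<le> C * Linf_norm f"
    using assms unfolding Linf_to_BMO_bounded_def by meson
  obtain g where "mult (m \<nu> i j) (trig (fr k) 1 0) g" using C[OF trig_Linf(1)] by blast
  then show "m \<nu> i j (- k) = cnj (m \<nu> i j k)" by (rule mult_trig(3))
  have "cmod (m \<nu> i j k) \<le> 2 * \<bar>C\<bar> + cmod (m \<nu> i j 0)" for k
  proof (cases "k = 0")
    case False
    obtain g where g: "g \<in> BMO" "mult (m \<nu> i j) (trig (fr k) 1 0) g" "BMO_norm g \<le> C * Linf_norm (trig (fr k) 1 0)"
      using C[OF trig_Linf(1)] by blast
    have n0: "0 \<le> Linf_norm (trig (fr k) 1 0)"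
      unfolding Linf_norm_def by (rule cInf_greatest) (auto intro!: exI[of _ 1] simp: trig_def)
    have "cmod (m \<nu> i j k) * (1/2) \<le> cmod (m \<nu> i j k) * cmod (ctest k k)"
      by (intro mult_left_mono cmod_ctest_self) auto
    also have "\<dots> = cmod (fcoeff g k)" by (simp add: mult_trig(2)[OF g(2)] norm_mult)
    also have "\<dots> \<le> mean_osc g torus_cell" by (rule fcoeff_le_mean_osc[OF mult_trig(1)[OF g(2)] False])
    also have "\<dots> \<le> BMO_norm g"
      unfolding BMO_norm_def using g(1) by (intro cSUP_upper torus_cell_cube) (auto simp: BMO_def)
    also have "\<dots> \<le> \<bar>C\<bar> * Linf_norm (trig (fr k) 1 0)"
      using g(3) mult_right_mono[OF abs_ge_self[of C] n0] by linarith
    also have "\<dots> \<le> \<bar>C\<bar> * 1" using trig_Linf(2)[of k] by (intro mult_left_mono) auto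
    finally show ?thesis using norm_ge_zero[of "m \<nu> i j 0"] by linarith
  qed simp
  then show "\<exists>C. \<forall>k. cmod (m \<nu> i j k) \<le> C" by blast
qed

text \<open>
  The image of \<open>cos (k \<bullet> x)\<close> is \<open>Re (m k) * cos (k \<bullet> x) - Im (m k) * sin (k \<bullet> x)\<close>, and its second
  derivatives are multiples of itself. Evaluating the identity at two points of different phase separates
  the real and the imaginary part.
\<close>

lemma symbol_divfree:
  assumes A1: "divergence_free m" and \<nu>: "0 \<le> \<nu>"
    and cn: "\<And>i j k. m \<nu> i j (- k) = cnj (m \<nu> i j k)" and bd: "\<And>i j. \<exists>C. \<forall>k. cmod (m \<nu> i j k) \<le> C"
  shows "(\<Sum>i\<in>UNIV. \<Sum>j\<in>UNIV. of_int (k $ i) * of_int (k $ j) * m \<nu> i j k) = 0"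
proof (cases "k = 0")
  case False
  obtain g where g: "\<And>i j. mult (m \<nu> i j) (trig (fr k) 1 0) (g i j)" "\<And>i j. smooth_fun (g i j)"
    "\<And>x. (\<Sum>i\<in>UNIV. \<Sum>j\<in>UNIV. pd i (pd j (g i j)) x) = 0"
    using A1 \<nu> periodic_trig smooth_trig unfolding divergence_free_def by meson
  have geq: "g i j = trig (fr k) (Re (m \<nu> i j k)) (- Im (m \<nu> i j k))" for i j
  proof
    fix x
    obtain C where C: "\<And>k. cmod (m \<nu> i j k) \<le> C" using bd by blast
    let ?c = "\<lambda>l. m \<nu> i j l * ctest k l"
    have s: "sums_le (\<lambda>l. cmod (?c l)) C"
      unfolding sums_le_def
    proof (intro allI impI)
      fix F :: "(int^'a) set" assume F: "finite F"
      have C0: "0 \<le> C" using C[of 0] norm_ge_zero[of "m \<nu> i j 0"] by linarith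
      have "(\<Sum>l\<in>F. cmod (?c l)) \<le> (\<Sum>l\<in>F. C * cmod (ctest k l))"
        by (intro sum_mono) (simp add: norm_mult mult_right_mono C)
      also have "\<dots> \<le> C * 1" unfolding sum_distrib_left[symmetric]
        using sums_leD[OF ctest_sums_le F] C0 by (intro mult_left_mono) auto
      finally show "(\<Sum>l\<in>F. cmod (?c l)) \<le> C" by simp
    qed
    have r: "real_seq ?c" using real_seq_ctest[of k] cn by (simp add: real_seq_def)
    have "g i j x = fser ?c x"
    proof (rule continuous_eq_of_fcoeff)
      show "g i j \<in> torus_L1" "fser ?c \<in> torus_L1" using mult_trig(1)[OF g(1)] fser_L1[OF s] by auto
      show "fcoeff (g i j) l = fcoeff (fser ?c) l" for l
        by (simp add: mult_trig(2)[OF g(1)] fcoeff_fser[OF s r])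
      show "continuous_on UNIV (g i j)" using g(2)[of i j] by (auto simp: smooth_fun_def dest: spec[of _ 0])
      show "continuous_on UNIV (fser ?c)" unfolding fser_ctest[of "m \<nu> i j", OF cn] by (rule continuous_trig)
    qed
    then show "g i j x = trig (fr k) (Re (m \<nu> i j k)) (- Im (m \<nu> i j k)) x"
      by (simp add: fser_ctest[of "m \<nu> i j", OF cn])
  qed
  let ?X = "\<Sum>i\<in>UNIV. \<Sum>j\<in>UNIV. of_int (k $ i) * of_int (k $ j) * m \<nu> i j k"
  have ReX: "Re ?X = (\<Sum>i\<in>UNIV. \<Sum>j\<in>UNIV. fr k $ i * (fr k $ j * Re (m \<nu> i j k)))"
    and ImX: "Im ?X = (\<Sum>i\<in>UNIV. \<Sum>j\<in>UNIV. fr k $ i * (fr k $ j * Im (m \<nu> i j k)))"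
    by (simp_all add: fr_nth mult.assoc)
  have key: "- Re ?X * cos (fr k \<bullet> x) + Im ?X * sin (fr k \<bullet> x) = 0" for x
  proof -
    have "0 = (\<Sum>i\<in>UNIV. \<Sum>j\<in>UNIV. pd i (pd j (g i j)) x)" using g(3) by simp
    also have "\<dots> = (\<Sum>i\<in>UNIV. \<Sum>j\<in>UNIV. - (fr k $ i * (fr k $ j * Re (m \<nu> i j k))) * cos (fr k \<bullet> x)
        + fr k $ i * (fr k $ j * Im (m \<nu> i j k)) * sin (fr k \<bullet> x))"
      by (simp add: geq pd_trig trig_def)
    also have "\<dots> = - Re ?X * cos (fr k \<bullet> x) + Im ?X * sin (fr k \<bullet> x)"
      unfolding ReX ImX by (simp add: sum.distrib sum_distrib_right sum_negf sum_subtractf)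
    finally show ?thesis by simp
  qed
  have "fr k \<noteq> 0" using False by (auto simp: vec_eq_iff fr_nth)
  \<comment> \<open>A point of phase \<open>pi / 2\<close>, where the cosine vanishes.\<close>
  define y where "y = (pi / 2 / (fr k \<bullet> fr k)) *\<^sub>R fr k"
  have y: "fr k \<bullet> y = pi / 2" using \<open>fr k \<noteq> 0\<close> by (simp add: y_def)
  have "Im ?X = 0" using key[of y] unfolding y cos_pi_half sin_pi_half by linarith
  moreover have "Re ?X = 0" using key[of 0] by simp
  ultimately show ?thesis by (simp add: complex_eq_iff)
qed simp

section \<open>The velocity\<close>

text \<open>
  The case of coefficients that are constant in time, on the time interval \<open>{0..0}\<close>.
\<close>

lemma fser_derivative:
  fixes c :: "int^'d::finite \<Rightarrow> complex"
  assumes c: "sums_le (\<lambda>k. jb k * cmod (c k)) H"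
  shows "(fser c has_derivative (\<lambda>\<xi>. \<Sum>j\<in>UNIV. \<xi> $ j * fser (dcoef j c) x)) (at x)"
    and "continuous_on UNIV (fser (dcoef j c))"
proof -
  let ?f = "\<lambda>k. jb k * cmod (c k)"
  have s: "?f summable_on A" for A by (rule sums_le_summable[OF c]) auto
  define r where "r n = infsum ?f (- fball n)" for n
  have r: "r \<longlonglongrightarrow> 0" unfolding r_def[abs_def] by (rule infsum_tail_tendsto[OF s])
  have r0: "0 \<le> r n" for n unfolding r_def by (rule infsum_nonneg) auto
  have t1: "(\<Sum>k\<in>F. ?f k) \<le> r n" if "finite F" "F \<inter> fball n = {}" for F n
    unfolding r_def using that by (intro finite_sum_le_infsum s) auto
  note st = spacetime_C1[of 0 "\<lambda>_. c" "\<lambda>_ _. 0" r, OF order_refl _ _ r t1]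
  have st3: "((\<lambda>(t, x). fser c x) has_derivative
        (\<lambda>(\<tau>, \<xi>). \<tau> * fser (\<lambda>_. 0) x + (\<Sum>j\<in>UNIV. \<xi> $ j * fser (dcoef j c) x))) (at (0::real, x) within {0..0} \<times> UNIV)"
    by (rule st(3)) (auto simp: r0)
  have im: "(\<lambda>x. (0::real, x)) ` (UNIV :: (real^'d) set) = {0..0} \<times> UNIV" by auto
  have "((\<lambda>x. case (0::real, x) of (t, x) \<Rightarrow> fser c x) has_derivative
     (\<lambda>\<xi>. case (0, \<xi>) of (\<tau>, \<xi>) \<Rightarrow> \<tau> * fser (\<lambda>_. 0) x + (\<Sum>j\<in>UNIV. \<xi> $ j * fser (dcoef j c) x))) (at x)"
    by (rule has_derivative_in_compose[where f="\<lambda>x. (0::real, x)" and f'="\<lambda>\<xi>. (0, \<xi>)"])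
      (use st3 im in \<open>auto intro!: derivative_eq_intros\<close>)
  then show "(fser c has_derivative (\<lambda>\<xi>. \<Sum>j\<in>UNIV. \<xi> $ j * fser (dcoef j c) x)) (at x)" by simp
  have "continuous_on ({0..0::real} \<times> UNIV) (\<lambda>(t, x). fser (dcoef j c) x)"
    by (rule st(2)) (auto simp: r0)
  then have "continuous_on UNIV (\<lambda>x. (\<lambda>(t::real, x). fser (dcoef j c) x) (0, x))"
    by (rule continuous_on_compose2) (auto intro!: continuous_intros)
  then show "continuous_on UNIV (fser (dcoef j c))" by simp
qed

lemma fser_pd:
  assumes "sums_le (\<lambda>k. jb k * cmod (c k)) H"
  shows "pd i (fser c) x = fser (dcoef i c) x"
  unfolding pd_eqI[OF fser_derivative(1)[OF assms]]
  by (simp add: axis_def if_distrib[of "\<lambda>x. x * _"] cong: if_cong)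

lemma fser_differentiable:
  assumes "sums_le (\<lambda>k. jb k * cmod (c k)) H"
  shows "fser c differentiable (at x)" "continuous_on UNIV (fser c)"
proof -
  show *: "fser c differentiable (at x)" for x
    using fser_derivative(1)[OF assms] by (auto simp: differentiable_def)
  show "continuous_on UNIV (fser c)"
    by (intro differentiable_imp_continuous_on) (auto simp: differentiable_on_def *)
qed

lemma fser_sum:
  assumes "\<And>i. i \<in> I \<Longrightarrow> sums_le (\<lambda>k. cmod (c i k)) H"
  shows "fser (\<lambda>k. \<Sum>i\<in>I. c i k) x = (\<Sum>i\<in>I. fser (c i) x)"
proof -
  have "((\<lambda>k. \<Sum>i\<in>I. c i k * ew k x) has_sum (\<Sum>i\<in>I. infsum (\<lambda>k. c i k * ew k x) UNIV)) UNIV"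
  proof (cases "finite I")
    case True
    then show ?thesis using assms
    proof (induction I)
      case (insert i I)
      then show ?case
        by (simp, intro has_sum_add has_sum_infsum abs_summable_ew(2)[of "c i" H]) auto
    qed simp
  qed simp
  then have "infsum (\<lambda>k. \<Sum>i\<in>I. c i k * ew k x) UNIV = (\<Sum>i\<in>I. infsum (\<lambda>k. c i k * ew k x) UNIV)"
    by (rule infsumI)
  then show ?thesis by (simp add: fser_def sum_distrib_right)
qed

lemma sums_le_jb_weaken: "sums_le (\<lambda>k. jb k * cmod (c k)) H \<Longrightarrow> sums_le (\<lambda>k. cmod (c k)) H"
  by (erule sums_le_mono) (auto intro: cmod_le_jb_cmod)

lemma sums_le_cmult:
  assumes "sums_le f H" "\<And>k. g k \<le> C * f k" "0 \<le> C"
  shows "sums_le g (C * H)"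
  unfolding sums_le_def
proof (intro allI impI)
  fix F assume F: "finite (F :: 'a set)"
  have "sum g F \<le> C * sum f F" unfolding sum_distrib_left by (intro sum_mono assms)
  also have "\<dots> \<le> C * H" using sums_leD[OF assms(1) F] assms(3) by (intro mult_left_mono)
  finally show "sum g F \<le> C * H" .
qed

text \<open>
  What the assumptions on the operators say about their symbols at \<open>\<nu> = 0\<close>. The bound \<open>Cm\<close>
  makes \<open>T\<^sub>i\<^sub>j[\<theta>]\<close> as smooth as \<open>\<theta>\<close>; the size of the velocity is governed by \<open>C0\<close>.
\<close>

locale as_symbol =
  fixes \<mu> :: "'d::finite \<Rightarrow> 'd \<Rightarrow> int^'d \<Rightarrow> complex" and C0 Cm s :: real
  assumes mu_cnj: "\<mu> i j (- k) = cnj (\<mu> i j k)"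
    and mu_bd: "cmod (\<mu> i j k) \<le> Cm"
    and mu_div: "(\<Sum>i\<in>UNIV. \<Sum>j\<in>UNIV. of_int (k $ i) * of_int (k $ j) * \<mu> i j k) = 0"
    and mu_grad: "cmod (of_int (k $ i) * \<mu> i j k) \<le> C0"
    and s_large: "s > real CARD('d) / 2 + 1"
begin

definition \<Lambda> :: "'d \<Rightarrow> int^'d \<Rightarrow> complex" where
  "\<Lambda> j l = (\<Sum>i\<in>UNIV. \<i> * of_int (l $ i) * \<mu> i j l)"

definition \<sigma> :: "int^'d \<Rightarrow> int^'d \<Rightarrow> complex" where
  "\<sigma> p l = (\<Sum>j\<in>UNIV. \<i> * of_int (p $ j) * \<Lambda> j l)"

definition D :: real where "D = real CARD('d)"

lemma C0_nonneg: "0 \<le> C0"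
  using mu_grad[of 0 undefined undefined] by simp

lemma Cm_nonneg: "0 \<le> Cm"
  using mu_bd[of undefined undefined 0] norm_ge_zero order_trans by blast

lemma Lambda_le: "cmod (\<Lambda> j l) \<le> D * C0"
proof -
  have "cmod (\<Lambda> j l) \<le> (\<Sum>i\<in>(UNIV::'d set). C0)"
    unfolding \<Lambda>_def by (rule sum_norm_le) (use mu_grad in \<open>simp add: norm_mult mult.assoc\<close>)
  then show ?thesis by (simp add: D_def)
qed

lemma Lambda_cnj: "\<Lambda> j (- l) = cnj (\<Lambda> j l)"
  by (simp add: \<Lambda>_def mu_cnj)

lemma Lambda_div: "(\<Sum>j\<in>UNIV. of_int (l $ j) * \<Lambda> j l) = 0"
proof -
  have "(\<Sum>j\<in>UNIV. of_int (l $ j) * \<Lambda> j l) = \<i> * (\<Sum>i\<in>UNIV. \<Sum>j\<in>UNIV. of_int (l $ i) * of_int (l $ j) * \<mu> i j l)"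
    unfolding \<Lambda>_def sum_distrib_left by (subst sum.swap) (simp add: mult_ac)
  then show ?thesis by (simp add: mu_div)
qed

sublocale transport_symbol \<sigma> "D * (D * C0)" s
proof
  fix p l :: "int^'d"
  have "cmod (\<sigma> p l) \<le> (\<Sum>j\<in>(UNIV::'d set). norm (fr p) * (D * C0))"
    unfolding \<sigma>_def
  proof (rule sum_norm_le)
    fix j
    have "cmod (\<i> * of_int (p $ j) * \<Lambda> j l) = \<bar>real_of_int (p $ j)\<bar> * cmod (\<Lambda> j l)"
      by (simp add: norm_mult)
    also have "\<dots> \<le> norm (fr p) * (D * C0)"
      by (intro mult_mono comp_le_norm_fr Lambda_le) auto
    finally show "cmod (\<i> * of_int (p $ j) * \<Lambda> j l) \<le> norm (fr p) * (D * C0)" .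
  qed
  then show "cmod (\<sigma> p l) \<le> D * (D * C0) * norm (fr p)" by (simp add: D_def mult_ac)
  have "\<sigma> (p + l) l = \<sigma> p l + \<i> * (\<Sum>j\<in>UNIV. of_int (l $ j) * \<Lambda> j l)"
    by (simp add: \<sigma>_def sum.distrib sum_distrib_left algebra_simps)
  then show "\<sigma> (p + l) l = \<sigma> p l" by (simp add: Lambda_div)
  show "cnj (\<sigma> p l) = - \<sigma> p (- l)" by (simp add: \<sigma>_def Lambda_cnj sum_negf)
  show "\<sigma> (- p) l = - \<sigma> p l" by (simp add: \<sigma>_def sum_negf)
  show "0 \<le> D * (D * C0)" using C0_nonneg by (simp add: D_def)
  show "real CARD('d) / 2 + 1 < s" by (rule s_large)
qed

definition vel :: "(int^'d \<Rightarrow> complex) \<Rightarrow> 'd \<Rightarrow> int^'d \<Rightarrow> complex" where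
  "vel a j l = \<Lambda> j l * a l"

lemma real_seq_vel: "real_seq a \<Longrightarrow> real_seq (vel a j)"
  by (simp add: real_seq_def vel_def Lambda_cnj)

lemma vel_jb:
  assumes "hsb a E"
  shows "sums_le (\<lambda>l. jb l * cmod (vel a j l)) (D * C0 * (sqrt E * \<kappa>))"
proof (rule sums_le_cmult[OF hsb_l1[OF assms]])
  fix k
  show "jb k * cmod (vel a j k) \<le> D * C0 * (jb k * cmod (a k))"
    using mult_right_mono[OF Lambda_le[of j k], of "jb k * cmod (a k)"] by (simp add: vel_def norm_mult mult_ac)
qed (use C0_nonneg in \<open>simp add: D_def\<close>)

lemma mu_jb:
  assumes "hsb a E"
  shows "sums_le (\<lambda>l. jb l * cmod (\<mu> i j l * a l)) (Cm * (sqrt E * \<kappa>))"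
proof (rule sums_le_cmult[OF hsb_l1[OF assms]])
  fix k
  show "jb k * cmod (\<mu> i j k * a k) \<le> Cm * (jb k * cmod (a k))"
    using mult_right_mono[OF mu_bd[of i j k], of "jb k * cmod (a k)"] by (simp add: norm_mult mult_ac)
qed (rule Cm_nonneg)

lemma dcoef_l1:
  assumes "sums_le (\<lambda>k. jb k * cmod (c k)) H"
  shows "sums_le (\<lambda>k. cmod (dcoef j c k)) H"
  by (rule sums_le_mono[OF assms]) (use cmod_dcoef in auto)

lemma velocity_sum:
  assumes a: "hsb a E"
  shows "(\<Sum>i\<in>UNIV. fser (dcoef i (\<lambda>l. \<mu> i j l * a l)) x) = fser (vel a j) x"
proof -
  have "vel a j = (\<lambda>l. \<Sum>i\<in>UNIV. dcoef i (\<lambda>l. \<mu> i j l * a l) l)"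
    by (simp add: vel_def \<Lambda>_def dcoef_def sum_distrib_left sum_distrib_right mult_ac fun_eq_iff)
  then show ?thesis by (simp only:) (rule fser_sum[symmetric], rule dcoef_l1[OF mu_jb[OF a]])
qed

lemma real_seq_mu: "real_seq a \<Longrightarrow> real_seq (\<lambda>l. \<mu> i j l * a l)"
  by (simp add: real_seq_def mu_cnj)

text \<open>
  The functions \<open>\<tau> i j\<close> in the definition of the velocity are continuous and have the same coefficients
  as the corresponding series, so they coincide with them everywhere and can be differentiated term by
  term.
\<close>

lemma velocity_unique:
  assumes a: "hsb (fcoeff f) E" and v: "velocity \<mu> f u"
  shows "u x $ j = fser (vel (fcoeff f) j) x"
proof -
  let ?a = "fcoeff f"
  obtain \<tau> where \<tau>: "\<And>i j. mult (\<mu> i j) f (\<tau> i j)" "\<And>i j x. \<tau> i j differentiable (at x)"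
    "\<And>x j. u x $ j = (\<Sum>i\<in>UNIV. pd i (\<tau> i j) x)"
    using v unfolding velocity_def by blast
  have eq: "\<tau> i j = fser (\<lambda>l. \<mu> i j l * ?a l)" for i j
  proof
    fix x
    show "\<tau> i j x = fser (\<lambda>l. \<mu> i j l * ?a l) x"
    proof (rule continuous_eq_of_fcoeff)
      show "\<tau> i j \<in> torus_L1" using \<tau>(1) by (simp add: mult_def)
      show "fser (\<lambda>l. \<mu> i j l * ?a l) \<in> torus_L1" by (rule fser_L1[OF sums_le_jb_weaken[OF mu_jb[OF a]]])
      show "fcoeff (\<tau> i j) k = fcoeff (fser (\<lambda>l. \<mu> i j l * ?a l)) k" for k
        using \<tau>(1)[of i j] fcoeff_fser[OF sums_le_jb_weaken[OF mu_jb[OF a]] real_seq_mu[OF fcoeff_real]]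
        by (simp add: mult_def)
      show "continuous_on UNIV (\<tau> i j)"
        by (intro differentiable_imp_continuous_on) (auto simp: differentiable_on_def \<tau>(2))
      show "continuous_on UNIV (fser (\<lambda>l. \<mu> i j l * ?a l))" by (rule fser_differentiable(2)[OF mu_jb[OF a]])
    qed
  qed
  show ?thesis unfolding \<tau>(3) eq fser_pd[OF mu_jb[OF a]] by (rule velocity_sum[OF a])
qed

lemma velocity_exists:
  assumes a: "hsb a E" "real_seq a"
  shows "velocity \<mu> (fser a) (\<lambda>x. \<chi> j. fser (vel a j) x)"
  unfolding velocity_def
proof (intro exI[of _ "\<lambda>i j. fser (\<lambda>l. \<mu> i j l * a l)"] conjI allI)
  fix i j
  show "mult (\<mu> i j) (fser a) (fser (\<lambda>l. \<mu> i j l * a l))"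
    unfolding mult_def
    by (simp add: fser_L1[OF hsb_l10[OF a(1)]] fser_L1[OF sums_le_jb_weaken[OF mu_jb[OF a(1)]]]
        fcoeff_fser[OF hsb_l10[OF a(1)] a(2)] fcoeff_fser[OF sums_le_jb_weaken[OF mu_jb[OF a(1)]] real_seq_mu[OF a(2)]])
  fix x show "fser (\<lambda>l. \<mu> i j l * a l) differentiable (at x)" by (rule fser_differentiable(1)[OF mu_jb[OF a(1)]])
next
  fix x j
  show "(\<chi> j. fser (vel a j) x) $ j = (\<Sum>i\<in>UNIV. pd i (fser (\<lambda>l. \<mu> i j l * a l)) x)"
    unfolding fser_pd[OF mu_jb[OF a(1)]] velocity_sum[OF a(1)] by simp
qed

lemma fcoeff_sum:
  assumes "finite I" "\<And>i. i \<in> I \<Longrightarrow> f i \<in> torus_L1"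
  shows "(\<lambda>x. \<Sum>i\<in>I. f i x) \<in> torus_L1 \<and> fcoeff (\<lambda>x. \<Sum>i\<in>I. f i x) k = (\<Sum>i\<in>I. fcoeff (f i) k)"
  using assms
proof (induction I)
  case empty
  have "(\<lambda>x. 0) \<in> torus_L1" by (intro periodic_continuous_L1) (auto simp: periodic_def)
  then show ?case by (simp add: fcoeff_def)
qed (auto intro: L1_add simp: fcoeff_add)

lemma transport_continuous:
  assumes a: "hsb a E"
  shows "continuous_on UNIV (\<lambda>x. fser (vel a j) x * fser (dcoef j a) x)"
  by (intro continuous_intros fser_differentiable(2)[OF vel_jb[OF a]] fser_derivative(2)[OF hsb_l1[OF a]])

lemma transport_L1:
  assumes a: "hsb a E"
  shows "(\<lambda>x. fser (vel a j) x * fser (dcoef j a) x) \<in> torus_L1"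
  by (rule periodic_continuous_L1[OF _ transport_continuous[OF a]])
    (simp add: periodic_def periodic_fser[unfolded periodic_def])

text \<open>
  The convolution theorem identifies \<open>Bil\<close> as the Fourier transform of the nonlinear term.
\<close>

lemma transport_fcoeff:
  assumes a: "hsb a E" "real_seq a"
  shows "(\<lambda>x. \<Sum>j\<in>UNIV. fser (vel a j) x * fser (dcoef j a) x) \<in> torus_L1"
    "fcoeff (\<lambda>x. \<Sum>j\<in>UNIV. fser (vel a j) x * fser (dcoef j a) x) k = Bil a a k"
proof -
  show "(\<lambda>x. \<Sum>j\<in>UNIV. fser (vel a j) x * fser (dcoef j a) x) \<in> torus_L1"
    using fcoeff_sum[of UNIV "\<lambda>j x. fser (vel a j) x * fser (dcoef j a) x"] transport_L1[OF a(1)] by simp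
  have l: "(\<lambda>n. \<Sum>p\<in>fball n. dcoef j a p * vel a j (k - p)) \<longlonglongrightarrow> fcoeff (\<lambda>x. fser (vel a j) x * fser (dcoef j a) x) k" for j
    using fcoeff_mult_fser[where k=k, OF fser_L1[OF sums_le_jb_weaken[OF vel_jb[OF a(1), of j]]]
        dcoef_l1[OF hsb_l1[OF a(1)]] real_seq_dcoef[OF a(2), of j]]
    by (simp add: fcoeff_fser[OF sums_le_jb_weaken[OF vel_jb[OF a(1)]] real_seq_vel[OF a(2)]])
  have "(\<lambda>n. \<Sum>j\<in>UNIV. \<Sum>p\<in>fball n. dcoef j a p * vel a j (k - p)) \<longlonglongrightarrow>
     (\<Sum>j\<in>UNIV. fcoeff (\<lambda>x. fser (vel a j) x * fser (dcoef j a) x) k)"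
    by (intro tendsto_sum l)
  moreover have "(\<lambda>n. \<Sum>j\<in>UNIV. \<Sum>p\<in>fball n. dcoef j a p * vel a j (k - p)) = (\<lambda>n. \<Sum>p\<in>fball n. tm a a k p)"
  proof
    fix n
    show "(\<Sum>j\<in>UNIV. \<Sum>p\<in>fball n. dcoef j a p * vel a j (k - p)) = (\<Sum>p\<in>fball n. tm a a k p)"
      by (subst sum.swap) (simp add: tm_def \<sigma>_def dcoef_def vel_def sum_distrib_left sum_distrib_right mult_ac)
  qed
  ultimately have "(\<Sum>j\<in>UNIV. fcoeff (\<lambda>x. fser (vel a j) x * fser (dcoef j a) x) k) = Bil a a k"
    using LIMSEQ_unique[OF _ Bil_lim[OF a(1) a(1)]] by simp
  then show "fcoeff (\<lambda>x. \<Sum>j\<in>UNIV. fser (vel a j) x * fser (dcoef j a) x) k = Bil a a k"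
    using fcoeff_sum[of UNIV "\<lambda>j x. fser (vel a j) x * fser (dcoef j a) x"] transport_L1[OF a(1)] by simp
qed

lemma Bil_zero: "Bil a b 0 = 0"
proof -
  have "\<sigma> p (0 - p) = 0" for p
    using symbol_shift[of p "- p"] by (simp add: \<sigma>_def[of 0])
  then have "tm a b 0 = (\<lambda>_. 0)" by (simp add: tm_def fun_eq_iff)
  then show ?thesis by (simp add: Bil_def)
qed

end

section \<open>From classical solutions to Fourier coefficients\<close>

lemma time_slice_derivative:
  assumes "((\<lambda>(t, x). \<theta> t x) has_derivative F) (at (t, x) within A \<times> UNIV)"
  shows "((\<lambda>r. \<theta> r x) has_derivative (\<lambda>h. F (h, 0))) (at t within A)"
proof -
  have e1: "((\<lambda>r. (r, x)) has_derivative (\<lambda>h. (h, 0))) (at t within A)"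
    by (auto intro!: derivative_eq_intros)
  have d1: "((\<lambda>(t, x). \<theta> t x) has_derivative F) (at (t, x) within (\<lambda>r. (r, x)) ` A)"
    by (rule has_derivative_subset[OF assms]) auto
  from has_derivative_in_compose[OF e1 d1] show ?thesis by simp
qed

lemma C1_strip_slices:
  fixes \<theta> :: "real \<Rightarrow> real^'a::finite \<Rightarrow> real"
  assumes "C1_strip T \<theta>" "0 \<le> T"
  obtains D :: "real \<times> (real^'a) \<Rightarrow> (real \<times> (real^'a)) \<Rightarrow>\<^sub>L real" where "continuous_on ({0..T} \<times> UNIV) D"
    "\<And>t x. t \<in> {0..T} \<Longrightarrow> ((\<lambda>r. \<theta> r x) has_vector_derivative blinfun_apply (D (t, x)) (1, 0)) (at t within {0..T})"
    "\<And>t x. t \<in> {0..T} \<Longrightarrow> \<theta> t differentiable (at x)"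
proof -
  obtain D :: "real \<times> (real^'a) \<Rightarrow> (real \<times> (real^'a)) \<Rightarrow>\<^sub>L real" where
    D: "continuous_on ({0..T} \<times> UNIV) D"
    "\<And>p. p \<in> {0..T} \<times> UNIV \<Longrightarrow> ((\<lambda>(t, x). \<theta> t x) has_derivative blinfun_apply (D p)) (at p within {0..T} \<times> UNIV)"
    using assms(1) unfolding C1_strip_def by blast
  show ?thesis
  proof
    show "continuous_on ({0..T} \<times> UNIV) D" by (rule D(1))
    fix t x assume t: "t \<in> {0..T}"
    have d: "((\<lambda>(t, x). \<theta> t x) has_derivative blinfun_apply (D (t, x))) (at (t, x) within {0..T} \<times> UNIV)"
      using D(2)[of "(t, x)"] t by simp
    have "((\<lambda>r. \<theta> r x) has_derivative (\<lambda>h. blinfun_apply (D (t, x)) (h, 0))) (at t within {0..T})"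
      by (rule time_slice_derivative[OF d])
    moreover have "(\<lambda>h. blinfun_apply (D (t, x)) (h, 0)) = (\<lambda>h. h *\<^sub>R blinfun_apply (D (t, x)) (1, 0))"
    proof
      fix h show "blinfun_apply (D (t, x)) (h, 0) = h *\<^sub>R blinfun_apply (D (t, x)) (1, 0)"
        using blinfun.scaleR_right[of "D (t, x)" h "(1, 0)"] by simp
    qed
    ultimately show "((\<lambda>r. \<theta> r x) has_vector_derivative blinfun_apply (D (t, x)) (1, 0)) (at t within {0..T})"
      unfolding has_vector_derivative_def by (simp only:)
    have e2: "((\<lambda>y. (t, y)) has_derivative (\<lambda>h. (0, h))) (at x)"
      by (auto intro!: derivative_eq_intros)
    have d2: "((\<lambda>(t, x). \<theta> t x) has_derivative blinfun_apply (D (t, x))) (at (t, x) within range (\<lambda>y. (t, y)))"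
      by (rule has_derivative_subset[OF d]) (use t in auto)
    from has_derivative_in_compose[OF e2 d2]
    have "((\<lambda>y. \<theta> t y) has_derivative (\<lambda>h. blinfun_apply (D (t, x)) (0, h))) (at x)" by simp
    then show "\<theta> t differentiable (at x)" by (auto simp: differentiable_def)
  qed
qed

lemma L2_imp_L1:
  assumes f: "f \<in> torus_L2"
  shows "f \<in> torus_L1"
proof -
  have m: "f \<in> borel_measurable lebesgue" using f by (simp add: torus_L2_def)
  have i: "integrable lebesgue (\<lambda>x. indicator torus_cell x *\<^sub>R 1 + indicator torus_cell x *\<^sub>R (f x)\<^sup>2)"
    using f cell_bounded_integrable[of "\<lambda>_. 1::real" 1] by (auto simp: torus_L2_def set_integrable_def)
  have "integrable lebesgue (\<lambda>x. indicator torus_cell x *\<^sub>R f x)"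
  proof (rule Bochner_Integration.integrable_bound[OF i])
    show "(\<lambda>x. indicator torus_cell x *\<^sub>R f x) \<in> borel_measurable lebesgue" using m by measurable
    show "AE x in lebesgue. norm (indicator torus_cell x *\<^sub>R f x) \<le> norm (indicator torus_cell x *\<^sub>R (1::real) + indicator torus_cell x *\<^sub>R (f x)\<^sup>2)"
    proof (rule AE_I2)
      fix x
      have "\<bar>f x\<bar> \<le> 1 + (f x)\<^sup>2"
      proof -
        have "2 * \<bar>f x\<bar> \<le> (f x)\<^sup>2 + 1" using sum_squares_bound[of "\<bar>f x\<bar>" 1] by simp
        then show ?thesis by linarith
      qed
      then show "norm (indicator torus_cell x *\<^sub>R f x) \<le> norm (indicator torus_cell x *\<^sub>R (1::real) + indicator torus_cell x *\<^sub>R (f x)\<^sup>2)"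
        by (auto simp: indicator_def)
    qed
  qed
  then show ?thesis using f by (simp add: torus_L1_def torus_L2_def set_integrable_def)
qed

lemma cell_integral_continuous:
  assumes "continuous_on UNIV (f :: real^'d::finite \<Rightarrow> complex)"
  shows "(LINT x:torus_cell|lebesgue. f x) = integral torus_cell f"
proof -
  have "set_integrable lborel torus_cell f"
    unfolding set_integrable_def torus_cell_def
    by (intro borel_integrable_compact continuous_on_subset[OF assms]) auto
  then have "set_integrable lebesgue torus_cell f"
    unfolding set_integrable_def
  proof (rule integrable_completion[THEN iffD2, rotated])
    show "(\<lambda>x. indicator torus_cell x *\<^sub>R f x) \<in> borel_measurable lborel"
      using borel_measurable_continuous_onI[OF assms] by measurable
  qed
  then show ?thesis by (rule set_lebesgue_integral_eq_integral(2))
qed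

lemma continuous_on_slice:
  assumes "continuous_on (A \<times> UNIV) (\<lambda>(t, x). g t x)" "t \<in> A"
  shows "continuous_on UNIV (g t)"
proof -
  have "continuous_on UNIV (\<lambda>x. (t, x))" by (intro continuous_intros)
  from continuous_on_compose2[OF assms(1) this] show ?thesis using assms(2) by auto
qed

text \<open>
  Differentiation under the integral sign over the compact cell.
\<close>

lemma has_vector_derivative_fcoeff:
  fixes \<theta> :: "real \<Rightarrow> real^'d::finite \<Rightarrow> real"
  assumes der: "\<And>t x. t \<in> {0..T} \<Longrightarrow> ((\<lambda>r. \<theta> r x) has_vector_derivative g t x) (at t within {0..T})"
    and cont: "\<And>t. t \<in> {0..T} \<Longrightarrow> continuous_on UNIV (\<theta> t)"
    and g: "continuous_on ({0..T} \<times> UNIV) (\<lambda>(t, x). g t x)"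
    and t: "t \<in> {0..T}"
  shows "((\<lambda>t. fcoeff (\<theta> t) k) has_vector_derivative fcoeff (g t) k) (at t within {0..T})"
proof -
  let ?e = "\<lambda>x. ew (- k) x"
  have gt: "continuous_on UNIV (g t)" if "t \<in> {0..T}" for t
    using continuous_on_slice[OF g that] .
  have "((\<lambda>t. integral (cbox 0 (\<chi> i. 2 * pi)) (\<lambda>x. complex_of_real (\<theta> t x) * ?e x)) has_vector_derivative
     integral (cbox 0 (\<chi> i. 2 * pi)) (\<lambda>x. complex_of_real (g t x) * ?e x)) (at t within {0..T})"
  proof (rule leibniz_rule_vector_derivative)
    fix r x assume r: "r \<in> {0..T}"
    show "((\<lambda>r. complex_of_real (\<theta> r x) * ?e x) has_vector_derivative complex_of_real (g r x) * ?e x) (at r within {0..T})"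
      by (intro has_vector_derivative_mult_left has_vector_derivative_of_real
        der[OF r, folded has_real_derivative_iff_has_vector_derivative])
  next
    fix r assume r: "r \<in> {0..T}"
    show "(\<lambda>x. complex_of_real (\<theta> r x) * ?e x) integrable_on cbox 0 (\<chi> i. 2 * pi)"
      by (intro integrable_continuous continuous_intros continuous_on_subset[OF cont[OF r]] continuous_ew) auto
  next
    have "continuous_on ({0..T} \<times> cbox 0 (\<chi> i. 2 * pi)) (\<lambda>p. complex_of_real (case p of (t, x) \<Rightarrow> g t x) * ?e (snd p))"
      by (intro continuous_intros continuous_on_subset[OF g] continuous_on_compose2[OF continuous_ew[of UNIV]]) auto
    then show "continuous_on ({0..T} \<times> cbox 0 (\<chi> i. 2 * pi)) (\<lambda>(t, x). complex_of_real (g t x) * ?e x)"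
      by (simp add: case_prod_unfold)
  qed (use t in auto)
  then have *: "((\<lambda>t. integral torus_cell (\<lambda>x. complex_of_real (\<theta> t x) * ?e x) / (2 * pi) ^ CARD('d)) has_vector_derivative
     integral torus_cell (\<lambda>x. complex_of_real (g t x) * ?e x) / (2 * pi) ^ CARD('d)) (at t within {0..T})"
    unfolding torus_cell_def by (intro has_vector_derivative_divide)
  have eq: "fcoeff f k = integral torus_cell (\<lambda>x. complex_of_real (f x) * ?e x) / (2 * pi) ^ CARD('d)"
    if "continuous_on UNIV f" for f
    unfolding fcoeff_ew using that
    by (subst cell_integral_continuous) (auto intro!: continuous_intros continuous_ew)
  show ?thesis unfolding eq[OF gt[OF t]]
    by (rule has_vector_derivative_transform[OF t _ *]) (simp add: eq cont)
qed

context as_symbol begin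

lemma Hs_weight_eq: "Hs_weight s f k = (w k * cmod (fcoeff f k))\<^sup>2"
proof -
  have "(1 + (\<Sum>i\<in>UNIV. (real_of_int (k $ i))\<^sup>2)) powr s = (w k)\<^sup>2"
  proof -
    have "((jb k)\<^sup>2) powr s = jb k powr (2 * s)" by (rule sq_powr) simp
    also have "\<dots> = jb k powr s * jb k powr s" using powr_add[of "jb k" s s] by (simp only: mult_2)
    finally show ?thesis unfolding jb_sq[symmetric] w_def by (simp only: power2_eq_square)
  qed
  then show ?thesis by (simp add: Hs_weight_def power_mult_distrib)
qed

lemma hsb_Hs:
  assumes f: "f \<in> Hs s"
  shows "hsb (fcoeff f) ((Hs_norm s f)\<^sup>2)"
proof -
  have s: "(\<lambda>k. (w k * cmod (fcoeff f k))\<^sup>2) summable_on UNIV"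
    using f by (simp add: Hs_def Hs_weight_eq[abs_def])
  have "(Hs_norm s f)\<^sup>2 = infsum (\<lambda>k. (w k * cmod (fcoeff f k))\<^sup>2) UNIV"
    unfolding Hs_norm_def Hs_weight_eq by (intro real_sqrt_pow2 infsum_nonneg) simp
  then show ?thesis unfolding hsb_def using summable_sums_le[OF s] by simp
qed

lemma hsb_mono: "hsb a E \<Longrightarrow> E \<le> E' \<Longrightarrow> hsb a E'"
  unfolding hsb_def by (erule sums_le_mono) auto

text \<open>
  The \<open>H\<^sup>s\<close>-bound holds for almost every time only. Each finite sum of squares of coefficients is
  continuous in time, so that the set of times where it exceeds the bound is open; being a null set, it is
  empty. Hence the bound holds at all times, and the coefficients of the equation can be computed.
\<close>

lemma solution_fourier:
  assumes T: "0 < T" and sol: "AS_solution m 0 S \<theta>0 T \<theta>" and m: "m 0 = \<mu>"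
    and Linf: "\<theta> \<in> Linf_Hs T s" and S: "S \<in> torus_L1" and \<theta>0: "\<theta>0 \<in> torus_L1"
  shows "\<exists>E. \<forall>t\<in>{0..T}. hsb (fcoeff (\<theta> t)) E"
    and "\<And>t k. t \<in> {0..T} \<Longrightarrow> ((\<lambda>t. fcoeff (\<theta> t) k) has_vector_derivative
        fcoeff S k - Bil (fcoeff (\<theta> t)) (fcoeff (\<theta> t)) k) (at t within {0..T})"
    and "fcoeff (\<theta> 0) = fcoeff \<theta>0"
    and "\<And>t. t \<in> {0..T} \<Longrightarrow> continuous_on UNIV (\<theta> t) \<and> \<theta> t \<in> torus_L1"
proof -
  have C1: "C1_strip T \<theta>" and per: "\<And>t. t \<in> {0..T} \<Longrightarrow> periodic (\<theta> t)"
    and init: "AE x in lebesgue. \<theta> 0 x = \<theta>0 x"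
    using sol unfolding AS_solution_def by auto
  obtain u where u: "\<And>t. t \<in> {0..T} \<Longrightarrow> velocity \<mu> (\<theta> t) (u t)"
    "\<And>t. t \<in> {0..T} \<Longrightarrow> AE x in lebesgue.
           vector_derivative (\<lambda>r. \<theta> r x) (at t within {0..T})
             + (\<Sum>j\<in>UNIV. u t x $ j * pd j (\<theta> t) x) = S x"
    using sol unfolding AS_solution_def m by blast
  obtain D :: "real \<times> (real^'d) \<Rightarrow> (real \<times> (real^'d)) \<Rightarrow>\<^sub>L real" where D: "continuous_on ({0..T} \<times> UNIV) D"
    "\<And>t x. t \<in> {0..T} \<Longrightarrow> ((\<lambda>r. \<theta> r x) has_vector_derivative blinfun_apply (D (t, x)) (1, 0)) (at t within {0..T})"
    "\<And>t x. t \<in> {0..T} \<Longrightarrow> \<theta> t differentiable (at x)"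
    using C1_strip_slices[OF C1 less_imp_le[OF T]] by blast
  define g where "g t x = blinfun_apply (D (t, x)) (1, 0)" for t x
  have gc: "continuous_on ({0..T} \<times> UNIV) (\<lambda>(t, x). g t x)"
    unfolding g_def using D(1) by (auto simp: case_prod_unfold intro!: continuous_intros)
  have cont: "continuous_on UNIV (\<theta> t)" if "t \<in> {0..T}" for t
    using D(3)[OF that] by (intro differentiable_imp_continuous_on) (auto simp: differentiable_on_def)
  have L1: "\<theta> t \<in> torus_L1" if "t \<in> {0..T}" for t
    by (rule periodic_continuous_L1[OF per[OF that] cont[OF that]])
  show "continuous_on UNIV (\<theta> t) \<and> \<theta> t \<in> torus_L1" if "t \<in> {0..T}" for t
    using cont[OF that] L1[OF that] by blast
  have gt: "continuous_on UNIV (g t)" if "t \<in> {0..T}" for t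
    using continuous_on_slice[OF gc that] .
  have der: "((\<lambda>t. fcoeff (\<theta> t) k) has_vector_derivative fcoeff (g t) k) (at t within {0..T})" if "t \<in> {0..T}" for t k
    by (rule has_vector_derivative_fcoeff[OF _ cont gc that]) (simp add: g_def D(2))
  have fc: "continuous_on {0..T} (\<lambda>t. fcoeff (\<theta> t) k)" for k
    unfolding continuous_on_eq_continuous_within using der has_vector_derivative_continuous by blast
  have zt: "0 \<in> {0..T}" using T by simp
  show "fcoeff (\<theta> 0) = fcoeff \<theta>0"
    using fcoeff_AE_cong[OF _ _ init] L1[OF zt] \<theta>0 by (auto simp: torus_L1_def)
  obtain M where M: "AE t in lebesgue_on {0<..<T}. \<theta> t \<in> Hs s \<and> Hs_norm s (\<theta> t) \<le> M"
    using Linf unfolding Linf_Hs_def by blast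
  have "AE t in lebesgue. t \<in> {0<..<T} \<longrightarrow> \<theta> t \<in> Hs s \<and> Hs_norm s (\<theta> t) \<le> M"
    using M by (subst (asm) AE_restrict_space_iff) auto
  then obtain N where N: "negligible N" "{t. \<not> (t \<in> {0<..<T} \<longrightarrow> \<theta> t \<in> Hs s \<and> Hs_norm s (\<theta> t) \<le> M)} \<subseteq> N"
    unfolding eventually_ae_filter_negligible by blast
  have hs: "hsb (fcoeff (\<theta> t)) (M\<^sup>2)" if t: "t \<in> {0..T}" for t
    unfolding hsb_def sums_le_def
  proof (intro allI impI)
    fix F :: "(int^'d) set" assume F: "finite F"
    let ?h = "\<lambda>t. \<Sum>k\<in>F. (w k * cmod (fcoeff (\<theta> t) k))\<^sup>2"
    have hc: "continuous_on {0..T} ?h" by (intro continuous_intros fc)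
    let ?G = "{0<..<T} \<inter> ?h -` {M\<^sup>2<..}"
    have "open ?G"
      by (intro continuous_open_preimage continuous_on_subset[OF hc]) auto
    moreover have "?G \<subseteq> N"
    proof
      fix r assume r: "r \<in> ?G"
      have "\<not> (\<theta> r \<in> Hs s \<and> Hs_norm s (\<theta> r) \<le> M)"
      proof
        assume a: "\<theta> r \<in> Hs s \<and> Hs_norm s (\<theta> r) \<le> M"
        have "?h r \<le> (Hs_norm s (\<theta> r))\<^sup>2"
          using hsb_Hs[of "\<theta> r"] a F by (simp add: hsb_def sums_le_def)
        also have "\<dots> \<le> M\<^sup>2" using a by (intro power_mono) (auto simp: Hs_norm_def intro!: infsum_nonneg simp: Hs_weight_eq)
        finally show False using r by simp
      qed
      then show "r \<in> N" using N(2) r by auto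
    qed
    ultimately have "?G = {}" using open_not_negligible negligible_subset[OF N(1)] by blast
    then have le: "?h r \<le> M\<^sup>2" if "r \<in> {0<..<T}" for r using that by (auto simp: not_less)
    have cl: "closure {0<..<T} = {0..T}" using T by simp
    show "?h t \<le> M\<^sup>2"
      by (rule continuous_le_on_closure[of "{0<..<T}" ?h]) (use hc le t cl in auto)
  qed
  then show "\<exists>E. \<forall>t\<in>{0..T}. hsb (fcoeff (\<theta> t)) E" by blast
  show "((\<lambda>t. fcoeff (\<theta> t) k) has_vector_derivative
        fcoeff S k - Bil (fcoeff (\<theta> t)) (fcoeff (\<theta> t)) k) (at t within {0..T})" if t: "t \<in> {0..T}" for t k
  proof -
    let ?a = "fcoeff (\<theta> t)"
    note h = hs[OF t]
    have \<theta>eq: "\<theta> t = fser ?a"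
    proof
      fix x show "\<theta> t x = fser ?a x"
        by (rule continuous_eq_of_fcoeff[OF L1[OF t] fser_L1[OF hsb_l10[OF h]] _ cont[OF t] fser_differentiable(2)[OF hsb_l1[OF h]]])
          (simp add: fcoeff_fser[OF hsb_l10[OF h] fcoeff_real])
    qed
    have pd: "pd j (\<theta> t) x = fser (dcoef j ?a) x" for j x
      using fser_pd[OF hsb_l1[OF h], of j x] \<theta>eq by simp
    have vd: "vector_derivative (\<lambda>r. \<theta> r x) (at t within {0..T}) = g t x" for x
      unfolding g_def using vector_derivative_within_cbox[OF T _, of t "\<lambda>r. \<theta> r x"] D(2)[OF t, of x] t by simp
    let ?N = "\<lambda>x. \<Sum>j\<in>UNIV. fser (vel ?a j) x * fser (dcoef j ?a) x"
    have N: "?N \<in> torus_L1" "fcoeff ?N k = Bil ?a ?a k"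
      using transport_fcoeff[OF h fcoeff_real] by auto
    have "AE x in lebesgue. g t x = S x - ?N x"
      using u(2)[OF t]
    proof eventually_elim
      case (elim x)
      then show ?case by (simp add: vd pd velocity_unique[OF h u(1)[OF t]])
    qed
    then have "fcoeff (g t) k = fcoeff (\<lambda>x. S x - ?N x) k"
      using L1_diff[OF S N(1)] borel_measurable_lebesgueI[OF borel_measurable_continuous_onI[OF gt[OF t]]]
      by (intro fcoeff_AE_cong) (auto simp: torus_L1_def)
    also have "\<dots> = fcoeff S k - Bil ?a ?a k" by (simp add: fcoeff_diff[OF S N(1)] N(2))
    finally show ?thesis using der[OF t, of k] by simp
  qed
qed

end

section \<open>From Fourier coefficients to classical solutions\<close>

context transport_symbol begin

lemma Bil_partial:
  assumes a: "hsb a E" and b: "hsb b E"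
  shows "cmod ((\<Sum>p\<in>fball n. tm a b k p) - Bil a b k) \<le> K * sqrt E * (sqrt E * \<rho> n)"
proof (rule partial_sum_diff_le[OF Bil_lim[OF a b]])
  fix F :: "(int^'d) set" assume F: "finite F" "F \<inter> fball n = {}"
  have E: "0 \<le> E" by (rule hsb_nonneg[OF a])
  have "(\<Sum>p\<in>F. cmod (tm a b k p)) \<le> (\<Sum>p\<in>F. K * (sqrt E * (jb p * cmod (b p))))"
    using K_nonneg hsb_cmod[OF a]
    by (intro sum_mono order_trans[OF norm_tm] mult_left_mono mult_right_mono) auto
  also have "\<dots> = K * sqrt E * (\<Sum>p\<in>F. jb p * cmod (b p))" by (simp add: sum_distrib_left mult_ac)
  also have "\<dots> \<le> K * sqrt E * (sqrt E * \<rho> n)"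
    using K_nonneg E by (intro mult_left_mono hsb_l1_tail[OF b F]) auto
  finally show "(\<Sum>p\<in>F. cmod (tm a b k p)) \<le> K * sqrt E * (sqrt E * \<rho> n)" .
qed

lemma Bil_continuous:
  assumes a: "\<And>t. t \<in> A \<Longrightarrow> hsb (a t) E" and cont: "\<And>k. continuous_on A (\<lambda>t. a t k)"
  shows "continuous_on A (\<lambda>t. Bil (a t) (a t) k)"
proof (rule uniform_limit_theorem)
  show "\<forall>\<^sub>F n in sequentially. continuous_on A (\<lambda>t. \<Sum>p\<in>fball n. tm (a t) (a t) k p)"
    unfolding tm_def by (intro always_eventually allI continuous_intros cont)
  show "uniform_limit A (\<lambda>n t. \<Sum>p\<in>fball n. tm (a t) (a t) k p) (\<lambda>t. Bil (a t) (a t) k) sequentially"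
  proof (rule uniform_limitI)
    fix e :: real assume e: "0 < e"
    have "(\<lambda>n. K * sqrt E * (sqrt E * \<rho> n)) \<longlonglongrightarrow> K * sqrt E * (sqrt E * 0)"
      by (intro tendsto_intros \<rho>_tendsto)
    then have "\<forall>\<^sub>F n in sequentially. K * sqrt E * (sqrt E * \<rho> n) < e"
      using e by (intro order_tendstoD(2)) auto
    then show "\<forall>\<^sub>F n in sequentially. \<forall>t\<in>A. dist (\<Sum>p\<in>fball n. tm (a t) (a t) k p) (Bil (a t) (a t) k) < e"
    proof eventually_elim
      case (elim n)
      show ?case
      proof
        fix t assume "t \<in> A"
        from Bil_partial[OF a[OF this] a[OF this], where n=n and k=k] elim
        show "dist (\<Sum>p\<in>fball n. tm (a t) (a t) k p) (Bil (a t) (a t) k) < e" by (simp add: dist_norm)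
      qed
    qed
  qed
qed simp

lemma Bil_real:
  assumes "real_seq a"
  shows "real_seq (Bil a a)"
  unfolding real_seq_def
proof
  fix k
  have "Bil a a (- k) = infsum (\<lambda>p. tm a a (- k) (- p)) UNIV"
    unfolding Bil_def
    by (rule infsum_reindex_bij_betw[symmetric]) (simp add: bij_uminus)
  also have "\<dots> = infsum (\<lambda>p. cnj (tm a a k p)) UNIV" by (simp only: tm_real[OF assms])
  also have "\<dots> = cnj (Bil a a k)" unfolding Bil_def by (rule infsum_cnj)
  finally show "Bil a a (- k) = cnj (Bil a a k)" .
qed

end

lemma zero_mean_fcoeff: "zero_mean f \<longleftrightarrow> fcoeff f 0 = 0"
proof -
  have "(LINT x:torus_cell|lebesgue. complex_of_real (f x) * ew 0 x) = of_real (LINT x:torus_cell|lebesgue. f x)"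
    unfolding set_lebesgue_integral_def integral_complex_of_real[symmetric]
    by (simp add: scaleR_conv_of_real)
  then show ?thesis by (simp add: zero_mean_def fcoeff_ew)
qed

context as_symbol begin

lemma fser_Hs:
  assumes c: "hsb c E" "real_seq c"
  shows "fser c \<in> Hs s"
proof -
  have cont: "continuous_on UNIV (fser c)" by (rule fser_differentiable(2)[OF hsb_l1[OF c(1)]])
  have "(\<lambda>x. (fser c x)\<^sup>2) \<in> torus_L1"
    by (rule periodic_continuous_L1) (use periodic_fser[of c] cont in \<open>auto simp: periodic_def intro!: continuous_intros\<close>)
  then have "fser c \<in> torus_L2"
    using fser_L1[OF hsb_l10[OF c(1)]] by (simp add: torus_L2_def torus_L1_def)
  moreover have "Hs_weight s (fser c) summable_on UNIV"
    unfolding Hs_weight_eq[abs_def] fcoeff_fser[OF hsb_l10[OF c(1)] c(2)]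
    by (rule sums_le_summable) (use c(1) in \<open>auto simp: hsb_def\<close>)
  ultimately show ?thesis by (simp add: Hs_def)
qed

lemma Hs_norm_le:
  assumes "hsb (fcoeff f) E"
  shows "Hs_norm s f \<le> sqrt E"
  unfolding Hs_norm_def Hs_weight_eq
  by (intro real_sqrt_le_mono sums_le_infsum) (use assms in \<open>auto simp: hsb_def\<close>)

definition proj :: "nat \<Rightarrow> (int^'d \<Rightarrow> complex) \<Rightarrow> int^'d \<Rightarrow> complex" where
  "proj n c k = (if k \<in> fball n then c k else 0)"

lemma hsb_proj:
  assumes "hsb c E"
  shows "hsb (proj n c) E"
  unfolding hsb_def by (rule sums_le_mono[OF assms[unfolded hsb_def]]) (auto simp: proj_def)

lemma real_seq_proj: "real_seq c \<Longrightarrow> real_seq (proj n c)"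
  by (simp add: real_seq_def proj_def)

text \<open>
  The simple approximations truncate to the frequencies in \<open>fball n\<close> and freeze time on a grid that is so
  fine that the finitely many coefficients, which are uniformly continuous, change by less than
  \<open>1 / Suc n\<close> in total. The truncation error is the tail of a convergent sum for every fixed time.
\<close>

lemma strongly_measurable:
  fixes a :: "real \<Rightarrow> int^'d \<Rightarrow> complex"
  assumes T: "0 < T" and a: "\<And>t. t \<in> {0..T} \<Longrightarrow> hsb (a t) E \<and> real_seq (a t)"
    and cont: "\<And>k. continuous_on {0..T} (\<lambda>t. a t k)"
  shows "(\<lambda>t. fser (a t)) \<in> Linf_Hs T s"
proof -
  define close where "close n d \<longleftrightarrow> (\<forall>t\<in>{0..T}. \<forall>t'\<in>{0..T}. \<bar>t' - t\<bar> < d \<longrightarrow>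
      (\<Sum>k\<in>fball n. (w k * cmod (a t' k - a t k))\<^sup>2) < 1 / real (Suc n))" for n d
  have "\<exists>d. 0 < d \<and> close n d" for n
  proof -
    let ?G = "\<lambda>p. \<Sum>k\<in>fball n. (w k * cmod (a (fst p) k - a (snd p) k))\<^sup>2"
    have "continuous_on ({0..T} \<times> {0..T}) ?G"
      by (intro continuous_intros continuous_on_compose2[OF cont]) auto
    then have "uniformly_continuous_on ({0..T} \<times> {0..T}) ?G"
      by (rule compact_uniformly_continuous) (intro compact_Times compact_Icc)
    moreover have "0 < 1 / real (Suc n)" by simp
    ultimately obtain d where d: "d > 0" "\<forall>p\<in>{0..T} \<times> {0..T}. \<forall>q\<in>{0..T} \<times> {0..T}. dist q p < d \<longrightarrow> dist (?G q) (?G p) < 1 / real (Suc n)"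
      unfolding uniformly_continuous_on_def by blast
    have "(\<Sum>k\<in>fball n. (w k * cmod (a t' k - a t k))\<^sup>2) < 1 / real (Suc n)" if "t \<in> {0..T}" "t' \<in> {0..T}" "\<bar>t' - t\<bar> < d" for t t'
    proof -
      have "dist (t', t) (t, t) < d" using that(3) by (simp add: dist_Pair_Pair dist_real_def)
      then have "dist (?G (t', t)) (?G (t, t)) < 1 / real (Suc n)"
        using d(2) that by blast
      moreover have "?G (t, t) = 0" by simp
      ultimately have "?G (t', t) < 1 / real (Suc n)" unfolding dist_real_def by linarith
      then show ?thesis by (simp only: fst_conv snd_conv)
    qed
    then have "close n d" unfolding close_def by blast
    then show ?thesis using d(1) by blast
  qed
  then have "\<forall>n. \<exists>d. 0 < d \<and> close n d" by blast
  from choice[OF this] obtain d where d0: "\<forall>n. 0 < d n \<and> close n (d n)" by blast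
  then have d: "\<And>n. d n > 0" "\<And>n t t'. t \<in> {0..T} \<Longrightarrow> t' \<in> {0..T} \<Longrightarrow> \<bar>t' - t\<bar> < d n \<Longrightarrow>
      (\<Sum>k\<in>fball n. (w k * cmod (a t' k - a t k))\<^sup>2) < 1 / real (Suc n)"
    unfolding close_def by blast+
  have "\<exists>N::nat. 0 < N \<and> T / real N < d n" for n
  proof -
    obtain N where N: "T / d n < real N" using reals_Archimedean2 by blast
    have "0 < T / d n" using T d(1) by simp
    then have "0 < real N" using N by linarith
    then show ?thesis using N d(1)[of n] by (intro exI[of _ N]) (simp add: field_simps)
  qed
  then have "\<forall>n. \<exists>N::nat. 0 < N \<and> T / real N < d n" by blast
  from choice[OF this] obtain N where "\<forall>n. 0 < N n \<and> T / real (N n) < d n" by blast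
  then have N: "\<And>n. 0 < N n" "\<And>n. T / real (N n) < d n" by blast+
  \<comment> \<open>Grid points, and the index of the last grid point before \<open>t\<close>.\<close>
  define gr where "gr n j = T * real_of_int j / real (N n)" for n j
  define fl where "fl n t = \<lfloor>t * real (N n) / T\<rfloor>" for n t
  have fl: "fl n t \<in> {0..int (N n)}" "gr n (fl n t) \<in> {0..T}" "\<bar>gr n (fl n t) - t\<bar> < d n" if t: "t \<in> {0<..<T}" for n t
  proof -
    have Np: "0 < real (N n)" using N(1) by simp
    let ?y = "t * real (N n) / T"
    have y: "0 \<le> ?y" "?y \<le> real (N n)" using t T Np by (auto simp: field_simps)
    have f: "real_of_int (fl n t) \<le> ?y" "?y < real_of_int (fl n t) + 1" unfolding fl_def by linarith+
    have f0: "0 \<le> fl n t" unfolding fl_def using y by simp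
    show "fl n t \<in> {0..int (N n)}" using f0 f y by auto
    have g1: "gr n (fl n t) \<le> t" using f(1) T Np by (simp add: gr_def field_simps)
    have g2: "t < gr n (fl n t) + T / real (N n)" using f(2) T Np by (simp add: gr_def field_simps)
    have g0: "0 \<le> gr n (fl n t)" using f0 T Np by (simp add: gr_def)
    show "gr n (fl n t) \<in> {0..T}" using g0 g1 t by auto
    show "\<bar>gr n (fl n t) - t\<bar> < d n" using g1 g2 N(2)[of n] by linarith
  qed
  define \<phi> where "\<phi> n t = fser (proj n (a (gr n (fl n t))))" for n t
  have simple: "simple_Hs T s (\<phi> n)" for n
    unfolding simple_Hs_def
  proof (intro conjI allI)
    have "\<phi> n ` {0<..<T} \<subseteq> (\<lambda>j. fser (proj n (a (gr n j)))) ` {0..int (N n)}"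
      unfolding \<phi>_def using fl(1) by blast
    then show "finite (\<phi> n ` {0<..<T})" by (rule finite_subset) simp
    show "\<phi> n ` {0<..<T} \<subseteq> Hs s"
    proof
      fix f assume "f \<in> \<phi> n ` {0<..<T}"
      then obtain t where t: "t \<in> {0<..<T}" "f = \<phi> n t" by blast
      have "hsb (a (gr n (fl n t))) E" "real_seq (a (gr n (fl n t)))" using a[OF fl(2)[OF t(1)]] by auto
      then show "f \<in> Hs s" unfolding t(2) \<phi>_def by (intro fser_Hs[OF hsb_proj real_seq_proj])
    qed
    fix g
    have "fl n -` {j. fser (proj n (a (gr n j))) = g} \<inter> space borel \<in> sets borel"
    proof (rule measurable_sets)
      show "fl n \<in> borel \<rightarrow>\<^sub>M count_space UNIV" unfolding fl_def by measurable
    qed simp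
    then have "{0<..<T} \<inter> fl n -` {j. fser (proj n (a (gr n j))) = g} \<in> sets borel" by auto
    moreover have "{t \<in> {0<..<T}. \<phi> n t = g} = {0<..<T} \<inter> fl n -` {j. fser (proj n (a (gr n j))) = g}"
      by (auto simp: \<phi>_def)
    ultimately show "{t \<in> {0<..<T}. \<phi> n t = g} \<in> sets lebesgue"
      by (metis sets_completionI_sets sets_lborel)
  qed
  have conv: "(\<lambda>n. Hs_norm s (\<lambda>x. \<phi> n t x - fser (a t) x)) \<longlonglongrightarrow> 0" if t: "t \<in> {0<..<T}" for t
  proof -
    have tt: "t \<in> {0..T}" using t by auto
    let ?f = "\<lambda>k. (w k * cmod (a t k))\<^sup>2"
    have s: "?f summable_on A" for A
      by (rule sums_le_summable) (use a[OF tt] in \<open>auto simp: hsb_def\<close>)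
    define q where "q n = infsum ?f (- fball n)" for n
    have q: "q \<longlonglongrightarrow> 0" unfolding q_def[abs_def] by (rule infsum_tail_tendsto[OF s])
    have le: "Hs_norm s (\<lambda>x. \<phi> n t x - fser (a t) x) \<le> sqrt (1 / real (Suc n) + q n)" for n
    proof (rule Hs_norm_le)
      let ?b = "proj n (a (gr n (fl n t)))"
      have ab: "hsb (a (gr n (fl n t))) E" "real_seq (a (gr n (fl n t)))" using a[OF fl(2)[OF t]] by auto
      have P: "fser ?b \<in> torus_L1" "fcoeff (fser ?b) = ?b"
        using hsb_l10[OF hsb_proj[OF ab(1)]] real_seq_proj[OF ab(2)] by (auto intro: fser_L1 fcoeff_fser)
      have A: "fser (a t) \<in> torus_L1" "fcoeff (fser (a t)) = a t"
        using hsb_l10 a[OF tt] by (auto intro: fser_L1 fcoeff_fser)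
      have "fcoeff (\<lambda>x. \<phi> n t x - fser (a t) x) k = ?b k - a t k" for k
        unfolding \<phi>_def fcoeff_diff[OF P(1) A(1)] P(2) A(2) ..
      then have fc: "fcoeff (\<lambda>x. \<phi> n t x - fser (a t) x) = (\<lambda>k. ?b k - a t k)" by (rule ext)
      show "hsb (fcoeff (\<lambda>x. \<phi> n t x - fser (a t) x)) (1 / real (Suc n) + q n)"
        unfolding fc hsb_def sums_le_def
      proof (intro allI impI)
        fix F :: "(int^'d) set" assume F: "finite F"
        let ?h = "\<lambda>k. (w k * cmod (?b k - a t k))\<^sup>2"
        have "sum ?h F = sum ?h (F \<inter> fball n) + sum ?h (F - fball n)"
          using F by (subst sum.union_disjoint[symmetric]) (auto intro!: sum.cong)
        also have "sum ?h (F \<inter> fball n) \<le> sum ?h (fball n)" by (intro sum_mono2) auto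
        also have "sum ?h (fball n) = (\<Sum>k\<in>fball n. (w k * cmod (a (gr n (fl n t)) k - a t k))\<^sup>2)"
          by (intro sum.cong refl) (simp add: proj_def)
        also have "\<dots> \<le> 1 / real (Suc n)" using d(2)[OF tt fl(2,3)[OF t]] by (rule less_imp_le)
        also have "sum ?h (F - fball n) = sum ?f (F - fball n)"
          by (intro sum.cong refl) (simp add: proj_def)
        also have "\<dots> \<le> q n" unfolding q_def using F by (intro finite_sum_le_infsum s) auto
        finally show "sum ?h F \<le> 1 / real (Suc n) + q n" by simp
      qed
    qed
    have "(\<lambda>n. 1 / real (Suc n)) \<longlonglongrightarrow> 0" using LIMSEQ_inverse_real_of_nat by (simp add: inverse_eq_divide)
    from tendsto_real_sqrt[OF tendsto_add[OF this q]]
    have "(\<lambda>n. sqrt (1 / real (Suc n) + q n)) \<longlonglongrightarrow> 0" by simp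
    then show ?thesis
    proof (rule Lim_null_comparison[rotated])
      have "0 \<le> Hs_norm s f" for f :: "real^'d \<Rightarrow> real"
        unfolding Hs_norm_def Hs_weight_eq by (intro real_sqrt_ge_zero infsum_nonneg) simp
      then show "\<forall>\<^sub>F n in sequentially. norm (Hs_norm s (\<lambda>x. \<phi> n t x - fser (a t) x)) \<le> sqrt (1 / real (Suc n) + q n)"
        using le by (intro always_eventually allI) simp
    qed
  qed
  have AE: "AE t in lebesgue_on {0<..<T}. P t" if "\<And>t. t \<in> {0<..<T} \<Longrightarrow> P t" for P
    by (rule AE_I2) (use that in auto)
  show ?thesis
    unfolding Linf_Hs_def
  proof (intro CollectI conjI)
    show "\<exists>M. AE t in lebesgue_on {0<..<T}. fser (a t) \<in> Hs s \<and> Hs_norm s (fser (a t)) \<le> M"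
    proof (intro exI AE conjI)
      fix t assume "t \<in> {0<..<T}"
      then have t: "hsb (a t) E" "real_seq (a t)" using a by auto
      show "fser (a t) \<in> Hs s" by (rule fser_Hs[OF t])
      show "Hs_norm s (fser (a t)) \<le> sqrt E"
        by (rule Hs_norm_le) (simp add: fcoeff_fser[OF hsb_l10[OF t(1)] t(2)] t(1))
    qed
    show "\<exists>\<phi>. (\<forall>n. simple_Hs T s (\<phi> n)) \<and>
       (AE t in lebesgue_on {0<..<T}. (\<lambda>n. Hs_norm s (\<lambda>x. \<phi> n t x - fser (a t) x)) \<longlonglongrightarrow> 0)"
      using simple conv by (intro exI[of _ \<phi>] conjI allI AE) auto
  qed
qed

text \<open>
  The coefficients of \<open>\<partial>\<^sub>t\<theta> + u \<bullet> \<nabla>\<theta>\<close> and of \<open>S\<close> agree, so the two functions agree almost everywhere. The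
  mean is conserved because \<open>Bil a a 0 = 0\<close>.
\<close>

lemma classical_solution:
  fixes a :: "real \<Rightarrow> int^'d \<Rightarrow> complex"
  assumes T: "0 < T" and a: "\<And>t. t \<in> {0..T} \<Longrightarrow> real_seq (a t) \<and> hsb (a t) E"
    and der: "\<And>t k. t \<in> {0..T} \<Longrightarrow>
      ((\<lambda>t. a t k) has_vector_derivative fcoeff S k - Bil (a t) (a t) k) (at t within {0..T})"
    and S: "S \<in> torus_L1" "hsb (fcoeff S) ES" "zero_mean S"
    and init: "a 0 = fcoeff \<theta>0" and \<theta>0: "\<theta>0 \<in> torus_L1" "zero_mean \<theta>0" and m: "m 0 = \<mu>"
  shows "AS_solution m 0 S \<theta>0 T (\<lambda>t. fser (a t))" "(\<lambda>t. fser (a t)) \<in> Linf_Hs T s"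
proof -
  define c' where "c' t k = fcoeff S k - Bil (a t) (a t) k" for t k
  have E: "0 \<le> E" using a[of 0] T hsb_nonneg by auto
  have cont: "continuous_on {0..T} (\<lambda>t. a t k)" for k
    unfolding continuous_on_eq_continuous_within using der has_vector_derivative_continuous by blast
  show "(\<lambda>t. fser (a t)) \<in> Linf_Hs T s"
    using a by (intro strongly_measurable[OF T _ cont]) auto
  have cont': "continuous_on {0..T} (\<lambda>t. c' t k)" for k
    unfolding c'_def using a by (intro continuous_intros Bil_continuous[where E=E] cont) auto
  let ?K = "D * (D * C0)"
  \<comment> \<open>A common bound for the tails of \<open>a t\<close> and \<open>c' t\<close>. The index \<open>n div 2\<close> comes from \<open>Bil_l1_tail\<close>, as
    \<open>fball (n div 2 + n div 2) \<subseteq> fball n\<close>.\<close>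
  define r where "r n = sqrt E * \<rho> n + sqrt ES * \<rho> n + 2 * ?K * E * \<kappa> * \<rho> (n div 2)" for n
  have K: "0 \<le> ?K" by (rule K_nonneg)
  have ES: "0 \<le> ES" by (rule hsb_nonneg[OF S(2)])
  have "filterlim (\<lambda>n::nat. n div 2) at_top sequentially"
    unfolding filterlim_at_top
  proof
    fix N :: nat
    show "\<forall>\<^sub>F n in sequentially. N \<le> n div 2"
      unfolding eventually_sequentially by (intro exI[of _ "2 * N"]) auto
  qed
  then have "(\<lambda>n. \<rho> (n div 2)) \<longlonglongrightarrow> 0" by (rule filterlim_compose[OF \<rho>_tendsto])
  then have "(\<lambda>n. sqrt E * \<rho> n + sqrt ES * \<rho> n + 2 * ?K * E * \<kappa> * \<rho> (n div 2)) \<longlonglongrightarrow> sqrt E * 0 + sqrt ES * 0 + 2 * ?K * E * \<kappa> * 0"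
    by (intro tendsto_intros \<rho>_tendsto)
  then have r: "r \<longlonglongrightarrow> 0" unfolding r_def[abs_def] by simp
  have pos: "0 \<le> sqrt E * \<rho> n" "0 \<le> sqrt ES * \<rho> n" "0 \<le> 2 * ?K * E * \<kappa> * \<rho> (n div 2)" for n
    using E ES K by auto
  have tail: "(\<Sum>k\<in>F. jb k * cmod (a t k)) \<le> r n" if "t \<in> {0..T}" "finite F" "F \<inter> fball n = {}" for n t F
    using hsb_l1_tail[OF conjunct2[OF a[OF that(1)]] that(2,3)] pos[of n] unfolding r_def by linarith
  have tail': "(\<Sum>k\<in>F. cmod (c' t k)) \<le> r n" if "t \<in> {0..T}" "finite F" "F \<inter> fball n = {}" for n t F
  proof -
    have h: "hsb (a t) E" using a[OF that(1)] by blast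
    have "fball (n div 2 + n div 2) \<subseteq> (fball n :: (int^'d) set)" by (rule fball_mono) simp
    then have "F \<inter> fball (n div 2 + n div 2) = {}" using that(3) by blast
    then have B: "(\<Sum>k\<in>F. cmod (Bil (a t) (a t) k)) \<le> 2 * ?K * E * \<kappa> * \<rho> (n div 2)"
      by (rule Bil_l1_tail[OF h h that(2)])
    have "(\<Sum>k\<in>F. cmod (c' t k)) \<le> (\<Sum>k\<in>F. cmod (fcoeff S k) + cmod (Bil (a t) (a t) k))"
      unfolding c'_def by (intro sum_mono norm_triangle_ineq4)
    also have "\<dots> \<le> sqrt ES * \<rho> n + 2 * ?K * E * \<kappa> * \<rho> (n div 2)"
      unfolding sum.distrib by (intro add_mono B hsb_l1_tail0[OF S(2) that(2,3)])
    finally show ?thesis using pos[of n] unfolding r_def by linarith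
  qed
  note st0 = spacetime_C1[OF less_imp_le[OF T] der[folded c'_def] cont' r tail tail']
  have st1: "continuous_on ({0..T} \<times> UNIV) (\<lambda>(t, x). fser (c' t) x)"
    by (rule st0(1))
  have st2: "continuous_on ({0..T} \<times> UNIV) (\<lambda>(t, x). fser (dcoef j (a t)) x)" for j
    by (rule st0(2))
  have st3: "((\<lambda>(t, x). fser (a t) x) has_derivative
        (\<lambda>(\<tau>, \<xi>). \<tau> * fser (c' t) x + (\<Sum>j\<in>UNIV. \<xi> $ j * fser (dcoef j (a t)) x))) (at (t, x) within {0..T} \<times> UNIV)"
    if "t \<in> {0..T}" for t x
    using that by (rule st0(3)[rotated -1])
  have c'l1: "sums_le (\<lambda>k. cmod (c' t k)) ((\<Sum>k\<in>fball 0. cmod (c' t k)) + r 0)" if "t \<in> {0..T}" for t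
    by (rule sums_le_of_tail[OF tail'[OF that]]) auto
  have c'r: "real_seq (c' t)" if "t \<in> {0..T}" for t
    using Bil_real[of "a t"] a[OF that] fcoeff_real[of S] by (simp add: c'_def real_seq_def)
  have a0: "a t 0 = 0" if t: "t \<in> {0..T}" for t
  proof -
    obtain c where c: "\<And>t. t \<in> {0..T} \<Longrightarrow> a t 0 = c"
    proof (rule has_vector_derivative_zero_constant[of "{0..T}" "\<lambda>t. a t 0"])
      fix t assume "t \<in> {0..T}"
      then show "((\<lambda>t. a t 0) has_vector_derivative 0) (at t within {0..T})"
        using der[of t 0] S(3) by (simp add: Bil_zero zero_mean_fcoeff)
    qed auto
    then show ?thesis using c[OF t] c[of 0] T init \<theta>0(2) by (simp add: zero_mean_fcoeff)
  qed
  have bl: "bounded_linear (\<lambda>h :: real \<times> (real^'d). snd h $ j)" for j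
    by (rule bounded_linear_compose[OF bounded_linear_vec_nth bounded_linear_snd])
  define Dp where "Dp p = fser (c' (fst p)) (snd p) *\<^sub>R Blinfun fst +
     (\<Sum>j\<in>UNIV. fser (dcoef j (a (fst p))) (snd p) *\<^sub>R Blinfun (\<lambda>h :: real \<times> (real^'d). snd h $ j))" for p :: "real \<times> (real^'d)"
  have Dp: "blinfun_apply (Dp (t, x)) = (\<lambda>(\<tau>, \<xi>). \<tau> * fser (c' t) x + (\<Sum>j\<in>UNIV. \<xi> $ j * fser (dcoef j (a t)) x))" for t x
    by (rule ext) (simp add: Dp_def blinfun.add_left blinfun.sum_left blinfun.scaleR_left
        bounded_linear_Blinfun_apply[OF bounded_linear_fst] bounded_linear_Blinfun_apply[OF bl] case_prod_unfold mult.commute)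
  have C1: "C1_strip T (\<lambda>t. fser (a t))"
  proof -
    have c1: "continuous_on ({0..T} \<times> UNIV) (\<lambda>p. fser (c' (fst p)) (snd p))"
      using st1 unfolding case_prod_unfold .
    have c2: "continuous_on ({0..T} \<times> UNIV) (\<lambda>p. fser (dcoef j (a (fst p))) (snd p))" for j
      using st2[of j] unfolding case_prod_unfold .
    have "continuous_on ({0..T} \<times> UNIV) Dp"
      unfolding Dp_def
      by (intro continuous_on_add continuous_on_sum continuous_on_scaleR continuous_on_const c1 c2)
    moreover have "((\<lambda>(t, x). fser (a t) x) has_derivative blinfun_apply (Dp p)) (at p within {0..T} \<times> UNIV)"
      if p: "p \<in> {0..T} \<times> UNIV" for p
    proof -
      obtain t x where tx: "p = (t, x)" "t \<in> {0..T}" using p by blast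
      show ?thesis unfolding tx(1) Dp by (rule st3[OF tx(2)])
    qed
    ultimately show ?thesis unfolding C1_strip_def by blast
  qed
  have vd: "vector_derivative (\<lambda>r. fser (a r) x) (at t within {0..T}) = fser (c' t) x" if t: "t \<in> {0..T}" for t x
  proof -
    have "((\<lambda>r. fser (a r) x) has_vector_derivative fser (c' t) x) (at t within {0..T})"
      using time_slice_derivative[OF st3[OF t, of x]] by (simp add: has_vector_derivative_def)
    then show ?thesis
      using vector_derivative_within_cbox[OF T _, of t "\<lambda>r. fser (a r) x"] t by simp
  qed
  show "AS_solution m 0 S \<theta>0 T (\<lambda>t. fser (a t))"
    unfolding AS_solution_def
  proof (intro conjI C1 ballI exI[of _ "\<lambda>t x. \<chi> j. fser (vel (a t) j) x"])
    fix t assume t: "t \<in> {0..T}"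
    have h: "hsb (a t) E" and re: "real_seq (a t)" using a[OF t] by auto
    show "periodic (fser (a t))" by (rule periodic_fser)
    show "zero_mean (fser (a t))"
      by (simp add: zero_mean_fcoeff fcoeff_fser[OF hsb_l10[OF h] re] a0[OF t])
    show "velocity (m 0) (fser (a t)) (\<lambda>x. \<chi> j. fser (vel (a t) j) x)"
      unfolding m by (rule velocity_exists[OF h re])
    let ?N = "\<lambda>x. \<Sum>j\<in>UNIV. fser (vel (a t) j) x * fser (dcoef j (a t)) x"
    have N: "?N \<in> torus_L1" "\<And>k. fcoeff ?N k = Bil (a t) (a t) k"
      using transport_fcoeff[OF h re] by auto
    note c1 = fser_L1[OF c'l1[OF t]]
    have "AE x in lebesgue. fser (c' t) x + ?N x = S x"
    proof (rule AE_eq_of_fcoeff[OF L1_add[OF c1 N(1)] S(1)])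
      fix k
      show "fcoeff (\<lambda>x. fser (c' t) x + ?N x) k = fcoeff S k"
        by (simp add: fcoeff_add[OF c1 N(1)] N(2) fcoeff_fser[OF c'l1[OF t] c'r[OF t]]) (simp add: c'_def)
    qed
    then show "AE x in lebesgue. vector_derivative (\<lambda>r. fser (a r) x) (at t within {0..T}) +
       (\<Sum>j\<in>UNIV. (\<chi> j. fser (vel (a t) j) x) $ j * pd j (fser (a t)) x) = S x"
      by (simp add: vd[OF t] fser_pd[OF hsb_l1[OF h]])
  next
    have z: "0 \<in> {0..T}" using T by simp
    have h: "hsb (a 0) E" and re: "real_seq (a 0)" using a[OF z] by auto
    show "AE x in lebesgue. fser (a 0) x = \<theta>0 x"
      by (rule AE_eq_of_fcoeff[OF fser_L1[OF hsb_l10[OF h]] \<theta>0(1)])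
        (simp only: fcoeff_fser[OF hsb_l10[OF h] re], simp only: init)
  qed
qed

section \<open>Local well-posedness\<close>

lemma well_posed:
  assumes \<theta>0: "\<theta>0 \<in> Hs s" "zero_mean \<theta>0" and S: "S \<in> Hs s" "zero_mean S" and m: "m 0 = \<mu>"
  shows "\<exists>T>0. (\<exists>\<theta>. AS_solution m 0 S \<theta>0 T \<theta> \<and> \<theta> \<in> Linf_Hs T s) \<and>
    (\<forall>\<theta> \<eta>. AS_solution m 0 S \<theta>0 T \<theta> \<and> \<theta> \<in> Linf_Hs T s \<and>
           AS_solution m 0 S \<theta>0 T \<eta> \<and> \<eta> \<in> Linf_Hs T s \<longrightarrow>
           (\<forall>t\<in>{0..T}. \<forall>x. \<theta> t x = \<eta> t x))"
proof -
  have L1: "\<theta>0 \<in> torus_L1" "S \<in> torus_L1" using \<theta>0 S by (auto simp: Hs_def intro: L2_imp_L1)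
  obtain T E a where T: "0 < T" and a: "\<And>t. t \<in> {0..T} \<Longrightarrow> real_seq (a t) \<and> hsb (a t) E"
    and a0: "\<And>k. a 0 k = fcoeff \<theta>0 k"
    and der: "\<And>t k. t \<in> {0..T} \<Longrightarrow> ((\<lambda>t. a t k) has_vector_derivative fcoeff S k - Bil (a t) (a t) k) (at t within {0..T})"
    using fourier_existence[OF fcoeff_real hsb_Hs[OF \<theta>0(1)] fcoeff_real hsb_Hs[OF S(1)]] by blast
  have a0': "a 0 = fcoeff \<theta>0" using a0 by (rule ext)
  have ex: "AS_solution m 0 S \<theta>0 T (\<lambda>t. fser (a t)) \<and> (\<lambda>t. fser (a t)) \<in> Linf_Hs T s"
    using classical_solution[where m=m and a=a, OF T a der L1(2) hsb_Hs[OF S(1)] S(2) a0' L1(1) \<theta>0(2) m] by blast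
  have un: "\<theta> t x = \<eta> t x"
    if \<theta>: "AS_solution m 0 S \<theta>0 T \<theta>" "\<theta> \<in> Linf_Hs T s" and \<eta>: "AS_solution m 0 S \<theta>0 T \<eta>" "\<eta> \<in> Linf_Hs T s"
      and t: "t \<in> {0..T}" for \<theta> \<eta> t x
  proof -
    note f1 = solution_fourier[OF T \<theta>(1) m \<theta>(2) L1(2,1)]
    note f2 = solution_fourier[OF T \<eta>(1) m \<eta>(2) L1(2,1)]
    obtain E1 E2 where "\<forall>t\<in>{0..T}. hsb (fcoeff (\<theta> t)) E1" "\<forall>t\<in>{0..T}. hsb (fcoeff (\<eta> t)) E2"
      using f1(1) f2(1) by blast
    then have h: "\<And>t. t \<in> {0..T} \<Longrightarrow> hsb (fcoeff (\<theta> t)) (max E1 E2)" "\<And>t. t \<in> {0..T} \<Longrightarrow> hsb (fcoeff (\<eta> t)) (max E1 E2)"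
      using hsb_mono by (metis max.cobounded1, metis max.cobounded2)
    have "fcoeff (\<theta> t) k = fcoeff (\<eta> t) k" for k
    proof (rule uniqueness[where T=T and S="fcoeff S" and a="\<lambda>t. fcoeff (\<theta> t)" and b="\<lambda>t. fcoeff (\<eta> t)"])
      show "real_seq (fcoeff (\<theta> t)) \<and> hsb (fcoeff (\<theta> t)) (max E1 E2)" if "t \<in> {0..T}" for t
        using fcoeff_real h(1)[OF that] by blast
      show "fcoeff (\<theta> 0) k = fcoeff (\<eta> 0) k" for k using f1(3) f2(3) by simp
    qed (use h(2) f1(2) f2(2) t in auto)
    then show ?thesis using f1(4)[OF t] f2(4)[OF t] by (intro continuous_eq_of_fcoeff) auto
  qed
  show ?thesis using T ex un by blast
qed

end

theorem theorem2p4: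
  fixes m :: "'d::finite symbols"
    and \<theta>0 S :: "real^'d \<Rightarrow> real"
    and s :: real
  assumes "CARD('d) \<ge> 2"
    and "s > real CARD('d) / 2 + 1"
    and "\<theta>0 \<in> Hs s" and "S \<in> Hs s"
    and "zero_mean \<theta>0" and "zero_mean S"
    and "divergence_free m" and "Linf_to_BMO_bounded m" and "gradient_bounded m"
  shows "\<exists>T>0.
    (\<exists>\<theta>. AS_solution m 0 S \<theta>0 T \<theta> \<and> \<theta> \<in> Linf_Hs T s) \<and>
    (\<forall>\<theta> \<eta>. AS_solution m 0 S \<theta>0 T \<theta> \<and> \<theta> \<in> Linf_Hs T s \<and>
           AS_solution m 0 S \<theta>0 T \<eta> \<and> \<eta> \<in> Linf_Hs T s \<longrightarrow>
           (\<forall>t\<in>{0..T}. \<forall>x. \<theta> t x = \<eta> t x))"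
proof -
  note A2 = symbol_bounded_cnj[OF assms(8) order_refl]
  obtain C0 where C0: "\<And>i j k. cmod (of_int (k $ i) * m 0 i j k) \<le> C0"
    using assms(9) unfolding gradient_bounded_def by blast
  obtain C where C: "\<And>i j k. cmod (m 0 i j k) \<le> C i j" using A2(2) by metis
  define Cm where "Cm = (\<Sum>i\<in>UNIV. \<Sum>j\<in>UNIV. \<bar>C i j\<bar>)"
  have Cm: "cmod (m 0 i j k) \<le> Cm" for i j k
  proof -
    have "cmod (m 0 i j k) \<le> \<bar>C i j\<bar>" using C[of i j k] by linarith
    also have "\<dots> \<le> (\<Sum>j\<in>UNIV. \<bar>C i j\<bar>)" by (rule member_le_sum) auto
    also have "\<dots> \<le> Cm" unfolding Cm_def
      by (rule member_le_sum[of i UNIV "\<lambda>i. \<Sum>j\<in>UNIV. \<bar>C i j\<bar>"]) (auto intro: sum_nonneg)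
    finally show ?thesis .
  qed
  interpret as_symbol "m 0" C0 Cm s
  proof
    show "m 0 i j (- k) = cnj (m 0 i j k)" for i j k by (rule A2(1))
    show "(\<Sum>i\<in>UNIV. \<Sum>j\<in>UNIV. of_int (k $ i) * of_int (k $ j) * m 0 i j k) = 0" for k
      by (rule symbol_divfree[OF assms(7) order_refl A2])
  qed (use Cm C0 assms(2) in auto)
  show ?thesis by (rule well_posed[where m=m, OF assms(3,5,4,6) refl])
qed

end
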